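(* Let $\Sigma$ be a compact surface hyperbolically mapped, relative to $v_1, \dots, v_n \in \partial\Sigma$, into a general hyperbolic manifold $M$, and suppose that each arc in $\partial \Sigma - \{v_1, \dots, v_n\}$ is geodesic. Let $\theta_i$ be the exterior angle at $v_i$ with respect to the geodesics in the boundary of $\Sigma$. Then $$\mathrm{Area}(\Sigma) \leq \sum_i \theta_i - 2\pi \chi(\Sigma).$$
   Context: A general hyperbolic manifold is a $3$-manifold $M$ (in general with nonempty boundary) with an atlas of charts to $\mathbb{H}^3$ with transition maps in $\mathrm{Isom}(\mathbb{H}^3)$, equipped with the length metric of the induced Riemannian metric, which is required to be complete (so $M$ is a geodesic space), and with a triangulation in which each tetrahedron is isometric to a hyperbolic tetrahedron in $\mathbb{H}^3$. Geodesics are geodesics of the ambient manifold $M$. A hyperbolic triangle in $M$ is a totally geodesic subset isometric to a geodesic triangle of $\mathbb{H}^2$ (degenerate ones allowed). Let $\Sigma$ be a compact triangulated hyperbolic surface (each triangle isometric to a possibly degenerate hyperbolic triangle), and let $v_1,\dots,v_n$ be distinguished vertices in $\partial \Sigma$. A map $f:\Sigma\to M$ sending each triangle to a hyperbolic triangle in $M$ is a hyperbolic-map relative to $\{v_1,\dots,v_n\}$ (and $\Sigma$ is then said to be hyperbolically mapped relative to $v_1,\dots,v_n$) if the sum of the angles at $v$ of the image triangles in the stellar neighborhood of $v$ is at least $2\pi$ for every interior vertex $v$, and at least $\pi$ for every boundary vertex $v\neq v_i$. Area and angles of triangles are those of the image triangles. The angle between two geodesics issuing from a common point is the (Alexandrov)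 upper angle, i.e. the limsup of Euclidean comparison angles, which lies in $[0,\pi]$. For an oriented geodesic $l_1$ ending at $x$ and an oriented geodesic $l_2$ starting at $x$, the exterior angle between them is $\pi$ minus the angle in $M$ at $x$ between the reversal of $l_1$ and $l_2$. *)

theory Defs
  imports "HOL-Analysis.Analysis"
begin

section \<open>Hyperbolic space (hyperboloid model)\<close>

definition lorentz :: "real \<times> 'a::euclidean_space \<Rightarrow> real \<times> 'a \<Rightarrow> real" where
  "lorentz p q = snd p \<bullet> snd q - fst p * fst q"

definition hyp_space :: "(real \<times> 'a::euclidean_space) set" where
  "hyp_space = {p. lorentz p p = -1 \<and> fst p > 0}"

definition hdist :: "real \<times> 'a::euclidean_space \<Rightarrow> real \<times> 'a \<Rightarrow> real" where
  "hdist p q = arcosh (- lorentz p q)"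

type_synonym h2 = "real \<times> (real \<times> real)"
type_synonym h3 = "real \<times> (real ^ 3)"

definition hyp_isometry :: "(real \<times> 'a::euclidean_space \<Rightarrow> real \<times> 'a) \<Rightarrow> bool" where
  "hyp_isometry h \<longleftrightarrow> bij_betw h hyp_space hyp_space \<and>
     (\<forall>p\<in>hyp_space. \<forall>q\<in>hyp_space. hdist (h p) (h q) = hdist p q)"

text \<open>Geodesic convex hull of a finite set: geodesics of the hyperboloid are its sections by
  linear planes, so the hull is cut out by the cone of nonnegative combinations.\<close>

definition hhull :: "(real \<times> 'a::euclidean_space) set \<Rightarrow> (real \<times> 'a) set" where
  "hhull Q = {p \<in> hyp_space. \<exists>c. (\<forall>q\<in>Q. 0 \<le> c q) \<and> p = (\<Sum>q\<in>Q. c q *\<^sub>R q)}"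

text \<open>The unit vector tangent to \<^term>\<open>hyp_space\<close> at \<open>p\<close> in the direction of \<open>q \<noteq> p\<close>, the
  unit-speed geodesic it generates, and the angle at \<open>p\<close> of the geodesic triangle \<open>p q r\<close>.\<close>

definition hdir :: "real \<times> 'a::euclidean_space \<Rightarrow> real \<times> 'a \<Rightarrow> real \<times> 'a" where
  "hdir p q = (let u = q + lorentz p q *\<^sub>R p in u /\<^sub>R sqrt (lorentz u u))"

definition hgeod :: "real \<times> 'a::euclidean_space \<Rightarrow> real \<times> 'a \<Rightarrow> real \<Rightarrow> real \<times> 'a" where
  "hgeod p q s = cosh s *\<^sub>R p + sinh s *\<^sub>R hdir p q"

definition hangle :: "real \<times> 'a::euclidean_space \<Rightarrow> real \<times> 'a \<Rightarrow> real \<times> 'a \<Rightarrow> real" where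
  "hangle p q r = arccos (lorentz (hdir p q) (hdir p r))"

text \<open>In the coordinates \<open>x = snd p\<close> the hyperboloid is the graph of \<open>sqrt (1 + \<bar>x\<bar>\<^sup>2)\<close>, and its
  Riemannian area form is \<open>dx / sqrt (1 + \<bar>x\<bar>\<^sup>2)\<close>.\<close>

definition hyp_area :: "h2 set \<Rightarrow> real" where
  "hyp_area S = set_lebesgue_integral lborel (snd ` S) (\<lambda>x. 1 / sqrt (1 + (norm x)\<^sup>2))"


section \<open>Length, geodesics and angles in metric spaces\<close>

definition path_length :: "(real \<Rightarrow> 'm::metric_space) \<Rightarrow> ennreal" where
  "path_length g = (SUP ts \<in> {ts. sorted ts \<and> set ts \<subseteq> {0..1}}.
     \<Sum>i<length ts - 1. ennreal (dist (g (ts ! i)) (g (ts ! Suc i))))"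

text \<open>The length metric induced on a subset; pairs not joined by a rectifiable path in the subset
  get the value 0, which never occurs for distinct points where the metric is compared with
  hyperbolic distance.\<close>

definition intrinsic_dist :: "'m::metric_space set \<Rightarrow> 'm \<Rightarrow> 'm \<Rightarrow> real" where
  "intrinsic_dist T x y =
     enn2real (INF g \<in> {g. path g \<and> path_image g \<subseteq> T \<and> pathstart g = x \<and> pathfinish g = y}.
       path_length g)"

text \<open>Unit-speed (local) geodesics for the distance function \<open>d\<close>.\<close>

definition geodesic_on :: "('m \<Rightarrow> 'm \<Rightarrow> real) \<Rightarrow> real set \<Rightarrow> (real \<Rightarrow> 'm) \<Rightarrow> bool" where
  "geodesic_on d I g \<longleftrightarrow> (\<forall>t\<in>I. \<exists>e>0. \<forall>s\<in>I. \<forall>s'\<in>I.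
     \<bar>s - t\<bar> < e \<longrightarrow> \<bar>s' - t\<bar> < e \<longrightarrow> d (g s) (g s') = \<bar>s - s'\<bar>)"

definition totally_geodesic :: "'m::metric_space set \<Rightarrow> bool" where
  "totally_geodesic T \<longleftrightarrow> (\<forall>g a b. g ` {a..b} \<subseteq> T \<longrightarrow>
     geodesic_on (intrinsic_dist T) {a..b} g \<longrightarrow> geodesic_on dist {a..b} g)"

text \<open>A path on \<open>[0,1]\<close> that is a geodesic after monotone reparametrization.\<close>

definition geodesic_path :: "(real \<Rightarrow> 'm::metric_space) \<Rightarrow> bool" where
  "geodesic_path c \<longleftrightarrow> (\<exists>L g r. geodesic_on dist {0..L} g \<and>
     continuous_on {0..1} r \<and> mono_on {0..1} r \<and> r ` {0..1} = {0..L} \<and>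
     (\<forall>t\<in>{0..1}. c t = g (r t)))"

definition comparison_angle :: "'m::metric_space \<Rightarrow> 'm \<Rightarrow> 'm \<Rightarrow> real" where
  "comparison_angle p x y =
     arccos (((dist p x)\<^sup>2 + (dist p y)\<^sup>2 - (dist x y)\<^sup>2) / (2 * dist p x * dist p y))"

text \<open>Alexandrov upper angle between two curves issuing from \<open>g 0 = h 0\<close>.\<close>

definition upper_angle :: "(real \<Rightarrow> 'm::metric_space) \<Rightarrow> (real \<Rightarrow> 'm) \<Rightarrow> real" where
  "upper_angle g h = real_of_ereal (Limsup (at_right 0 \<times>\<^sub>F at_right 0)
     (\<lambda>(s, t). ereal (comparison_angle (g 0) (g s) (h t))))"

text \<open>The subset \<open>T\<close>, with its induced length metric, is isometric to \<open>hhull Q\<close> via \<open>\<tau>\<close>.\<close>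

definition hyp_isometric_via ::
    "(real \<times> 'a::euclidean_space) set \<Rightarrow> (real \<times> 'a \<Rightarrow> 'm::metric_space) \<Rightarrow> 'm set \<Rightarrow> bool" where
  "hyp_isometric_via Q \<tau> T \<longleftrightarrow> bij_betw \<tau> (hhull Q) T \<and>
     (\<forall>p\<in>hhull Q. \<forall>q\<in>hhull Q. intrinsic_dist T (\<tau> p) (\<tau> q) = hdist p q)"


section \<open>General hyperbolic manifolds\<close>

text \<open>The manifold is the whole metric space \<open>'m\<close>. A chart is a pair of an open set and a map
  defined on it, with values in (not necessarily onto an open subset of) hyperbolic 3-space.\<close>

definition three_manifold_with_boundary :: "'m::metric_space itself \<Rightarrow> bool" where
  "three_manifold_with_boundary _ \<longleftrightarrow>
     (\<exists>\<B>::'m set set. countable \<B> \<and> topological_basis \<B>) \<and>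
     (\<forall>x::'m. \<exists>U V. open U \<and> x \<in> U \<and>
        openin (top_of_set {y :: real ^ 3. y $ 3 \<ge> 0}) V \<and> U homeomorphic V)"

definition hyperbolic_atlas :: "('m::metric_space set \<times> ('m \<Rightarrow> h3)) set \<Rightarrow> bool" where
  "hyperbolic_atlas \<A> \<longleftrightarrow>
     (\<Union>(U, \<phi>)\<in>\<A>. U) = UNIV \<and>
     (\<forall>(U, \<phi>)\<in>\<A>. open U \<and> \<phi> ` U \<subseteq> hyp_space \<and> (\<exists>\<psi>. homeomorphism U (\<phi> ` U) \<phi> \<psi>)) \<and>
     (\<forall>(U, \<phi>)\<in>\<A>. \<forall>(V, \<psi>)\<in>\<A>. \<forall>x\<in>U \<inter> V. \<exists>W h.
        open W \<and> x \<in> W \<and> W \<subseteq> U \<inter> V \<and> hyp_isometry h \<and> (\<forall>y\<in>W. \<psi> y = h (\<phi> y)))"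

text \<open>\<open>riem_path \<A> x y l\<close>: there is a piecewise \<open>C\<^sup>1\<close> path from \<open>x\<close> to \<open>y\<close>, made of pieces each
  lying in one chart, of total Riemannian length \<open>l\<close>. The Riemannian metric of the hyperboloid is
  the restriction of the Lorentz form.\<close>

inductive riem_path ::
    "('m::metric_space set \<times> ('m \<Rightarrow> h3)) set \<Rightarrow> 'm \<Rightarrow> 'm \<Rightarrow> real \<Rightarrow> bool"
  for \<A> where
  refl: "riem_path \<A> x x 0"
| step: "\<lbrakk> riem_path \<A> x (\<gamma> a) l; a \<le> b; (U, \<phi>) \<in> \<A>; \<gamma> ` {a..b} \<subseteq> U;
     \<forall>t\<in>{a..b}. ((\<phi> \<circ> \<gamma>) has_vector_derivative D t) (at t within {a..b});
     continuous_on {a..b} D \<rbrakk>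
   \<Longrightarrow> riem_path \<A> x (\<gamma> b) (l + integral {a..b} (\<lambda>t. sqrt (lorentz (D t) (D t))))"

definition dist_is_riemannian :: "('m::metric_space set \<times> ('m \<Rightarrow> h3)) set \<Rightarrow> bool" where
  "dist_is_riemannian \<A> \<longleftrightarrow>
     (\<forall>x y. (\<exists>l. riem_path \<A> x y l) \<and> dist x y = Inf {l. riem_path \<A> x y l})"

text \<open>A locally finite triangulation by tetrahedra, each given as a pair \<open>(Q, \<tau>)\<close> of the vertex set
  of a nondegenerate hyperbolic tetrahedron and an isometry onto a subset of the manifold.\<close>

definition hyperbolic_triangulation :: "(h3 set \<times> (h3 \<Rightarrow> 'm::metric_space)) set \<Rightarrow> bool" where
  "hyperbolic_triangulation \<T> \<longleftrightarrow>
     (\<forall>(Q, \<tau>)\<in>\<T>. Q \<subseteq> hyp_space \<and> card Q = 4 \<and> independent Q \<and>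
        hyp_isometric_via Q \<tau> (\<tau> ` hhull Q)) \<and>
     (\<Union>(Q, \<tau>)\<in>\<T>. \<tau> ` hhull Q) = UNIV \<and>
     (\<forall>x. \<exists>U. open U \<and> x \<in> U \<and> finite {(Q, \<tau>) \<in> \<T>. \<tau> ` hhull Q \<inter> U \<noteq> {}}) \<and>
     (\<forall>(Q, \<tau>)\<in>\<T>. \<forall>(Q', \<tau>')\<in>\<T>. \<exists>S\<subseteq>Q. \<exists>S'\<subseteq>Q'. \<tau> ` S = \<tau>' ` S' \<and>
        \<tau> ` hhull Q \<inter> \<tau>' ` hhull Q' = \<tau> ` hhull S \<and> \<tau> ` hhull S = \<tau>' ` hhull S')"

definition general_hyperbolic_manifold ::
    "('m::metric_space set \<times> ('m \<Rightarrow> h3)) set \<Rightarrow> (h3 set \<times> (h3 \<Rightarrow> 'm)) set \<Rightarrow> bool" where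
  "general_hyperbolic_manifold \<A> \<T> \<longleftrightarrow>
     three_manifold_with_boundary TYPE('m) \<and> hyperbolic_atlas \<A> \<and> dist_is_riemannian \<A> \<and>
     complete (UNIV :: 'm set) \<and> hyperbolic_triangulation \<T>"


section \<open>Compact triangulated surfaces\<close>

text \<open>A triangulated surface is given by its finite set of triangles, each a set of three vertices.
  The underlying space is a surface with boundary exactly when all vertex links are circles
  (interior vertices) or arcs (boundary vertices).\<close>

definition link :: "'v set set \<Rightarrow> 'v \<Rightarrow> 'v set set" where
  "link F v = {t - {v} | t. t \<in> F \<and> v \<in> t}"

definition polygonal_arc :: "'v set set \<Rightarrow> bool" where
  "polygonal_arc E \<longleftrightarrow> (\<exists>ws. 2 \<le> length ws \<and> distinct ws \<and>
     E = {{ws ! i, ws ! Suc i} | i. Suc i < length ws})"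

definition polygonal_circle :: "'v set set \<Rightarrow> bool" where
  "polygonal_circle E \<longleftrightarrow> (\<exists>ws. 3 \<le> length ws \<and> distinct ws \<and>
     E = {{ws ! i, ws ! (Suc i mod length ws)} | i. i < length ws})"

definition triangulated_surface :: "'v set set \<Rightarrow> bool" where
  "triangulated_surface F \<longleftrightarrow> finite F \<and> (\<forall>t\<in>F. card t = 3) \<and>
     (\<forall>v\<in>\<Union>F. polygonal_circle (link F v) \<or> polygonal_arc (link F v))"

definition edges :: "'v set set \<Rightarrow> 'v set set" where
  "edges F = {e. card e = 2 \<and> (\<exists>t\<in>F. e \<subseteq> t)}"

definition boundary_edges :: "'v set set \<Rightarrow> 'v set set" where
  "boundary_edges F = {e \<in> edges F. card {t \<in> F. e \<subseteq> t} = 1}"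

definition boundary_vertices :: "'v set set \<Rightarrow> 'v set" where
  "boundary_vertices F = \<Union>(boundary_edges F)"

definition interior_vertices :: "'v set set \<Rightarrow> 'v set" where
  "interior_vertices F = \<Union>F - boundary_vertices F"

definition euler_char :: "'v set set \<Rightarrow> int" where
  "euler_char F = int (card (\<Union>F)) - int (card (edges F)) + int (card F)"

text \<open>Points of the underlying space are given by barycentric coordinates.\<close>

definition simplex_points :: "'v set \<Rightarrow> ('v \<Rightarrow> real) set" where
  "simplex_points s = {x. (\<forall>v. 0 \<le> x v) \<and> {v. x v \<noteq> 0} \<subseteq> s \<and> sum x s = 1}"

definition vertex_point :: "'v \<Rightarrow> 'v \<Rightarrow> real" where
  "vertex_point v = (\<lambda>u. if u = v then 1 else 0)"

definition realization :: "'v set set \<Rightarrow> ('v \<Rightarrow> real) set" where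
  "realization F = (\<Union>t\<in>F. simplex_points t)"

definition boundary_points :: "'v set set \<Rightarrow> ('v \<Rightarrow> real) set" where
  "boundary_points F = (\<Union>e\<in>boundary_edges F. simplex_points e)"


section \<open>Hyperbolic maps\<close>

text \<open>The image of each triangle \<open>t\<close> is a hyperbolic triangle in the manifold: \<open>P t v\<close> is the vertex
  corresponding to \<open>v \<in> t\<close> of a model triangle in the hyperbolic plane, and \<open>\<tau> t\<close> is an isometry
  of the model triangle onto the image triangle. The vertices of the model are distinct, so that the
  angles are defined, but may lie on a common geodesic.\<close>

definition maps_to_hyperbolic_triangles ::
    "'v set set \<Rightarrow> (('v \<Rightarrow> real) \<Rightarrow> 'm::metric_space) \<Rightarrow> ('v set \<Rightarrow> 'v \<Rightarrow> h2) \<Rightarrow>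
     ('v set \<Rightarrow> h2 \<Rightarrow> 'm) \<Rightarrow> bool" where
  "maps_to_hyperbolic_triangles F f P \<tau> \<longleftrightarrow> continuous_on (realization F) f \<and>
     (\<forall>t\<in>F. P t ` t \<subseteq> hyp_space \<and> inj_on (P t) t \<and>
        hyp_isometric_via (P t ` t) (\<tau> t) (f ` simplex_points t) \<and>
        totally_geodesic (f ` simplex_points t) \<and>
        (\<forall>s\<subseteq>t. \<tau> t ` hhull (P t ` s) = f ` simplex_points s))"

definition triangle_angle :: "('v set \<Rightarrow> 'v \<Rightarrow> h2) \<Rightarrow> 'v set \<Rightarrow> 'v \<Rightarrow> real" where
  "triangle_angle P t v =
     (THE \<alpha>. \<exists>a b. t = {v, a, b} \<and> card t = 3 \<and> \<alpha> = hangle (P t v) (P t a) (P t b))"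

definition angle_sum :: "'v set set \<Rightarrow> ('v set \<Rightarrow> 'v \<Rightarrow> h2) \<Rightarrow> 'v \<Rightarrow> real" where
  "angle_sum F P v = (\<Sum>t | t \<in> F \<and> v \<in> t. triangle_angle P t v)"

text \<open>\<open>V\<close> is the set of distinguished boundary vertices.\<close>

definition hyperbolic_map ::
    "'v set set \<Rightarrow> 'v set \<Rightarrow> (('v \<Rightarrow> real) \<Rightarrow> 'm::metric_space) \<Rightarrow> ('v set \<Rightarrow> 'v \<Rightarrow> h2) \<Rightarrow>
     ('v set \<Rightarrow> h2 \<Rightarrow> 'm) \<Rightarrow> bool" where
  "hyperbolic_map F V f P \<tau> \<longleftrightarrow> V \<subseteq> boundary_vertices F \<and>
     maps_to_hyperbolic_triangles F f P \<tau> \<and>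
     (\<forall>v\<in>interior_vertices F. angle_sum F P v \<ge> 2 * pi) \<and>
     (\<forall>v\<in>boundary_vertices F - V. angle_sum F P v \<ge> pi)"

definition surface_area :: "'v set set \<Rightarrow> ('v set \<Rightarrow> 'v \<Rightarrow> h2) \<Rightarrow> real" where
  "surface_area F P = (\<Sum>t\<in>F. hyp_area (hhull (P t ` t)))"

text \<open>The unit-speed geodesic from \<open>f v\<close> to \<open>f w\<close> that is the side \<open>v w\<close> of the image of \<open>t\<close>;
  as a function of a real parameter it is meaningful only up to the length of that side.\<close>

definition side_geodesic ::
    "('v set \<Rightarrow> 'v \<Rightarrow> h2) \<Rightarrow> ('v set \<Rightarrow> h2 \<Rightarrow> 'm) \<Rightarrow> 'v set \<Rightarrow> 'v \<Rightarrow> 'v \<Rightarrow> real \<Rightarrow> 'm" where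
  "side_geodesic P \<tau> t v w s = \<tau> t (hgeod (P t v) (P t w) s)"

text \<open>Both sides at \<open>v\<close> are taken to issue from \<open>v\<close>, i.e. the incoming one is already reversed.\<close>

definition is_exterior_angle ::
    "'v set set \<Rightarrow> ('v set \<Rightarrow> 'v \<Rightarrow> h2) \<Rightarrow> ('v set \<Rightarrow> h2 \<Rightarrow> 'm::metric_space) \<Rightarrow> 'v \<Rightarrow> real \<Rightarrow> bool"
    where
  "is_exterior_angle F P \<tau> v \<theta> \<longleftrightarrow> (\<exists>a b t u. a \<noteq> b \<and>
     {v, a} \<in> boundary_edges F \<and> t \<in> F \<and> {v, a} \<subseteq> t \<and>
     {v, b} \<in> boundary_edges F \<and> u \<in> F \<and> {v, b} \<subseteq> u \<and>
     \<theta> = pi - upper_angle (side_geodesic P \<tau> t v a) (side_geodesic P \<tau> u v b))"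

end

theory Submission
  imports Defs
begin

text \<open>
  The theorem is the Gauss--Bonnet formula with two inequalities in it.

  A hyperbolic triangle has area \<open>\<pi>\<close> minus the sum of its angles. Summing over the triangles and
  collecting the angles at each vertex, the area of the surface is \<open>\<pi>\<close> times the number of triangles
  minus the sum of all angle sums (\<open>surface_area_eq\<close>). An edge lies in two triangles or, on the
  boundary, in one, and the boundary has as many edges as vertices; hence twice the Euler
  characteristic is twice the number of interior vertices, plus the number of boundary vertices,
  minus the number of triangles (\<open>euler_char_eq\<close>). So it suffices that the angle sum is at least
  \<open>2 \<pi>\<close> at every interior vertex, \<open>\<pi>\<close> at every boundary vertex outside \<open>V\<close>, and \<open>\<pi> - \<theta> v\<close> at
  every \<open>v \<in> V\<close>. The first two bounds are what a hyperbolic map is required to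
  satisfy. The last one (\<open>exterior_angle_ge\<close>) says that the angle in the manifold between the two
  boundary sides at \<open>v\<close> is at most the angle sum at \<open>v\<close>. Indeed the triangles at \<open>v\<close> form a fan
  between these two sides. In one triangle the angle between the sides, measured in the manifold,
  is at most the angle of the model, because distances in the manifold are at most those in the
  triangle (\<open>angle_bound_triangle\<close>); and upper angles satisfy the triangle inequality
  (\<open>angle_bound_trans\<close>). Two consecutive triangles of the fan parametrize their common side
  separately, but both parametrizations are unit-speed geodesics with the same image, so they
  agree near \<open>v\<close> (\<open>geodesics_same_image\<close>).

  The area formula is proved in the hyperboloid model. For vertices \<open>A\<close>, \<open>B\<close>, \<open>C\<close> let \<open>D\<close> be the
  absolute value of their determinant and \<open>x\<close>, \<open>y\<close>, \<open>z\<close> the hyperbolic cosines of the sides.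
  Both the area and \<open>\<pi>\<close> minus the angle sum are equal to \<open>2 arctan (D / (1 + x + y + z))\<close>: the angles by
  an identity between complex numbers (\<open>angle_sum_eq\<close>), the area by integrating in projective
  coordinates, where both integrations have elementary primitives (\<open>hyp_area_eq_arctan\<close>). For
  degenerate triangles both sides are zero.
\<close>

section \<open>Geometry of the hyperboloid\<close>

lemma lorentz_commute: "lorentz p q = lorentz q p"
  by (simp add: lorentz_def inner_commute mult.commute)

lemma lorentz_add_left: "lorentz (p + q) r = lorentz p r + lorentz q r"
  and lorentz_add_right: "lorentz r (p + q) = lorentz r p + lorentz r q"
  and lorentz_scaleR_left: "lorentz (c *\<^sub>R p) r = c * lorentz p r"
  and lorentz_scaleR_right: "lorentz r (c *\<^sub>R p) = c * lorentz r p"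
  by (simp_all add: lorentz_def inner_add_left inner_add_right algebra_simps)

lemma lorentz_diff_left: "lorentz (p - q) r = lorentz p r - lorentz q r"
  and lorentz_diff_right: "lorentz r (p - q) = lorentz r p - lorentz r q"
  by (simp_all add: lorentz_def inner_diff_left inner_diff_right algebra_simps)

lemmas lorentz_bilinear =
  lorentz_add_left lorentz_add_right lorentz_diff_left lorentz_diff_right
  lorentz_scaleR_left lorentz_scaleR_right

lemma hyp_space_lorentz_self: "p \<in> hyp_space \<Longrightarrow> lorentz p p = -1"
  and hyp_space_fst_pos: "p \<in> hyp_space \<Longrightarrow> 0 < fst p"
  by (simp_all add: hyp_space_def)

lemma hyp_space_fst_eq:
  assumes "p \<in> hyp_space"
  shows "fst p = sqrt (1 + (norm (snd p))\<^sup>2)"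
proof -
  have "(fst p)\<^sup>2 = 1 + (norm (snd p))\<^sup>2"
    using assms by (simp add: hyp_space_def lorentz_def dot_square_norm power2_eq_square)
  then show ?thesis
    using hyp_space_fst_pos[OF assms] by (metis less_imp_le real_sqrt_unique)
qed

lemma hyp_space_eqI:
  assumes "p \<in> hyp_space" "q \<in> hyp_space" "snd p = snd q"
  shows "p = q"
  using assms by (simp add: prod_eq_iff hyp_space_fst_eq)

text \<open>
  The reversed Cauchy--Schwarz inequality: it places the argument of \<open>arcosh\<close> in \<open>hdist\<close> in the
  domain \<open>[1, \<infinity>)\<close>, and it makes \<open>hdist\<close> separate points.
\<close>

lemma lorentz_less_minus_one:
  fixes p q :: "real \<times> 'a::euclidean_space"
  assumes p: "p \<in> hyp_space" and q: "q \<in> hyp_space" and ne: "p \<noteq> q"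
  shows "lorentz p q < -1"
proof -
  let ?x = "snd p" and ?y = "snd q" and ?a = "fst p" and ?b = "fst q"
  have a: "?a\<^sup>2 = 1 + (norm ?x)\<^sup>2" "?a > 0" and b: "?b\<^sup>2 = 1 + (norm ?y)\<^sup>2" "?b > 0"
    using p q by (simp_all add: hyp_space_fst_eq add_pos_nonneg)
  have "?x \<noteq> ?y" using hyp_space_eqI[OF p q] ne by blast
  then have "0 < (norm (?x - ?y))\<^sup>2" by simp
  then have sq: "2 * (?x \<bullet> ?y) < (norm ?x)\<^sup>2 + (norm ?y)\<^sup>2"
    by (simp add: power2_norm_eq_inner inner_diff_left inner_diff_right inner_commute)
  have "(1 + ?x \<bullet> ?y)\<^sup>2 < (?a * ?b)\<^sup>2"
  proof -
    have "(?x \<bullet> ?y)\<^sup>2 \<le> (norm ?x)\<^sup>2 * (norm ?y)\<^sup>2"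
      by (metis Cauchy_Schwarz_ineq power2_norm_eq_inner)
    then show ?thesis
      using sq by (simp add: power_mult_distrib a b power2_sum algebra_simps)
  qed
  then have "\<bar>1 + ?x \<bullet> ?y\<bar> < ?a * ?b"
    using a(2) b(2) by (simp add: power2_less_imp_less abs_le_square_iff flip: abs_le_square_iff not_le)
  then show ?thesis by (simp add: lorentz_def)
qed

lemma lorentz_le_minus_one:
  assumes "p \<in> hyp_space" "q \<in> hyp_space"
  shows "lorentz p q \<le> -1"
  using lorentz_less_minus_one[OF assms] hyp_space_lorentz_self[OF assms(1)] by force

lemma hdist_nonneg: "p \<in> hyp_space \<Longrightarrow> q \<in> hyp_space \<Longrightarrow> 0 \<le> hdist p q"
  using lorentz_le_minus_one[of p q] by (simp add: hdist_def)

lemma cosh_hdist: "p \<in> hyp_space \<Longrightarrow> q \<in> hyp_space \<Longrightarrow> cosh (hdist p q) = - lorentz p q"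
  using lorentz_le_minus_one[of p q] by (simp add: hdist_def cosh_arcosh_real)

lemma hdist_self: "p \<in> hyp_space \<Longrightarrow> hdist p p = 0"
  by (simp add: hdist_def hyp_space_lorentz_self)

lemma hdist_pos: "p \<in> hyp_space \<Longrightarrow> q \<in> hyp_space \<Longrightarrow> p \<noteq> q \<Longrightarrow> 0 < hdist p q"
  using lorentz_less_minus_one[of p q] cosh_hdist[of p q] hdist_nonneg[of p q]
  by (metis cosh_0 equation_minus_iff less_eq_real_def less_irrefl)

lemma sinh_hdist:
  assumes "p \<in> hyp_space" "q \<in> hyp_space"
  shows "sinh (hdist p q) = sqrt ((lorentz p q)\<^sup>2 - 1)"
proof -
  have "(sinh (hdist p q))\<^sup>2 = (lorentz p q)\<^sup>2 - 1"
    using cosh_square_eq[of "hdist p q"] cosh_hdist[OF assms] by simp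
  then show ?thesis
    using hdist_nonneg[OF assms] by (metis real_sqrt_unique sinh_real_nonneg_iff)
qed

lemma hdir_eq:
  assumes "p \<in> hyp_space" "q \<in> hyp_space"
  shows "hdir p q = (q - cosh (hdist p q) *\<^sub>R p) /\<^sub>R sinh (hdist p q)"
proof -
  let ?u = "q + lorentz p q *\<^sub>R p"
  have "lorentz ?u ?u = (lorentz p q)\<^sup>2 - 1"
    using assms by (simp add: lorentz_bilinear hyp_space_lorentz_self lorentz_commute[of q p]
        power2_eq_square algebra_simps)
  then show ?thesis
    by (simp add: hdir_def Let_def sinh_hdist[OF assms] cosh_hdist[OF assms])
qed

lemma lorentz_hdir_base:
  assumes "p \<in> hyp_space" "q \<in> hyp_space"
  shows "lorentz p (hdir p q) = 0"
  using assms by (simp add: hdir_eq lorentz_bilinear hyp_space_lorentz_self cosh_hdist)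

lemma lorentz_hdir_hdir:
  assumes "p \<in> hyp_space" "q \<in> hyp_space" "r \<in> hyp_space"
  shows "lorentz (hdir p q) (hdir p r) =
    (cosh (hdist p q) * cosh (hdist p r) - cosh (hdist q r)) / (sinh (hdist p q) * sinh (hdist p r))"
  using assms
  by (simp add: hdir_eq lorentz_bilinear hyp_space_lorentz_self cosh_hdist lorentz_commute[of q p]
      lorentz_commute[of r p] divide_simps)

lemma lorentz_hdir_self:
  assumes "p \<in> hyp_space" "q \<in> hyp_space" "p \<noteq> q"
  shows "lorentz (hdir p q) (hdir p q) = 1"
proof -
  have "sinh (hdist p q) > 0" using hdist_pos[OF assms] by simp
  then show ?thesis
    using cosh_square_eq[of "hdist p q"]
    by (simp add: lorentz_hdir_hdir[OF assms(1,2,2)] hdist_self[OF assms(2)] power2_eq_square)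
qed

lemma hangle_commute: "hangle p q r = hangle p r q"
  by (simp add: hangle_def lorentz_commute)

lemma lorentz_hgeod_hgeod:
  assumes "p \<in> hyp_space" "q \<in> hyp_space" "r \<in> hyp_space"
  shows "lorentz (hgeod p q s) (hgeod p r t) =
    sinh s * sinh t * lorentz (hdir p q) (hdir p r) - cosh s * cosh t"
  using assms
  by (simp add: hgeod_def lorentz_bilinear hyp_space_lorentz_self lorentz_hdir_base
      lorentz_commute[of "hdir p q" p] algebra_simps)

text \<open>
  The vectors of Lorentz square \<open>-1\<close> form two sheets; the product of two vectors is negative on the
  same sheet and positive on different ones. This keeps \<open>hgeod\<close> on the upper sheet.
\<close>

lemma fst_pos_if_lorentz_neg:
  fixes p q :: "real \<times> 'a::euclidean_space"
  assumes p: "p \<in> hyp_space" and q: "lorentz q q = -1" and n: "lorentz p q < 0"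
  shows "0 < fst q"
proof (rule ccontr)
  assume "\<not> 0 < fst q"
  moreover have "fst q \<noteq> 0"
  proof
    assume "fst q = 0"
    with q have "snd q \<bullet> snd q = -1" by (simp add: lorentz_def)
    with inner_ge_zero[of "snd q"] show False by linarith
  qed
  ultimately have "- q \<in> hyp_space" using q by (simp add: hyp_space_def lorentz_def)
  from lorentz_le_minus_one[OF p this] n show False by (simp add: lorentz_def)
qed

lemma hgeod_in_hyp_space:
  assumes "p \<in> hyp_space" "q \<in> hyp_space" "p \<noteq> q"
  shows "hgeod p q s \<in> hyp_space"
proof -
  have "lorentz (hgeod p q s) (hgeod p q s) = -1"
    using cosh_square_eq[of s] assms
    by (simp add: lorentz_hgeod_hgeod lorentz_hdir_self power2_eq_square)
  moreover have "lorentz p (hgeod p q s) < 0"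
    using assms by (simp add: hgeod_def lorentz_bilinear hyp_space_lorentz_self lorentz_hdir_base cosh_real_pos)
  ultimately show ?thesis
    using fst_pos_if_lorentz_neg[OF assms(1)] by (simp add: hyp_space_def)
qed

lemma hgeod_0: "hgeod p q 0 = p"
  by (simp add: hgeod_def)

lemma hdist_hgeod:
  assumes "p \<in> hyp_space" "q \<in> hyp_space" "p \<noteq> q"
  shows "hdist (hgeod p q s) (hgeod p q t) = \<bar>s - t\<bar>"
proof -
  have "cosh (hdist (hgeod p q s) (hgeod p q t)) = cosh \<bar>s - t\<bar>"
    using assms by (simp add: cosh_hdist hgeod_in_hyp_space lorentz_hgeod_hgeod lorentz_hdir_self cosh_diff)
  then show ?thesis
    using cosh_real_nonneg_less_iff hdist_nonneg[OF hgeod_in_hyp_space[OF assms] hgeod_in_hyp_space[OF assms]]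
    by (metis abs_ge_zero linorder_neqE_linordered_idom order_less_irrefl)
qed

text \<open>
  Both coefficients are nonnegative exactly for \<open>0 \<le> s \<le> L\<close>: the geodesic stays in the cone spanned
  by \<open>p\<close> and \<open>q\<close> precisely between these two points.
\<close>

lemma hgeod_eq_combination:
  assumes "p \<in> hyp_space" "q \<in> hyp_space" "p \<noteq> q"
  defines "L \<equiv> hdist p q"
  shows "hgeod p q s = (sinh (L - s) / sinh L) *\<^sub>R p + (sinh s / sinh L) *\<^sub>R q"
proof -
  have "sinh L > 0" using hdist_pos[OF assms(1-3)] by (simp add: L_def)
  then have "cosh s - sinh s * cosh L / sinh L = sinh (L - s) / sinh L"
    by (simp add: sinh_diff field_simps)
  moreover have "hgeod p q s = (cosh s - sinh s * cosh L / sinh L) *\<^sub>R p + (sinh s / sinh L) *\<^sub>R q"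
    by (simp add: hgeod_def hdir_eq[OF assms(1,2)] L_def scaleR_diff_right scaleR_diff_left divide_inverse algebra_simps)
  ultimately show ?thesis by simp
qed

lemma hhull_mono: "Q \<subseteq> R \<Longrightarrow> finite R \<Longrightarrow> hhull Q \<subseteq> hhull R"
proof
  fix p assume QR: "Q \<subseteq> R" "finite R" and "p \<in> hhull Q"
  then obtain c where p: "p \<in> hyp_space" "\<forall>q\<in>Q. 0 \<le> c q" "p = (\<Sum>q\<in>Q. c q *\<^sub>R q)"
    by (auto simp: hhull_def)
  have "p = (\<Sum>q\<in>R. (if q \<in> Q then c q else 0) *\<^sub>R q)"
    unfolding p(3) using QR by (intro sum.mono_neutral_cong_left) auto
  then show "p \<in> hhull R"
    using p by (auto simp: hhull_def intro!: exI[of _ "\<lambda>q. if q \<in> Q then c q else 0"])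
qed

lemma hhull_singleton:
  assumes "p \<in> hyp_space"
  shows "hhull {p} = {p}"
proof -
  have "q = p" if "q \<in> hhull {p}" for q
  proof -
    obtain c where c: "q \<in> hyp_space" "0 \<le> c" "q = c *\<^sub>R p"
      using \<open>q \<in> hhull {p}\<close> by (auto simp: hhull_def)
    then have "c\<^sup>2 = 1"
      using hyp_space_lorentz_self[OF c(1)] hyp_space_lorentz_self[OF assms]
      by (simp add: lorentz_bilinear power2_eq_square)
    with c show ?thesis by (simp add: power2_eq_1_iff)
  qed
  moreover have "p \<in> hhull {p}"
    using assms by (auto simp: hhull_def intro: exI[of _ "\<lambda>_. 1"])
  ultimately show ?thesis by blast
qed

text \<open>
  For the less obvious inclusion, the parameter of a point \<open>a p + b q\<close> of the hull is its distance
  \<open>s\<close> from \<open>p\<close>: the condition that the point lies on the hyperboloid gives \<open>sinh s = b sinh L\<close>.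
\<close>

lemma hhull_pair:
  assumes "p \<in> hyp_space" "q \<in> hyp_space" "p \<noteq> q"
  shows "hhull {p, q} = hgeod p q ` {0..hdist p q}"
proof (rule set_eqI, rule iffI)
  define L where "L = hdist p q"
  have L: "L > 0" using hdist_pos[OF assms] by (simp add: L_def)
  fix x assume "x \<in> hgeod p q ` {0..hdist p q}"
  then obtain s where s: "0 \<le> s" "s \<le> L" "x = hgeod p q s" by (auto simp: L_def)
  have "x = (\<Sum>r\<in>{p,q}. (if r = p then sinh (L - s) / sinh L else sinh s / sinh L) *\<^sub>R r)"
    using assms(3) unfolding s(3) hgeod_eq_combination[OF assms] L_def by auto
  moreover have "0 \<le> sinh (L - s) / sinh L" "0 \<le> sinh s / sinh L" using s L by auto
  ultimately show "x \<in> hhull {p, q}"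
    using hgeod_in_hyp_space[OF assms, of s] s(3)
    unfolding hhull_def by (intro CollectI conjI exI[of _ "\<lambda>r. if r = p then sinh (L - s) / sinh L else sinh s / sinh L"]) auto
next
  define L where "L = hdist p q"
  have L: "L > 0" using hdist_pos[OF assms] by (simp add: L_def)
  fix x assume "x \<in> hhull {p, q}"
  then obtain a b where x: "x \<in> hyp_space" "0 \<le> a" "0 \<le> b" "x = a *\<^sub>R p + b *\<^sub>R q"
    using assms(3) by (auto simp: hhull_def)
  define s where "s = hdist p x"
  have pq: "lorentz p q = - cosh L" "lorentz q p = - cosh L"
    using cosh_hdist[OF assms(1,2)] by (simp_all add: L_def lorentz_commute[of q p])
  have "lorentz x x = -1" by (rule hyp_space_lorentz_self[OF x(1)])
  then have n: "a\<^sup>2 + b\<^sup>2 + 2 * a * b * cosh L = 1"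
    using assms unfolding x(4)
    by (simp add: lorentz_bilinear hyp_space_lorentz_self pq power2_eq_square algebra_simps)
  have cs: "cosh s = a + b * cosh L"
    using cosh_hdist[OF assms(1) x(1)] assms(1) unfolding s_def[symmetric] unfolding x(4)
    by (simp add: lorentz_bilinear hyp_space_lorentz_self pq)
  have s0: "0 \<le> s" using hdist_nonneg[OF assms(1) x(1)] by (simp add: s_def)
  have "(sinh s)\<^sup>2 = (b * sinh L)\<^sup>2"
  proof -
    have "(sinh s)\<^sup>2 = (a + b * cosh L)\<^sup>2 - 1" using cosh_square_eq[of s] cs by simp
    also have "\<dots> = b\<^sup>2 * ((cosh L)\<^sup>2 - 1)"
      using n by (simp add: power2_eq_square algebra_simps)
    finally show ?thesis using cosh_square_eq[of L] by (simp add: power_mult_distrib)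
  qed
  then have ss: "sinh s = b * sinh L"
    using s0 x(3) L by (simp add: power2_eq_iff_nonneg)
  have "b\<^sup>2 \<le> 1"
  proof -
    have "0 \<le> a * b * cosh L" using x by simp
    then show ?thesis using n zero_le_power2[of a] by linarith
  qed
  then have "b \<le> 1" using x(3) by (simp add: power2_le_iff_abs_le abs_square_le_1)
  then have "sinh s \<le> sinh L" using ss L by (simp add: mult_left_le_one_le x(3))
  then have "s \<le> L" by simp
  moreover have "x = hgeod p q s"
  proof -
    have "sinh s *\<^sub>R hdir p q = b *\<^sub>R (q - cosh L *\<^sub>R p)"
      using L by (simp add: hdir_eq[OF assms(1,2)] ss flip: L_def)
    then show ?thesis
      by (simp add: hgeod_def cs x(4) algebra_simps)
  qed
  ultimately show "x \<in> hgeod p q ` {0..hdist p q}" using s0 by (auto simp: L_def)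
qed

section \<open>The angle sum of a hyperbolic triangle\<close>

text \<open>
  The hyperbolic law of cosines: the cosine of the angle opposite to the side with hyperbolic
  cosine \<open>x\<close>, where \<open>y\<close> and \<open>z\<close> are the hyperbolic cosines of the other two sides.
\<close>

definition cos_angle :: "real \<Rightarrow> real \<Rightarrow> real \<Rightarrow> real" where
  "cos_angle x y z = (y * z - x) / (sqrt (y\<^sup>2 - 1) * sqrt (z\<^sup>2 - 1))"

text \<open>
  Minus the determinant of the Gram matrix, for the Lorentz form, of three points of the hyperboloid
  with mutual products \<open>-x\<close>, \<open>-y\<close>, \<open>-z\<close>.
\<close>

definition gram :: "real \<Rightarrow> real \<Rightarrow> real \<Rightarrow> real" where
  "gram x y z = 1 + 2 * x * y * z - x\<^sup>2 - y\<^sup>2 - z\<^sup>2"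

lemma one_minus_cos_angle_sq:
  assumes "1 < y" "1 < z"
  shows "1 - (cos_angle x y z)\<^sup>2 = gram x y z / ((y\<^sup>2 - 1) * (z\<^sup>2 - 1))"
proof -
  have p: "y\<^sup>2 - 1 > 0" "z\<^sup>2 - 1 > 0" using assms by simp_all
  then have "1 - (cos_angle x y z)\<^sup>2 = 1 - (y * z - x)\<^sup>2 / ((y\<^sup>2 - 1) * (z\<^sup>2 - 1))"
    by (simp add: cos_angle_def power_divide power_mult_distrib)
  also have "\<dots> = ((y\<^sup>2 - 1) * (z\<^sup>2 - 1) - (y * z - x)\<^sup>2) / ((y\<^sup>2 - 1) * (z\<^sup>2 - 1))"
    using p by (simp add: diff_divide_distrib)
  also have "(y\<^sup>2 - 1) * (z\<^sup>2 - 1) - (y * z - x)\<^sup>2 = gram x y z"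
    unfolding gram_def by (simp add: power2_eq_square algebra_simps)
  finally show ?thesis .
qed

lemma abs_cos_angle_le_1:
  assumes "1 < y" "1 < z" "0 \<le> gram x y z"
  shows "\<bar>cos_angle x y z\<bar> \<le> 1"
proof -
  have "0 \<le> 1 - (cos_angle x y z)\<^sup>2"
    using assms by (subst one_minus_cos_angle_sq) auto
  then show ?thesis by (simp add: abs_square_le_1)
qed

lemma sin_arccos_cos_angle:
  assumes "1 < y" "1 < z" "0 \<le> D" "D\<^sup>2 = gram x y z"
  shows "sin (arccos (cos_angle x y z)) = D / (sqrt (y\<^sup>2 - 1) * sqrt (z\<^sup>2 - 1))"
proof -
  have c: "\<bar>cos_angle x y z\<bar> \<le> 1"
    using abs_cos_angle_le_1[of y z x] assms by (metis zero_le_power2)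
  have "sin (arccos (cos_angle x y z)) = sqrt (D\<^sup>2 / ((y\<^sup>2 - 1) * (z\<^sup>2 - 1)))"
    using c assms by (subst sin_arccos_abs) (auto simp: one_minus_cos_angle_sq)
  then show ?thesis using assms(3) by (simp add: real_sqrt_divide real_sqrt_mult)
qed

text \<open>
  With \<open>x = cosh a\<close>, \<open>y = cosh b\<close>, \<open>z = cosh c\<close>, the sum of the two cosines has the sign of
  \<open>sinh (a + b) (cosh c - cosh (a - b))\<close>, so that the claim is the triangle inequality
  \<open>\<bar>a - b\<bar> \<le> c\<close>, which in turn follows from the hypothesis on the Gram determinant. The identity behind it
  appears below with \<open>X = sinh a\<close> and \<open>Y = sinh b\<close>.
\<close>

lemma two_angles_le_pi:
  assumes "1 < x" "1 < y" "1 < z" "0 \<le> gram x y z"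
  shows "arccos (cos_angle x y z) + arccos (cos_angle y x z) \<le> pi"
proof -
  define X where "X = sqrt (x\<^sup>2 - 1)"
  define Y where "Y = sqrt (y\<^sup>2 - 1)"
  define Z where "Z = sqrt (z\<^sup>2 - 1)"
  have pos: "X > 0" "Y > 0" "Z > 0" using assms by (auto simp: X_def Y_def Z_def)
  have sq: "X\<^sup>2 = x\<^sup>2 - 1" "Y\<^sup>2 = y\<^sup>2 - 1"
    using assms by (auto simp: X_def Y_def)
  have "(x * y - z)\<^sup>2 \<le> (X * Y)\<^sup>2"
    using assms(4) unfolding power_mult_distrib sq gram_def by (simp add: power2_eq_square algebra_simps)
  then have "x * y - z \<le> X * Y"
    using pos by (meson less_imp_le mult_nonneg_nonneg power2_le_imp_le)
  then have "(x * y - X * Y) * (X * y + Y * x) \<le> z * (X * y + Y * x)"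
    using pos assms by (intro mult_right_mono) auto
  moreover have "(x * y - X * Y) * (X * y + Y * x) = X * x + Y * y"
    using sq by algebra
  ultimately have k: "0 \<le> X * (y * z - x) + Y * (x * z - y)"
    by (simp add: algebra_simps)
  have "cos_angle x y z + cos_angle y x z = (X * (y * z - x) + Y * (x * z - y)) / (X * Y * Z)"
    using pos unfolding cos_angle_def X_def[symmetric] Y_def[symmetric] Z_def[symmetric]
    by (simp add: field_simps)
  then have "- cos_angle x y z \<le> cos_angle y x z" using k pos by (smt (verit) divide_nonneg_pos mult_pos_pos)
  moreover have b: "\<bar>cos_angle x y z\<bar> \<le> 1" "\<bar>cos_angle y x z\<bar> \<le> 1"
    using assms by (auto intro!: abs_cos_angle_le_1 simp: gram_def algebra_simps)
  ultimately have "arccos (cos_angle y x z) \<le> arccos (- cos_angle x y z)"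
    by (intro arccos_le_arccos) (auto simp: abs_le_iff)
  also have "\<dots> = pi - arccos (cos_angle x y z)"
    using b by (intro arccos_minus) auto
  finally show ?thesis by simp
qed

text \<open>
  Write \<open>M = 1 + x + y + z\<close>. The angles are the arguments of \<open>yz - x + iD\<close>, \<open>xz - y + iD\<close>,
  \<open>xy - z + iD\<close>, and \<open>2 arctan (D / M)\<close> is the argument of \<open>(M + iD)\<^sup>2\<close>. The product of the
  first three numbers is a negative multiple of \<open>(M - iD)\<^sup>2\<close>, so the four arguments add up to \<open>\<pi>\<close>
  modulo \<open>2 \<pi>\<close>. Since any two of the angles add up to at most \<open>\<pi>\<close>, the sum is below \<open>3 \<pi>\<close>.
\<close>

lemma angle_sum_eq:
  assumes g1: "1 < x" "1 < y" "1 < z" and D: "0 \<le> D" "D\<^sup>2 = gram x y z"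
  shows "arccos (cos_angle x y z) + arccos (cos_angle y x z) + arccos (cos_angle z x y)
    = pi - 2 * arctan (D / (1 + x + y + z))"
proof -
  define X where "X = sqrt (x\<^sup>2 - 1)"
  define Y where "Y = sqrt (y\<^sup>2 - 1)"
  define Z where "Z = sqrt (z\<^sup>2 - 1)"
  have pos: "X > 0" "Y > 0" "Z > 0" using g1 by (auto simp: X_def Y_def Z_def)
  have sq: "X\<^sup>2 = x\<^sup>2 - 1" "Y\<^sup>2 = y\<^sup>2 - 1" "Z\<^sup>2 = z\<^sup>2 - 1"
    using g1 by (auto simp: X_def Y_def Z_def)
  define M where "M = 1 + x + y + z"
  have M: "M > 0" using g1 by (simp add: M_def)
  define \<alpha> \<beta> \<gamma> \<omega> where "\<alpha> = arccos (cos_angle x y z)" and "\<beta> = arccos (cos_angle y x z)"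
    and "\<gamma> = arccos (cos_angle z x y)" and "\<omega> = 2 * arctan (D / M)"
  have gr: "0 \<le> gram x y z" "gram y x z = gram x y z" "gram z x y = gram x y z"
    using D(2)[symmetric] by (simp_all add: gram_def algebra_simps)
  have cisA: "cis \<alpha> = Complex (y * z - x) D / of_real (Y * Z)"
    using abs_cos_angle_le_1[of y z x] sin_arccos_cos_angle[of y z D x] g1 gr D
    by (simp add: \<alpha>_def complex_eq_iff cos_angle_def Y_def Z_def cos_arccos_abs)
  have cisB: "cis \<beta> = Complex (x * z - y) D / of_real (X * Z)"
    using abs_cos_angle_le_1[of x z y] sin_arccos_cos_angle[of x z D y] g1 gr D
    by (simp add: \<beta>_def complex_eq_iff cos_angle_def X_def Z_def cos_arccos_abs)
  have cisC: "cis \<gamma> = Complex (x * y - z) D / of_real (X * Y)"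
    using abs_cos_angle_le_1[of x y z] sin_arccos_cos_angle[of x y D z] g1 gr D
    by (simp add: \<gamma>_def complex_eq_iff cos_angle_def X_def Y_def cos_arccos_abs)
  have MD: "M\<^sup>2 + D\<^sup>2 = 2 * (1 + x) * (1 + y) * (1 + z)"
    using D(2) unfolding M_def gram_def by algebra
  have cisO: "cis \<omega> = (Complex M D)\<^sup>2 / of_real (M\<^sup>2 + D\<^sup>2)"
  proof -
    have "cis (arctan (D / M)) = Complex M D / of_real (sqrt (M\<^sup>2 + D\<^sup>2))"
    proof -
      have "sqrt (1 + (D / M)\<^sup>2) = sqrt (M\<^sup>2 + D\<^sup>2) / M"
      proof -
        have "1 + (D / M)\<^sup>2 = (M\<^sup>2 + D\<^sup>2) / M\<^sup>2" using M by (simp add: field_simps power_divide)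
        then show ?thesis using M by (simp add: real_sqrt_divide)
      qed
      then show ?thesis using M by (simp add: complex_eq_iff cos_arctan sin_arctan)
    qed
    moreover have "cis \<omega> = (cis (arctan (D / M)))\<^sup>2"
      by (simp add: \<omega>_def Complex.DeMoivre)
    moreover have "(complex_of_real (sqrt (M\<^sup>2 + D\<^sup>2)))\<^sup>2 = of_real (M\<^sup>2 + D\<^sup>2)"
      by (metis of_real_power real_sqrt_pow2 sum_power2_ge_zero)
    ultimately show ?thesis by (simp add: power_divide)
  qed
  have "cis (\<alpha> + \<beta> + \<gamma> + \<omega>) = -1"
  proof -
    define K where "K = (x - 1) * (y - 1) * (z - 1)"
    have prod: "Complex (y * z - x) D * Complex (x * z - y) D * Complex (x * y - z) D =
        - (of_real (K / 2) * (Complex M (- D))\<^sup>2)"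
    proof -
      have re: "(y * z - x) * (x * z - y) * (x * y - z) -
            D\<^sup>2 * ((y * z - x) + (x * z - y) + (x * y - z)) = - (M\<^sup>2 - D\<^sup>2) * K / 2"
        unfolding D(2) K_def M_def gram_def
        by (simp add: field_simps) (simp add: power2_eq_square algebra_simps)
      have im: "(y * z - x) * (x * z - y) + (y * z - x) * (x * y - z) + (x * z - y) * (x * y - z)
           - D\<^sup>2 = M * K"
        unfolding D(2) K_def M_def gram_def by (simp add: power2_eq_square algebra_simps)
      show ?thesis
        unfolding complex_eq_iff using re im
        by (simp add: power2_eq_square) algebra
    qed
    have n: "X * Y * Z \<noteq> 0" using pos by simp
    have den: "(Y * Z) * (X * Z) * (X * Y) * (M\<^sup>2 + D\<^sup>2) = (K / 2) * (M\<^sup>2 + D\<^sup>2)\<^sup>2"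
    proof -
      have "(Y * Z) * (X * Z) * (X * Y) = X\<^sup>2 * Y\<^sup>2 * Z\<^sup>2" by (simp add: power2_eq_square)
      also have "\<dots> = K * ((1 + x) * (1 + y) * (1 + z))"
        unfolding sq K_def by (simp add: power2_eq_square algebra_simps)
      also have "\<dots> = (K / 2) * (M\<^sup>2 + D\<^sup>2)" unfolding MD by algebra
      finally show ?thesis by (simp add: power2_eq_square)
    qed
    \<comment> \<open>The two factors in \<open>M - iD\<close> and \<open>M + iD\<close> combine to a positive real number.\<close>
    have cc: "(Complex M (- D))\<^sup>2 * (Complex M D)\<^sup>2 = of_real ((M\<^sup>2 + D\<^sup>2)\<^sup>2)"
    proof -
      have "Complex M (- D) * Complex M D = of_real (M\<^sup>2 + D\<^sup>2)"
        by (simp add: complex_eq_iff power2_eq_square)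
      then show ?thesis by (metis of_real_power power_mult_distrib)
    qed
    have "cis (\<alpha> + \<beta> + \<gamma> + \<omega>) = cis \<alpha> * cis \<beta> * cis \<gamma> * cis \<omega>" by (simp add: cis_mult)
    also have "\<dots> = (Complex (y * z - x) D * Complex (x * z - y) D * Complex (x * y - z) D) * (Complex M D)\<^sup>2
        / of_real ((Y * Z) * (X * Z) * (X * Y) * (M\<^sup>2 + D\<^sup>2))"
      unfolding cisA cisB cisC cisO by simp
    also have "\<dots> = - of_real ((K / 2) * (M\<^sup>2 + D\<^sup>2)\<^sup>2) / of_real ((K / 2) * (M\<^sup>2 + D\<^sup>2)\<^sup>2)"
      unfolding prod den using cc by simp
    also have "\<dots> = -1"
    proof -
      have "K \<noteq> 0" using g1 by (simp add: K_def)
      moreover have "M\<^sup>2 + D\<^sup>2 \<noteq> 0" using M by (metis less_irrefl sum_power2_eq_zero_iff)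
      ultimately have "(K / 2) * (M\<^sup>2 + D\<^sup>2)\<^sup>2 \<noteq> 0" by simp
      then show ?thesis by (metis divide_self minus_divide_left of_real_eq_0_iff)
    qed
    finally show ?thesis .
  qed
  then have "cos (\<alpha> + \<beta> + \<gamma> + \<omega> - pi) = 1"
    by (simp add: cos_diff complex_eq_iff)
  then obtain n :: int where n: "\<alpha> + \<beta> + \<gamma> + \<omega> - pi = of_int n * 2 * pi"
    by (subst (asm) cos_one_2pi_int) blast
  have ran: "0 \<le> \<alpha>" "0 \<le> \<beta>" "0 \<le> \<gamma>"
    using abs_cos_angle_le_1[of y z x] abs_cos_angle_le_1[of x z y] abs_cos_angle_le_1[of x y z] g1 gr
    by (auto simp: \<alpha>_def \<beta>_def \<gamma>_def intro!: arccos_lbound simp: abs_le_iff)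
  have two: "\<alpha> + \<beta> \<le> pi" "\<alpha> + \<gamma> \<le> pi" "\<beta> + \<gamma> \<le> pi"
  proof -
    have sw: "cos_angle a b c = cos_angle a c b" for a b c by (simp add: cos_angle_def mult.commute)
    show "\<alpha> + \<beta> \<le> pi" using two_angles_le_pi[of x y z] g1 gr by (simp add: \<alpha>_def \<beta>_def)
    show "\<alpha> + \<gamma> \<le> pi" using two_angles_le_pi[of x z y] g1 gr
      by (simp add: \<alpha>_def \<gamma>_def gram_def sw[of x z y] mult.commute mult.left_commute)
    show "\<beta> + \<gamma> \<le> pi" using two_angles_le_pi[of y z x] g1 gr
      by (simp add: \<beta>_def \<gamma>_def gram_def sw[of y z x] sw[of z y x] mult.commute mult.left_commute)
  qed
  have om: "0 \<le> \<omega>" "\<omega> < pi"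
    using D(1) M arctan_ubound[of "D / M"] by (auto simp: \<omega>_def)
  have "of_int n * (2 * pi) < 1 * (2 * pi)" "(-1) * (2 * pi) < of_int n * (2 * pi)"
    using n ran two om pi_gt_zero by linarith+
  then have "real_of_int n < 1" "-1 < real_of_int n"
    by (simp_all only: mult_less_cancel_right_pos pi_gt_zero zero_less_mult_iff zero_less_numeral simp_thms)
  then have "n = 0" by linarith
  with n show ?thesis by (simp add: \<alpha>_def \<beta>_def \<gamma>_def \<omega>_def M_def)
qed

text \<open>
  The determinant of the matrix with columns \<open>A\<close>, \<open>B\<close>, \<open>C\<close>.
\<close>

definition triple :: "h2 \<Rightarrow> h2 \<Rightarrow> h2 \<Rightarrow> real" where
  "triple A B C = fst A * (fst (snd B) * snd (snd C) - snd (snd B) * fst (snd C))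
     - fst B * (fst (snd A) * snd (snd C) - snd (snd A) * fst (snd C))
     + fst C * (fst (snd A) * snd (snd B) - snd (snd A) * fst (snd B))"

text \<open>
  The Gram matrix is \<open>M\<^sup>T J M\<close>, where \<open>M\<close> has the columns \<open>A\<close>, \<open>B\<close>, \<open>C\<close> and \<open>J\<close> is the diagonal matrix of
  the Lorentz form, which has determinant \<open>-1\<close>.
\<close>

lemma triple_sq_gram:
  assumes "A \<in> hyp_space" "B \<in> hyp_space" "C \<in> hyp_space"
  shows "(triple A B C)\<^sup>2 = gram (- lorentz B C) (- lorentz A C) (- lorentz A B)"
proof -
  obtain a0 a1 a2 where A: "A = (a0, a1, a2)" by (metis surj_pair)
  obtain b0 b1 b2 where B: "B = (b0, b1, b2)" by (metis surj_pair)
  obtain c0 c1 c2 where C: "C = (c0, c1, c2)" by (metis surj_pair)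
  have 1: "a1\<^sup>2 + a2\<^sup>2 - a0\<^sup>2 = -1" "b1\<^sup>2 + b2\<^sup>2 - b0\<^sup>2 = -1" "c1\<^sup>2 + c2\<^sup>2 - c0\<^sup>2 = -1"
    using assms[THEN hyp_space_lorentz_self] by (simp_all add: A B C lorentz_def power2_eq_square)
  show ?thesis
    unfolding A B C triple_def gram_def lorentz_def
    using 1 by (simp, algebra)
qed

theorem hangle_sum_eq:
  assumes hyp: "A \<in> hyp_space" "B \<in> hyp_space" "C \<in> hyp_space"
    and dist: "A \<noteq> B" "A \<noteq> C" "B \<noteq> C"
  shows "hangle A B C + hangle B A C + hangle C A B = pi - 2 * arctan (\<bar>triple A B C\<bar> /
      (1 - lorentz B C - lorentz A C - lorentz A B))"
proof -
  have ang: "hangle p q r = arccos (cos_angle (- lorentz q r) (- lorentz p q) (- lorentz p r))"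
    if "p \<in> hyp_space" "q \<in> hyp_space" "r \<in> hyp_space" for p q r :: h2
    using that by (simp add: hangle_def lorentz_hdir_hdir cosh_hdist sinh_hdist cos_angle_def)
  have sw: "cos_angle a b c = cos_angle a c b" for a b c by (simp add: cos_angle_def mult.commute)
  have "1 < - lorentz B C" "1 < - lorentz A C" "1 < - lorentz A B"
    using lorentz_less_minus_one[OF hyp(2,3)] lorentz_less_minus_one[OF hyp(1,3)]
      lorentz_less_minus_one[OF hyp(1,2)] dist by auto
  from angle_sum_eq[OF this, of "\<bar>triple A B C\<bar>"] triple_sq_gram[OF hyp]
  show ?thesis
    using hyp by (simp add: ang lorentz_commute[of B A] lorentz_commute[of C A] lorentz_commute[of C B]
       sw[of "- lorentz B C" "- lorentz A C"] sw[of "- lorentz A C" "- lorentz B C"]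
       sw[of "- lorentz A B" "- lorentz B C"])
qed

section \<open>The area of a hyperbolic triangle\<close>

text \<open>
  The area is an integral over \<open>real \<times> real\<close>, while the substitution formula for several variables
  is about \<open>real ^ 2\<close>. The identification of the two planes preserves Lebesgue measure.
\<close>

definition pair_of_vec :: "real ^ 2 \<Rightarrow> real \<times> real" where
  "pair_of_vec v = (v $ 1, v $ 2)"

definition vec_of_pair :: "real \<times> real \<Rightarrow> real ^ 2" where
  "vec_of_pair p = vector [fst p, snd p]"

lemma vec_of_pair_nth: "vec_of_pair p $ 1 = fst p" "vec_of_pair p $ 2 = snd p"
  by (simp_all add: vec_of_pair_def)

lemma pair_of_vec_of_pair [simp]: "pair_of_vec (vec_of_pair p) = p"
  by (simp add: pair_of_vec_def vec_of_pair_nth)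

lemma vec_of_pair_of_vec [simp]: "vec_of_pair (pair_of_vec v) = v"
  by (simp add: pair_of_vec_def vec_eq_iff forall_2 vec_of_pair_nth)

lemma bounded_linear_pair_of_vec: "bounded_linear pair_of_vec"
  unfolding pair_of_vec_def
  by (intro bounded_linear_Pair bounded_linear_vec_nth)

lemma bounded_linear_vec_of_pair: "bounded_linear vec_of_pair"
  by (intro linear_conv_bounded_linear[THEN iffD1] linearI)
     (simp_all add: vec_eq_iff forall_2 vec_of_pair_nth)

lemma pair_of_vec_vimage: "pair_of_vec -` S = vec_of_pair ` S"
proof
  show "pair_of_vec -` S \<subseteq> vec_of_pair ` S"
    using vec_of_pair_of_vec by (metis image_eqI subsetI vimage_eq)
qed auto

lemma borel_measurable_pair_of_vec [measurable]: "pair_of_vec \<in> borel_measurable borel"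
  by (intro borel_measurable_continuous_onI bounded_linear.continuous_on[OF bounded_linear_pair_of_vec] continuous_on_id)

lemma lborel_distr_pair_of_vec: "distr lborel borel pair_of_vec = lborel"
proof (rule lborel_eqI[symmetric])
  fix l u :: "real \<times> real" assume le: "\<And>b. b \<in> Basis \<Longrightarrow> l \<bullet> b \<le> u \<bullet> b"
  have B: "(Basis :: (real ^ 2) set) = {axis 1 1, axis 2 1}"
    by (auto simp: Basis_vec_def UNIV_2)
  have ne: "(axis 1 1 :: real ^ 2) \<noteq> axis 2 1"
    by (simp add: axis_eq_axis)
  have le': "fst l \<le> fst u" "snd l \<le> snd u" using le[of "(1,0)"] le[of "(0,1)"]
    by (auto simp: Basis_prod_def inner_prod_def)
  have "pair_of_vec -` box l u = box (vec_of_pair l) (vec_of_pair u)"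
    by (auto simp: box_def B pair_of_vec_def inner_axis vec_of_pair_nth Basis_prod_def inner_prod_def)
  then have "emeasure (distr lborel borel pair_of_vec) (box l u) =
      emeasure lborel (box (vec_of_pair l) (vec_of_pair u))"
    by (subst emeasure_distr) auto
  also have "\<dots> = (\<Prod>b\<in>Basis. (vec_of_pair u - vec_of_pair l) \<bullet> b)"
    using le' by (intro emeasure_lborel_box) (auto simp: B inner_axis vec_of_pair_nth)
  also have "\<dots> = (\<Prod>b\<in>Basis. (u - l) \<bullet> b)"
    using ne by (simp add: B inner_axis vec_of_pair_nth Basis_prod_def inner_prod_def mult.commute)
  finally show "emeasure (distr lborel borel pair_of_vec) (box l u) = (\<Prod>b\<in>Basis. (u - l) \<bullet> b)" .
qed simp

lemma compact_integral_pair_of_vec: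
  fixes f :: "real \<times> real \<Rightarrow> real"
  assumes K: "compact K" and f: "continuous_on K f"
  shows "set_lebesgue_integral lborel K f = integral (vec_of_pair ` K) (\<lambda>v. f (pair_of_vec v))"
proof -
  let ?g = "\<lambda>x. indicator K x *\<^sub>R f x" and ?L = "vec_of_pair ` K"
  have L: "compact ?L"
    by (intro compact_continuous_image K bounded_linear.continuous_on[OF bounded_linear_vec_of_pair] continuous_on_id)
  have fL: "continuous_on ?L (\<lambda>v. f (pair_of_vec v))"
    by (intro continuous_on_compose2[OF f] bounded_linear.continuous_on[OF bounded_linear_pair_of_vec] continuous_on_id) auto
  have m: "?g \<in> borel_measurable borel"
    using borel_integrable_compact[OF K f] by (auto dest: borel_measurable_integrable)
  have "set_lebesgue_integral lborel K f = integral\<^sup>L (distr lborel borel pair_of_vec) ?g"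
    by (simp add: set_lebesgue_integral_def lborel_distr_pair_of_vec)
  also have "\<dots> = integral\<^sup>L lborel (\<lambda>v. ?g (pair_of_vec v))"
    by (rule integral_distr) (use m in auto)
  also have "\<dots> = set_lebesgue_integral lborel ?L (\<lambda>v. f (pair_of_vec v))"
  proof -
    have "pair_of_vec v \<in> K \<longleftrightarrow> v \<in> ?L" for v
      using pair_of_vec_vimage[of K] by blast
    then show ?thesis by (simp add: set_lebesgue_integral_def indicator_def)
  qed
  also have "\<dots> = integral ?L (\<lambda>v. f (pair_of_vec v))"
    using borel_integrable_compact[OF L fL]
    by (intro set_borel_integral_eq_integral(2)) (simp add: set_integrable_def)
  finally show ?thesis .
qed

lemma integral_unit_square:
  fixes f :: "real \<times> real \<Rightarrow> real"
  assumes "continuous_on (cbox (0,0) (1,1)) f"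
  shows "integral (cbox 0 1) (\<lambda>v. f (pair_of_vec v)) = integral {0..1} (\<lambda>x. integral {0..1} (\<lambda>y. f (x, y)))"
proof -
  have "cbox (0::real^2) 1 = vec_of_pair ` cbox (0,0) (1,1)"
  proof (rule set_eqI)
    fix v :: "real ^ 2"
    have "v \<in> cbox 0 1 \<longleftrightarrow> pair_of_vec v \<in> cbox (0,0) (1,1)"
      by (auto simp: mem_box_cart forall_2 pair_of_vec_def)
    then show "v \<in> cbox 0 1 \<longleftrightarrow> v \<in> vec_of_pair ` cbox (0,0) (1,1)"
      by (simp flip: pair_of_vec_vimage)
  qed
  then have "integral (cbox 0 1) (\<lambda>v. f (pair_of_vec v)) = set_lebesgue_integral lborel (cbox (0,0) (1,1)) f"
    using compact_integral_pair_of_vec[OF compact_cbox assms] by simp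
  also have "\<dots> = integral (cbox (0,0) (1,1)) f"
    using borel_integrable_compact[OF compact_cbox assms]
    by (intro set_borel_integral_eq_integral(2)) (simp add: set_integrable_def)
  also have "\<dots> = integral {0..1} (\<lambda>x. integral {0..1} (\<lambda>y. f (x, y)))"
    using integral_prod_continuous[OF assms] by simp
  finally show ?thesis .
qed

text \<open>
  A primitive is \<open>(1 - r + \<beta> r) / (\<beta>\<^sup>2 - q)\<close> divided by the square root. Below, the quadratic
  polynomial in \<open>r\<close> is minus the Lorentz square along a ray from the vertex \<open>A\<close> to the opposite side,
  and \<open>q < \<beta>\<^sup>2\<close> says that the end point of the ray is not proportional to \<open>A\<close>.
\<close>

lemma ray_integral:
  fixes \<beta> q :: real
  assumes q: "0 < q" and \<beta>: "0 < \<beta>" "q < \<beta>\<^sup>2"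
  shows "integral {0..1} (\<lambda>r. r / sqrt ((1 - r)\<^sup>2 + 2 * r * (1 - r) * \<beta> + r\<^sup>2 * q) ^ 3)
    = 1 / (sqrt q * (\<beta> + sqrt q))"
proof -
  define Q where "Q r = (1 - r)\<^sup>2 + 2 * r * (1 - r) * \<beta> + r\<^sup>2 * q" for r :: real
  define G where "G r = ((1 - r) + \<beta> * r) / sqrt (Q r) / (\<beta>\<^sup>2 - q)" for r
  have Qpos: "0 < Q r" if "r \<in> {0..1}" for r
  proof (cases "r = 0")
    case False
    then have "0 < r\<^sup>2 * q" using q by simp
    moreover have "0 \<le> 2 * r * (1 - r) * \<beta>" using that \<beta> by simp
    ultimately show ?thesis unfolding Q_def by (simp add: add_nonneg_pos)
  qed (simp add: Q_def)
  have dQ: "(Q has_real_derivative 2 * (- (1 - r) + (1 - 2 * r) * \<beta> + r * q)) (at r within S)" for r S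
    unfolding Q_def by (auto intro!: derivative_eq_intros simp: algebra_simps)
  have "((\<lambda>r. r / sqrt (Q r) ^ 3) has_integral (G 1 - G 0)) {0..1}"
  proof (rule fundamental_theorem_of_calculus)
    fix r :: real assume r: "r \<in> {0..1}"
    have Q: "0 < Q r" by (rule Qpos[OF r])
    have s: "sqrt (Q r) * sqrt (Q r) = Q r" "sqrt (Q r) \<noteq> 0" using Q by auto
    have key: "(- 1 + \<beta>) * Q r - ((1 - r) + \<beta> * r) * (- (1 - r) + (1 - 2 * r) * \<beta> + r * q) = r * (\<beta>\<^sup>2 - q)"
      unfolding Q_def by algebra
    define Q' where "Q' = 2 * (- (1 - r) + (1 - 2 * r) * \<beta> + r * q)"
    have dn: "((\<lambda>r. (1 - r) + \<beta> * r) has_real_derivative (- 1 + \<beta>)) (at r within {0..1})"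
      by (auto intro!: derivative_eq_intros)
    have ds: "((\<lambda>r. sqrt (Q r)) has_real_derivative inverse (sqrt (Q r)) / 2 * Q') (at r within {0..1})"
      unfolding Q'_def by (rule DERIV_chain2[OF DERIV_real_sqrt[OF Q] dQ])
    have "(G has_real_derivative
       ((- 1 + \<beta>) * sqrt (Q r) - ((1 - r) + \<beta> * r) * (inverse (sqrt (Q r)) / 2 * Q'))
        / (sqrt (Q r) * sqrt (Q r)) / (\<beta>\<^sup>2 - q)) (at r within {0..1})"
      unfolding G_def by (intro DERIV_cdivide DERIV_divide dn ds s)
    also have "((- 1 + \<beta>) * sqrt (Q r) - ((1 - r) + \<beta> * r) * (inverse (sqrt (Q r)) / 2 * Q'))
        / (sqrt (Q r) * sqrt (Q r))
      = ((- 1 + \<beta>) * Q r - ((1 - r) + \<beta> * r) * (- (1 - r) + (1 - 2 * r) * \<beta> + r * q)) / sqrt (Q r) ^ 3"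
    proof -
      have gen: "(a * k - b * (inverse k / 2 * (2 * c))) / (k * k) = (a * (k * k) - b * c) / k ^ 3"
        if "k \<noteq> 0" for a b c k :: real
        using that by (simp add: field_simps power3_eq_cube)
      show ?thesis unfolding Q'_def gen[OF s(2)] by (simp only: s(1))
    qed
    also have "\<dots> / (\<beta>\<^sup>2 - q) = r / sqrt (Q r) ^ 3"
      unfolding key using \<beta> by simp
    finally show "(G has_vector_derivative r / sqrt (Q r) ^ 3) (at r within {0..1})"
      by (simp add: has_real_derivative_iff_has_vector_derivative)
  qed simp
  moreover have "G 1 - G 0 = 1 / (sqrt q * (\<beta> + sqrt q))"
  proof -
    have s: "\<beta>\<^sup>2 - q = (\<beta> - sqrt q) * (\<beta> + sqrt q)"
      using q by (simp add: algebra_simps power2_eq_square)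
    have "sqrt q < \<beta>" using \<beta> q by (metis real_less_lsqrt less_imp_le)
    then have n: "\<beta> - sqrt q \<noteq> 0" "\<beta> + sqrt q \<noteq> 0" "sqrt q \<noteq> 0"
      using \<beta>(1) q by (auto simp: add_pos_pos less_imp_neq[symmetric])
    have "G 1 - G 0 = (\<beta> / sqrt q - 1) / ((\<beta> - sqrt q) * (\<beta> + sqrt q))"
      unfolding G_def s by (simp add: Q_def diff_divide_distrib)
    also have "\<beta> / sqrt q - 1 = (\<beta> - sqrt q) / sqrt q" using n by (simp add: diff_divide_distrib)
    finally show ?thesis using n by simp
  qed
  ultimately show ?thesis unfolding Q_def by (simp add: integral_unique)
qed

text \<open>
  The primitive \<open>2 arctan (D u / M u)\<close> is the area of the triangle cut off by the ray with parameter
  \<open>u\<close>, with side lengths entering without normalizing the end point \<open>w\<close> of the ray: \<open>q\<close>, \<open>\<beta>\<close>, \<open>\<delta>\<close>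
  are minus the Lorentz products of \<open>w\<close> with \<open>w\<close>, \<open>A\<close>, \<open>B\<close>. The derivative simplifies because
  \<open>M\<^sup>2 + u\<^sup>2 D\<^sup>2\<close> factors, which is the homogeneous form of the identity
  \<open>(1 + x + y + z)\<^sup>2 + D\<^sup>2 = 2 (1 + x) (1 + y) (1 + z)\<close>.
\<close>

lemma integral_over_rays:
  fixes x y z D :: real
  assumes g1: "1 < x" "1 < y" "1 < z" and D: "0 < D" "D\<^sup>2 = gram x y z"
  defines "q \<equiv> \<lambda>u. 1 + 2 * u * (1 - u) * (x - 1)" and "\<beta> \<equiv> \<lambda>u. (1 - u) * z + u * y"
  shows "integral {0..1} (\<lambda>u. D / (sqrt (q u) * (\<beta> u + sqrt (q u)))) = 2 * arctan (D / (1 + x + y + z))"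
proof -
  define \<delta> where "\<delta> u = 1 + u * (x - 1)" for u
  define M where "M u = sqrt (q u) * (1 + z) + \<beta> u + \<delta> u" for u
  define G where "G u = 2 * arctan (D * u / M u)" for u
  have q1: "1 \<le> q u" if "u \<in> {0..1}" for u using that g1 by (simp add: q_def)
  have \<beta>0: "0 < \<beta> u" if "u \<in> {0..1}" for u
  proof (cases "u = 0")
    case False
    then have "0 < u * y" "0 \<le> (1 - u) * z" using that g1 by auto
    then show ?thesis unfolding \<beta>_def by linarith
  qed (use g1 in \<open>simp add: \<beta>_def\<close>)
  have \<delta>0: "1 \<le> \<delta> u" if "u \<in> {0..1}" for u using that g1 by (simp add: \<delta>_def)
  have M0: "0 < M u" if "u \<in> {0..1}" for u
    unfolding M_def using q1[OF that] \<beta>0[OF that] \<delta>0[OF that] g1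
    by (intro add_pos_pos mult_pos_pos) auto
  have dq: "(q has_real_derivative 2 * (1 - 2 * u) * (x - 1)) (at u within S)" for u S
    unfolding q_def by (auto intro!: derivative_eq_intros simp: algebra_simps)
  have db: "(\<beta> has_real_derivative (y - z)) (at u within S)" for u S
    unfolding \<beta>_def by (auto intro!: derivative_eq_intros simp: algebra_simps)
  have dd: "(\<delta> has_real_derivative (x - 1)) (at u within S)" for u S
    unfolding \<delta>_def by (auto intro!: derivative_eq_intros simp: algebra_simps)
  have "((\<lambda>u. D / (sqrt (q u) * (\<beta> u + sqrt (q u)))) has_integral (G 1 - G 0)) {0..1}"
  proof (rule fundamental_theorem_of_calculus)
    fix u :: real assume u: "u \<in> {0..1}"
    define s where "s = sqrt (q u)"
    have s: "s\<^sup>2 = q u" "0 < s" using q1[OF u] by (auto simp: s_def)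
    define M' where "M' = (1 - 2 * u) * (x - 1) / s * (1 + z) + (y - z) + (x - 1)"
    have dM: "(M has_real_derivative M') (at u within {0..1})"
      unfolding M_def using s q1[OF u]
      by (auto intro!: derivative_eq_intros dq db dd simp: M'_def s_def field_simps)
    have M: "M u \<noteq> 0" using M0[OF u] by simp
    have dDu: "((\<lambda>u. D * u) has_real_derivative D) (at u within {0..1})"
      by (auto intro!: derivative_eq_intros)
    have "(G has_real_derivative 2 * (inverse (1 + (D * u / M u)\<^sup>2) * ((D * M u - D * u * M') / (M u * M u))))
        (at u within {0..1})"
      unfolding G_def
      by (intro DERIV_cmult DERIV_chain2[OF DERIV_arctan DERIV_divide[OF dDu dM M]])
    also have "2 * (inverse (1 + (D * u / M u)\<^sup>2) * ((D * M u - D * u * M') / (M u * M u)))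
       = 2 * D * (M u - u * M') / ((M u)\<^sup>2 + u\<^sup>2 * D\<^sup>2)"
    proof -
      have "M u * M u * (1 + (D * u / M u)\<^sup>2) = (M u)\<^sup>2 + u\<^sup>2 * D\<^sup>2"
        using M by (simp add: field_simps power2_eq_square)
      moreover have "2 * (inverse k * ((D * M u - D * u * M') / (M u * M u)))
          = 2 * D * (M u - u * M') / (M u * M u * k)" for k
        by (simp add: divide_inverse algebra_simps)
      ultimately show ?thesis by presburger
    qed
    also have "(M u)\<^sup>2 + u\<^sup>2 * D\<^sup>2 = 2 * (1 + z) * (s + \<beta> u) * (s + \<delta> u)"
    proof -
      have "M u = s * (1 + z) + \<beta> u + \<delta> u" by (simp add: M_def s_def)
      then show ?thesis using s(1) D(2) unfolding q_def \<beta>_def \<delta>_def gram_def by algebra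
    qed
    also have "M u - u * M' = (1 + z) * (s + \<delta> u) / s"
    proof -
      have "s * (M u - u * M') = (1 + z) * (s\<^sup>2 - u * (1 - 2 * u) * (x - 1)) + s * (\<beta> u + \<delta> u - u * (y - z) - u * (x - 1))"
        using s(2) unfolding M'_def M_def s_def[symmetric] by (simp add: field_simps power2_eq_square)
      also have "\<dots> = (1 + z) * (s + \<delta> u)"
        unfolding s(1) q_def \<beta>_def \<delta>_def by (simp add: power2_eq_square algebra_simps)
      finally show ?thesis using s(2) by (simp add: field_simps)
    qed
    also have "2 * D * ((1 + z) * (s + \<delta> u) / s) / (2 * (1 + z) * (s + \<beta> u) * (s + \<delta> u)) = D / (s * (\<beta> u + s))"
    proof -
      have "1 + z \<noteq> 0" "s + \<delta> u \<noteq> 0" "s \<noteq> 0" "s + \<beta> u \<noteq> 0" using g1 s(2) \<delta>0[OF u] \<beta>0[OF u] by linarith+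
      then show ?thesis by (simp add: divide_simps) (simp add: algebra_simps)
    qed
    finally show "(G has_vector_derivative D / (sqrt (q u) * (\<beta> u + sqrt (q u)))) (at u within {0..1})"
      unfolding s_def by (simp add: has_real_derivative_iff_has_vector_derivative)
  qed simp
  moreover have "G 1 - G 0 = 2 * arctan (D / (1 + x + y + z))"
    by (simp add: G_def M_def q_def \<beta>_def \<delta>_def algebra_simps)
  ultimately show ?thesis by (simp add: integral_unique)
qed

text \<open>
  Cramer's rule: the coefficients of a linear combination of independent vectors can be read off.
\<close>

lemma triple_combination:
  "triple (a *\<^sub>R A + b *\<^sub>R B + c *\<^sub>R C) B C = a * triple A B C"
  "triple A (a *\<^sub>R A + b *\<^sub>R B + c *\<^sub>R C) C = b * triple A B C"
  "triple A B (a *\<^sub>R A + b *\<^sub>R B + c *\<^sub>R C) = c * triple A B C"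
  by (simp_all add: triple_def algebra_simps)

locale hyp_triangle =
  fixes A B C :: h2
  assumes hyp: "A \<in> hyp_space" "B \<in> hyp_space" "C \<in> hyp_space"
    and distinct: "A \<noteq> B" "A \<noteq> C" "B \<noteq> C"
begin

text \<open>
  Projective coordinates on the triangle: \<open>u = fst p\<close> selects a point of the flat segment from \<open>B\<close> to
  \<open>C\<close>, and \<open>r = snd p\<close> moves from \<open>A\<close> to that point. Dividing by the Lorentz norm projects the flat
  triangle radially to the hyperboloid.
\<close>

definition cone_pt :: "real \<times> real \<Rightarrow> h2" where
  "cone_pt p = (1 - snd p) *\<^sub>R A + (snd p * (1 - fst p)) *\<^sub>R B + (snd p * fst p) *\<^sub>R C"

text \<open>
  The partial derivatives of \<open>cone_pt\<close>.
\<close>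

definition cone_u :: "real \<times> real \<Rightarrow> h2" where "cone_u p = snd p *\<^sub>R (C - B)"
definition cone_r :: "real \<times> real \<Rightarrow> h2" where "cone_r p = (1 - fst p) *\<^sub>R B + fst p *\<^sub>R C - A"

definition Q :: "real \<times> real \<Rightarrow> real" where "Q p = - lorentz (cone_pt p) (cone_pt p)"

definition chart :: "real \<times> real \<Rightarrow> real \<times> real" where
  "chart p = snd (cone_pt p) /\<^sub>R sqrt (Q p)"

text \<open>
  The derivative of \<open>chart\<close> by the quotient rule, where \<open>w'\<close> is the derivative of \<open>cone_pt\<close>.
\<close>

definition chart' :: "real \<times> real \<Rightarrow> real \<times> real \<Rightarrow> real \<times> real" where
  "chart' p h = (let w' = fst h *\<^sub>R cone_u p + snd h *\<^sub>R cone_r p in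
     snd w' /\<^sub>R sqrt (Q p) + (lorentz (cone_pt p) w' / (Q p * sqrt (Q p))) *\<^sub>R snd (cone_pt p))"

abbreviation "square \<equiv> cbox (0::real, 0::real) (1, 1)"

lemma square_iff: "p \<in> square \<longleftrightarrow> 0 \<le> fst p \<and> fst p \<le> 1 \<and> 0 \<le> snd p \<and> snd p \<le> 1"
  by (cases p) (auto simp: mem_box Basis_prod_def)

text \<open>
  The mutual products of the vertices are at most \<open>-1\<close>, so minus the Lorentz square of a nonnegative combination is
  smallest when they all equal \<open>-1\<close>. In particular the cone over the triangle avoids the light cone and the charts are smooth.
\<close>

lemma combination_ge_1:
  assumes "0 \<le> a" "0 \<le> b" "0 \<le> c"
  shows "(a + b + c)\<^sup>2 \<le> - lorentz (a *\<^sub>R A + b *\<^sub>R B + c *\<^sub>R C) (a *\<^sub>R A + b *\<^sub>R B + c *\<^sub>R C)"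
proof -
  have le: "s * t \<le> s * t * (- l)" if "l \<le> -1" "0 \<le> s" "0 \<le> t" for s t l :: real
    using that mult_left_mono[of 1 "- l" "s * t"] by simp
  note le[OF lorentz_le_minus_one[OF hyp(1,2)] assms(1,2)] le[OF lorentz_le_minus_one[OF hyp(1,3)] assms(1,3)]
    le[OF lorentz_le_minus_one[OF hyp(2,3)] assms(2,3)]
  then show ?thesis
    using hyp[THEN hyp_space_lorentz_self]
    by (simp add: lorentz_bilinear lorentz_commute[of B A] lorentz_commute[of C A] lorentz_commute[of C B]
        power2_eq_square algebra_simps)
qed

lemma Q_ge_1:
  assumes "p \<in> square"
  shows "1 \<le> Q p"
proof -
  have "1 = ((1 - snd p) + snd p * (1 - fst p) + snd p * fst p)\<^sup>2" by (simp add: algebra_simps)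
  also have "\<dots> \<le> Q p"
    unfolding Q_def cone_pt_def using assms by (intro combination_ge_1) (auto simp: square_iff)
  finally show ?thesis .
qed

lemma fst_cone_pt_pos:
  assumes "p \<in> square"
  shows "0 < fst (cone_pt p)"
proof -
  have c: "0 \<le> 1 - snd p" "0 \<le> snd p * (1 - fst p)" "0 \<le> snd p * fst p"
    using assms by (auto simp: square_iff)
  have s: "(1 - snd p) + snd p * (1 - fst p) + snd p * fst p = 1" by (simp add: algebra_simps)
  \<comment> \<open>\<open>cone_pt p\<close> is a convex combination of the vertices, whose time coordinates are positive.\<close>
  define m where "m = min (fst A) (min (fst B) (fst C))"
  have m: "0 < m" "m \<le> fst A" "m \<le> fst B" "m \<le> fst C"
    using hyp[THEN hyp_space_fst_pos] by (auto simp: m_def)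
  have "m = (1 - snd p) * m + snd p * (1 - fst p) * m + snd p * fst p * m"
    using s by (metis distrib_right mult_1)
  also have "\<dots> \<le> fst (cone_pt p)"
    unfolding cone_pt_def using c m by (auto intro!: add_mono mult_left_mono)
  finally show ?thesis using m(1) by simp
qed

lemma cone_pt_normalized:
  assumes "p \<in> square"
  shows "cone_pt p /\<^sub>R sqrt (Q p) \<in> hyp_space"
proof -
  have q: "0 < Q p" using Q_ge_1[OF assms] by simp
  have "lorentz (k *\<^sub>R cone_pt p) (k *\<^sub>R cone_pt p) = - (Q p * (k * k))" for k
    by (simp add: lorentz_bilinear Q_def)
  then have "lorentz (cone_pt p /\<^sub>R sqrt (Q p)) (cone_pt p /\<^sub>R sqrt (Q p)) = - (Q p / (sqrt (Q p) * sqrt (Q p)))"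
    by (simp only: divide_inverse inverse_mult_distrib)
  then show ?thesis using q fst_cone_pt_pos[OF assms] by (simp add: hyp_space_def)
qed

text \<open>
  The hull consists of the combinations with nonnegative coefficients that lie on the hyperboloid.
  Scaling the coefficients to sum 1 gives a point of the flat triangle, and the scaling factor is
  forced by the Lorentz norm.
\<close>

lemma snd_hhull: "snd ` hhull {A, B, C} = chart ` square"
proof (intro equalityI subsetI)
  fix y assume "y \<in> chart ` square"
  then obtain p where p: "p \<in> square" "y = chart p" by auto
  let ?N = "cone_pt p /\<^sub>R sqrt (Q p)" and ?c = "inverse (sqrt (Q p))"
  let ?f = "\<lambda>X. if X = A then ?c * (1 - snd p) else if X = B then ?c * (snd p * (1 - fst p)) else ?c * (snd p * fst p)"
  have "(\<Sum>X\<in>{A,B,C}. ?f X *\<^sub>R X) = ?f A *\<^sub>R A + (?f B *\<^sub>R B + ?f C *\<^sub>R C)"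
    using distinct by simp
  also have "\<dots> = ?N"
    using distinct[symmetric] by (simp add: cone_pt_def scaleR_add_right add.assoc)
  finally have "?N = (\<Sum>X\<in>{A,B,C}. ?f X *\<^sub>R X)" ..
  moreover have "\<forall>X\<in>{A,B,C}. 0 \<le> ?f X" using p(1) Q_ge_1[OF p(1)] by (auto simp: square_iff)
  ultimately have "?N \<in> hhull {A,B,C}"
    using cone_pt_normalized[OF p(1)] unfolding hhull_def by (intro CollectI conjI exI[of _ ?f])
  moreover have "y = snd ?N" by (simp add: p chart_def)
  ultimately show "y \<in> snd ` hhull {A,B,C}" by blast
next
  fix y assume "y \<in> snd ` hhull {A,B,C}"
  then obtain X where X: "X \<in> hhull {A,B,C}" "y = snd X" by auto
  then obtain f where f: "X \<in> hyp_space" "\<forall>Y\<in>{A,B,C}. 0 \<le> f Y" "X = (\<Sum>Y\<in>{A,B,C}. f Y *\<^sub>R Y)"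
    unfolding hhull_def by blast
  define a b c where "a = f A" and "b = f B" and "c = f C"
  have abc: "0 \<le> a" "0 \<le> b" "0 \<le> c" using f(2) by (auto simp: a_def b_def c_def)
  have Xeq: "X = a *\<^sub>R A + b *\<^sub>R B + c *\<^sub>R C"
    using f(3) distinct by (simp add: a_def b_def c_def add.assoc)
  define l where "l = a + b + c"
  have l: "0 < l"
  proof -
    have "l \<noteq> 0"
    proof
      assume "l = 0"
      then have "a = 0" "b = 0" "c = 0" using abc by (auto simp: l_def)
      then show False using f(1) Xeq by (simp add: hyp_space_def)
    qed
    then show ?thesis using abc by (simp add: l_def)
  qed
  define r where "r = (b + c) / l"
  \<comment> \<open>At the vertex \<open>A\<close> every value of \<open>u\<close> gives the same point.\<close>
  define u where "u = (if b + c = 0 then 0 else c / (b + c))"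
  have ru: "1 - r = a / l" "r * u = c / l" "r * (1 - u) = b / l"
  proof -
    show ru2: "r * u = c / l"
      using abc by (cases "b + c = 0") (auto simp: r_def u_def add_nonneg_eq_0_iff)
    have "r * (1 - u) = (b + c) / l - c / l"
      by (simp only: right_diff_distrib ru2) (simp add: r_def)
    then show "r * (1 - u) = b / l" by (simp add: add_divide_distrib)
    show "1 - r = a / l" using l by (simp add: r_def l_def field_simps)
  qed
  have sq: "(u, r) \<in> square"
    unfolding square_iff r_def u_def using abc l by (auto simp: l_def field_simps)
  have "X = l *\<^sub>R cone_pt (u, r)"
    using l by (simp add: cone_pt_def ru Xeq scaleR_add_right)
  moreover have "l = 1 / sqrt (Q (u, r))"
  proof -
    have "l\<^sup>2 * Q (u, r) = 1"
      using hyp_space_lorentz_self[OF f(1)]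
      unfolding Q_def \<open>X = l *\<^sub>R cone_pt (u, r)\<close> by (simp add: lorentz_bilinear power2_eq_square)
    moreover have "0 < Q (u, r)" using Q_ge_1[OF sq] by simp
    ultimately have "Q (u, r) = (1 / l)\<^sup>2" using l by (simp add: field_simps)
    then have "sqrt (Q (u, r)) = 1 / l" using l by (simp add: real_sqrt_unique)
    then show ?thesis by simp
  qed
  ultimately have "y = chart (u, r)"
    by (simp add: X chart_def divide_inverse)
  with sq show "y \<in> chart ` square" by blast
qed

lemma inj_on_chart:
  assumes "triple A B C \<noteq> 0"
  shows "inj_on chart {p \<in> square. 0 < snd p}"
proof (rule inj_onI)
  fix p p' assume p: "p \<in> {p \<in> square. 0 < snd p}" and p': "p' \<in> {p \<in> square. 0 < snd p}"
    and e: "chart p = chart p'"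
  have eq: "cone_pt p /\<^sub>R sqrt (Q p) = cone_pt p' /\<^sub>R sqrt (Q p')"
  proof (rule hyp_space_eqI)
    show "cone_pt p /\<^sub>R sqrt (Q p) \<in> hyp_space" "cone_pt p' /\<^sub>R sqrt (Q p') \<in> hyp_space"
      using p p' by (auto intro: cone_pt_normalized)
    show "snd (cone_pt p /\<^sub>R sqrt (Q p)) = snd (cone_pt p' /\<^sub>R sqrt (Q p'))"
      using e by (simp add: chart_def)
  qed
  define k k' where "k = inverse (sqrt (Q p))" and "k' = inverse (sqrt (Q p'))"
  have k: "0 < k" "0 < k'" using Q_ge_1[of p] Q_ge_1[of p'] p p' by (auto simp: k_def k'_def)
  have "(k * (1 - snd p)) *\<^sub>R A + (k * (snd p * (1 - fst p))) *\<^sub>R B + (k * (snd p * fst p)) *\<^sub>R C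
      = (k' * (1 - snd p')) *\<^sub>R A + (k' * (snd p' * (1 - fst p'))) *\<^sub>R B + (k' * (snd p' * fst p')) *\<^sub>R C"
    using eq by (simp add: cone_pt_def k_def k'_def scaleR_add_right)
  then have coef: "k * (1 - snd p) = k' * (1 - snd p')" "k * (snd p * (1 - fst p)) = k' * (snd p' * (1 - fst p'))"
      "k * (snd p * fst p) = k' * (snd p' * fst p')"
    using assms triple_combination by (metis mult_cancel_right)+
  then have "k = k'" by (simp add: algebra_simps)
  with coef k have "snd p = snd p'" "snd p * fst p = snd p' * fst p'" by auto
  then show "p = p'" using p by (auto simp: prod_eq_iff)
qed

lemma has_derivative_cone_pt:
  "(cone_pt has_derivative (\<lambda>h. fst h *\<^sub>R cone_u p + snd h *\<^sub>R cone_r p)) (at p within S)"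
proof -
  have "(cone_pt has_derivative (\<lambda>h. (- snd h) *\<^sub>R A + (snd h * (1 - fst p) + snd p * (- fst h)) *\<^sub>R B
      + (snd h * fst p + snd p * fst h) *\<^sub>R C)) (at p within S)"
    unfolding cone_pt_def
    by (rule derivative_eq_intros refl | simp add: algebra_simps)+
  then show ?thesis
    by (rule has_derivative_eq_rhs) (simp add: fun_eq_iff cone_u_def cone_r_def algebra_simps)
qed

lemma has_derivative_Q:
  "(Q has_derivative (\<lambda>h. -2 * lorentz (cone_pt p) (fst h *\<^sub>R cone_u p + snd h *\<^sub>R cone_r p))) (at p within S)"
proof -
  let ?w' = "\<lambda>h. fst h *\<^sub>R cone_u p + snd h *\<^sub>R cone_r p"
  note d = has_derivative_cone_pt[of p S]
  have "(Q has_derivative (\<lambda>h. - ((snd (cone_pt p) \<bullet> snd (?w' h) + snd (?w' h) \<bullet> snd (cone_pt p))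
     - (fst (cone_pt p) * fst (?w' h) + fst (?w' h) * fst (cone_pt p))))) (at p within S)"
    unfolding Q_def lorentz_def
    by (intro has_derivative_minus has_derivative_diff has_derivative_inner has_derivative_mult
        has_derivative_fst has_derivative_snd d)
  then show ?thesis
    by (rule has_derivative_eq_rhs) (simp only: fun_eq_iff lorentz_def, simp add: inner_commute)
qed

lemma has_derivative_chart:
  assumes "p \<in> square"
  shows "(chart has_derivative chart' p) (at p within S)"
proof -
  let ?w' = "\<lambda>h. fst h *\<^sub>R cone_u p + snd h *\<^sub>R cone_r p"
  have q: "0 < Q p" using Q_ge_1[OF assms] by simp
  have "DERIV (\<lambda>q. inverse (sqrt q)) (Q p) :> - (inverse (sqrt (Q p)) * inverse (Q p) / 2)"
    using q DERIV_inverse_fun[OF DERIV_real_sqrt[OF q]] by simp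
  from DERIV_compose_FDERIV[OF this has_derivative_Q[of p S]]
  have "((\<lambda>p. inverse (sqrt (Q p))) has_derivative (\<lambda>h. lorentz (cone_pt p) (?w' h) / (Q p * sqrt (Q p)))) (at p within S)"
  proof (rule has_derivative_eq_rhs)
    have "-2 * l * - (inverse s * inverse q / 2) = l / (q * s)" for l s q :: real
      by (simp add: field_simps)
    then show "(\<lambda>h. -2 * lorentz (cone_pt p) (?w' h) * - (inverse (sqrt (Q p)) * inverse (Q p) / 2)) =
        (\<lambda>h. lorentz (cone_pt p) (?w' h) / (Q p * sqrt (Q p)))"
      by (simp only:)
  qed
  from has_derivative_scaleR[OF this has_derivative_snd[OF has_derivative_cone_pt[of p S]]]
  have "(chart has_derivative (\<lambda>h. inverse (sqrt (Q p)) *\<^sub>R snd (?w' h) +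
      (lorentz (cone_pt p) (?w' h) / (Q p * sqrt (Q p))) *\<^sub>R snd (cone_pt p))) (at p within S)"
    unfolding chart_def .
  then show ?thesis
    unfolding chart'_def Let_def .
qed

lemma triple_cone: "triple (cone_pt p) (cone_u p) (cone_r p) = - snd p * triple A B C"
  unfolding cone_pt_def cone_u_def cone_r_def triple_def by (simp add: algebra_simps)

text \<open>
  The Jacobian determinant of the chart. For the radial projection, the determinant of
  \<open>cone_pt\<close>, \<open>cone_u\<close>, \<open>cone_r\<close> appears; it is linear in \<open>snd p\<close> by \<open>triple_cone\<close>.
\<close>

lemma chart'_det:
  assumes "p \<in> square"
  shows "fst (chart' p (1,0)) * snd (chart' p (0,1)) - fst (chart' p (0,1)) * snd (chart' p (1,0))
    = - (fst (cone_pt p) * snd p * triple A B C) / (Q p)\<^sup>2"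
proof -
  obtain w0 w1 w2 where w: "cone_pt p = (w0, w1, w2)" by (metis surj_pair)
  obtain a0 a1 a2 where a: "cone_u p = (a0, a1, a2)" by (metis surj_pair)
  obtain b0 b1 b2 where b: "cone_r p = (b0, b1, b2)" by (metis surj_pair)
  define la lb where "la = lorentz (cone_pt p) (cone_u p)" and "lb = lorentz (cone_pt p) (cone_r p)"
  define q where "q = Q p"
  have q: "0 < q" using Q_ge_1[OF assms] by (simp add: q_def)
  have s: "sqrt q * sqrt q = q" "sqrt q \<noteq> 0" using q by auto
  have la: "la = a1 * w1 + a2 * w2 - a0 * w0" and lb: "lb = b1 * w1 + b2 * w2 - b0 * w0"
    and qq: "q = w0 * w0 - w1 * w1 - w2 * w2"
    by (simp_all add: la_def lb_def q_def Q_def lorentz_def a b w)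
  have t: "w0 * (a1 * b2 - a2 * b1) - a0 * (w1 * b2 - w2 * b1) + b0 * (w1 * a2 - w2 * a1) = - snd p * triple A B C"
    using triple_cone[of p] by (simp add: a b w triple_def)
  have "fst (chart' p (1,0)) * snd (chart' p (0,1)) - fst (chart' p (0,1)) * snd (chart' p (1,0))
    = (a1 / sqrt q + la / (q * sqrt q) * w1) * (b2 / sqrt q + lb / (q * sqrt q) * w2)
      - (b1 / sqrt q + lb / (q * sqrt q) * w1) * (a2 / sqrt q + la / (q * sqrt q) * w2)"
    unfolding chart'_def Let_def fst_conv snd_conv scaleR_zero_left scaleR_one add_0_left add_0_right
      la_def[symmetric] lb_def[symmetric] q_def[symmetric]
    by (simp add: a b w divide_inverse mult.commute)
  also have "\<dots> = ((a1 * q + la * w1) * (b2 * q + lb * w2) - (b1 * q + lb * w1) * (a2 * q + la * w2)) / q ^ 3"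
  proof -
    have "x / sqrt q + l / (q * sqrt q) * y = (x * q + l * y) / (q * sqrt q)" for x l y
      using q s by (simp add: field_simps)
    moreover have "(x / (q * sqrt q)) * (y / (q * sqrt q)) = x * y / q ^ 3" for x y
    proof -
      have "(q * sqrt q) * (q * sqrt q) = q ^ 3"
        using s(1) by (simp add: power3_eq_cube mult.assoc mult.left_commute[of "sqrt q"])
      then show ?thesis by (metis times_divide_times_eq)
    qed
    ultimately show ?thesis by (simp only: diff_divide_distrib)
  qed
  also have "(a1 * q + la * w1) * (b2 * q + lb * w2) - (b1 * q + lb * w1) * (a2 * q + la * w2)
      = q * (w0 * (w0 * (a1 * b2 - a2 * b1) - a0 * (w1 * b2 - w2 * b1) + b0 * (w1 * a2 - w2 * a1)))"
  proof -
    have k: "q * (a1 * b2 - a2 * b1) + lb * (a1 * w2 - a2 * w1) + la * (w1 * b2 - w2 * b1)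
        = w0 * (w0 * (a1 * b2 - a2 * b1) - a0 * (w1 * b2 - w2 * b1) + b0 * (w1 * a2 - w2 * a1))"
      unfolding la lb qq by (simp add: algebra_simps)
    show ?thesis unfolding k[symmetric] by (simp add: algebra_simps)
  qed
  finally show ?thesis
    unfolding t using q by (simp add: w q_def[symmetric] power2_eq_square power3_eq_cube)
qed

definition chart_vec :: "real ^ 2 \<Rightarrow> real ^ 2" where
  "chart_vec v = vec_of_pair (chart (pair_of_vec v))"

definition chart_vec' :: "real ^ 2 \<Rightarrow> real ^ 2 \<Rightarrow> real ^ 2" where
  "chart_vec' v h = vec_of_pair (chart' (pair_of_vec v) (pair_of_vec h))"

lemma pair_of_vec_square: "pair_of_vec v \<in> square \<longleftrightarrow> v \<in> cbox 0 1"
  by (auto simp: square_iff mem_box_cart forall_2 pair_of_vec_def)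

lemma has_derivative_chart_vec:
  assumes "v \<in> cbox 0 1"
  shows "(chart_vec has_derivative chart_vec' v) (at v within S)"
proof -
  have "((\<lambda>v. chart (pair_of_vec v)) has_derivative (\<lambda>h. chart' (pair_of_vec v) (pair_of_vec h))) (at v within S)"
    by (rule has_derivative_compose[OF bounded_linear.has_derivative[OF bounded_linear_pair_of_vec has_derivative_ident]
          has_derivative_chart]) (use assms in \<open>simp add: pair_of_vec_square\<close>)
  from bounded_linear.has_derivative[OF bounded_linear_vec_of_pair this]
  show ?thesis by (simp add: chart_vec_def[abs_def] chart_vec'_def[abs_def])
qed

lemma det_chart_vec':
  assumes "v \<in> cbox 0 1"
  shows "det (matrix (chart_vec' v)) =
    - (fst (cone_pt (pair_of_vec v)) * v $ 2 * triple A B C) / (Q (pair_of_vec v))\<^sup>2"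
proof -
  have "pair_of_vec (axis 1 1) = (1, 0)" "pair_of_vec (axis 2 1) = (0, 1)"
    by (simp_all add: pair_of_vec_def axis_def)
  moreover have "snd (pair_of_vec v) = v $ 2" by (simp add: pair_of_vec_def)
  ultimately show ?thesis
    using chart'_det[OF iffD2[OF pair_of_vec_square assms]]
    by (simp add: det_2 matrix_def chart_vec'_def vec_of_pair_nth)
qed

definition area_density :: "real \<times> real \<Rightarrow> real" where "area_density y = 1 / sqrt (1 + (norm y)\<^sup>2)"

lemma continuous_on_chart: "continuous_on square chart"
  by (meson continuous_on_eq_continuous_within has_derivative_chart has_derivative_continuous)

lemma hyp_area_eq_integral:
  "hyp_area (hhull {A, B, C}) = integral (chart_vec ` cbox 0 1) (\<lambda>v. area_density (pair_of_vec v))"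
proof -
  have c: "continuous_on UNIV area_density"
    unfolding area_density_def by (intro continuous_intros) (auto simp: add_nonneg_eq_0_iff)
  have "hyp_area (hhull {A, B, C}) = set_lebesgue_integral lborel (chart ` square) area_density"
    by (simp add: hyp_area_def snd_hhull area_density_def[abs_def])
  also have "\<dots> = integral (vec_of_pair ` chart ` square) (\<lambda>v. area_density (pair_of_vec v))"
    by (intro compact_integral_pair_of_vec compact_continuous_image continuous_on_chart compact_cbox
        continuous_on_subset[OF c]) auto
  also have "vec_of_pair ` chart ` square = chart_vec ` cbox 0 1"
  proof -
    have "chart_vec ` cbox 0 1 = vec_of_pair ` chart ` pair_of_vec ` cbox 0 1"
      by (auto simp: chart_vec_def image_iff)
    moreover have "pair_of_vec ` cbox 0 1 = square"
    proof (intro equalityI subsetI)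
      fix p assume "p \<in> square"
      then have "vec_of_pair p \<in> cbox 0 1" by (simp flip: pair_of_vec_square)
      then show "p \<in> pair_of_vec ` cbox 0 1" by (metis image_eqI pair_of_vec_of_pair)
    qed (use pair_of_vec_square in blast)
    ultimately show ?thesis by simp
  qed
  finally show ?thesis .
qed

text \<open>
  The Jacobian determinant vanishes identically, so the image of the chart is a null set by Sard's
  theorem.
\<close>

lemma hyp_area_degenerate:
  assumes "triple A B C = 0"
  shows "hyp_area (hhull {A, B, C}) = 0"
proof -
  have "negligible (chart_vec ` cbox 0 1)"
  proof (rule baby_Sard)
    fix v :: "real ^ 2" assume "v \<in> cbox 0 1"
    then show "(chart_vec has_derivative chart_vec' v) (at v within cbox 0 1)"
      by (rule has_derivative_chart_vec)
    show "rank (matrix (chart_vec' v)) < CARD(2)"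
      using det_chart_vec'[OF \<open>v \<in> cbox 0 1\<close>] assms by (simp add: det_eq_0_rank)
  qed simp
  then show ?thesis
    unfolding hyp_area_eq_integral
    by (intro integral_unique has_integral_negligible[where S = "chart_vec ` cbox 0 1"]) auto
qed

lemma area_density_chart:
  assumes "p \<in> square"
  shows "area_density (chart p) = sqrt (Q p) / fst (cone_pt p)"
proof -
  let ?w = "cone_pt p"
  have q: "0 < Q p" and f: "0 < fst ?w" using Q_ge_1[OF assms] fst_cone_pt_pos[OF assms] by auto
  have "(norm (chart p))\<^sup>2 = (norm (snd ?w))\<^sup>2 / Q p"
    using q by (simp add: chart_def power_mult_distrib power_divide divide_inverse power_inverse)
  moreover have "Q p + (norm (snd ?w))\<^sup>2 = (fst ?w)\<^sup>2"
    by (simp add: Q_def lorentz_def power2_norm_eq_inner) (simp add: power2_eq_square)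
  ultimately have "1 + (norm (chart p))\<^sup>2 = (fst ?w)\<^sup>2 / Q p"
    using q by (simp add: field_simps)
  then show ?thesis using f by (simp add: area_density_def real_sqrt_divide)
qed

text \<open>
  The factor \<open>fst (cone_pt p)\<close> of the Jacobian cancels against the area density. The chart
  collapses the side \<open>r = 0\<close> of the square to the vertex \<open>A\<close>, so the substitution is made on the
  complement of that side; what is left out is a null set before and after the substitution.
\<close>

lemma hyp_area_eq_square_integral:
  assumes D: "triple A B C \<noteq> 0"
  shows "hyp_area (hhull {A, B, C}) =
    integral {0..1} (\<lambda>u. integral {0..1} (\<lambda>r. \<bar>triple A B C\<bar> * (r / sqrt (Q (u, r)) ^ 3)))"
proof -
  let ?S = "{v \<in> cbox 0 1. 0 < v $ 2} :: (real ^ 2) set"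
  define \<phi> where "\<phi> p = \<bar>triple A B C\<bar> * (snd p / sqrt (Q p) ^ 3)" for p
  \<comment> \<open>Scalar functions are regarded as functions with values in \<open>real ^ 1\<close> for the substitution.\<close>
  define F :: "real ^ 2 \<Rightarrow> real ^ 1" where "F v = vec (area_density (pair_of_vec v))" for v
  define G :: "real ^ 2 \<Rightarrow> real ^ 1" where "G v = vec (\<phi> (pair_of_vec v))" for v
  have cQ: "continuous_on square Q"
    using has_derivative_Q by (meson continuous_on_eq_continuous_within has_derivative_continuous)
  have c\<phi>: "continuous_on square \<phi>"
  proof -
    have "sqrt (Q p) ^ 3 \<noteq> 0" if "p \<in> square" for p using Q_ge_1[OF that] by simp
    then show ?thesis unfolding \<phi>_def by (intro continuous_intros cQ) auto
  qed
  have cG: "continuous_on (cbox 0 1) G"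
  proof -
    have "continuous_on (cbox 0 1) (\<lambda>v. \<phi> (pair_of_vec v))"
      by (intro continuous_on_compose2[OF c\<phi>] bounded_linear.continuous_on[OF bounded_linear_pair_of_vec]
          continuous_on_id) (use pair_of_vec_square in blast)
    then show ?thesis unfolding G_def vec_def by (intro continuous_on_vec_lambda)
  qed
  have Sb: "?S \<in> sets lebesgue"
  proof -
    have "?S = cbox 0 1 \<inter> {v. 0 < v $ 2}" by auto
    moreover have "open {v :: real ^ 2. 0 < v $ 2}" by (intro open_Collect_less continuous_intros)
    ultimately have "?S \<in> sets borel" by auto
    then show ?thesis by (simp add: sets_completionI_sets)
  qed
  have jac: "\<bar>det (matrix (chart_vec' v))\<bar> *\<^sub>R F (chart_vec v) = G v" if "v \<in> ?S" for v
  proof -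
    let ?p = "pair_of_vec v"
    have p: "?p \<in> square" "0 < v $ 2" "snd ?p = v $ 2"
      using that pair_of_vec_square[of v] by (simp_all add: pair_of_vec_def)
    have q: "0 < Q ?p" and f: "0 < fst (cone_pt ?p)" using Q_ge_1[OF p(1)] fst_cone_pt_pos[OF p(1)] by auto
    have "\<bar>det (matrix (chart_vec' v))\<bar> * area_density (pair_of_vec (chart_vec v)) =
        (fst (cone_pt ?p) * v $ 2 * \<bar>triple A B C\<bar>) / (Q ?p)\<^sup>2 * (sqrt (Q ?p) / fst (cone_pt ?p))"
      using that f p by (simp add: det_chart_vec' chart_vec_def area_density_chart abs_mult)
    also have "\<dots> = \<phi> ?p"
    proof -
      define k where "k = sqrt (Q ?p)"
      have k: "Q ?p = k\<^sup>2" "0 < k" using q by (auto simp: k_def)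
      show ?thesis unfolding \<phi>_def k_def[symmetric] p(3) unfolding k(1)
        using k(2) f by (simp add: field_simps power2_eq_square power3_eq_cube)
    qed
    finally show ?thesis by (simp add: F_def G_def vec_eq_iff)
  qed
  have inj: "inj_on chart_vec ?S"
  proof (rule inj_onI)
    fix v v' assume v: "v \<in> ?S" "v' \<in> ?S" and e: "chart_vec v = chart_vec v'"
    have "chart (pair_of_vec v) = chart (pair_of_vec v')"
      using e unfolding chart_vec_def by (metis pair_of_vec_of_pair)
    then have "pair_of_vec v = pair_of_vec v'"
    proof (rule inj_onD[OF inj_on_chart[OF D]])
      show "pair_of_vec v \<in> {p \<in> square. 0 < snd p}" "pair_of_vec v' \<in> {p \<in> square. 0 < snd p}"
        using v pair_of_vec_square[of v] pair_of_vec_square[of v'] by (simp_all add: pair_of_vec_def)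
    qed
    then show "v = v'" by (metis vec_of_pair_of_vec)
  qed
  have Gint: "G absolutely_integrable_on ?S"
    by (rule set_integrable_subset[OF absolutely_integrable_continuous[OF cG] Sb]) auto
  have "F absolutely_integrable_on chart_vec ` ?S \<and> integral (chart_vec ` ?S) F = integral ?S G"
  proof (rule iffD1[OF has_absolute_integral_change_of_variables[OF Sb _ inj]])
    show "(chart_vec has_derivative chart_vec' v) (at v within ?S)" if "v \<in> ?S" for v
      using that by (intro has_derivative_chart_vec) auto
    have "(\<lambda>v. \<bar>det (matrix (chart_vec' v))\<bar> *\<^sub>R F (chart_vec v)) absolutely_integrable_on ?S"
      by (rule absolutely_integrable_spike[OF Gint negligible_empty]) (use jac in auto)
    moreover have "integral ?S (\<lambda>v. \<bar>det (matrix (chart_vec' v))\<bar> *\<^sub>R F (chart_vec v)) = integral ?S G"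
      by (rule Henstock_Kurzweil_Integration.integral_cong) (use jac in auto)
    ultimately show "(\<lambda>v. \<bar>det (matrix (chart_vec' v))\<bar> *\<^sub>R F (chart_vec v)) absolutely_integrable_on ?S \<and>
       integral ?S (\<lambda>v. \<bar>det (matrix (chart_vec' v))\<bar> *\<^sub>R F (chart_vec v)) = integral ?S G" by blast
  qed
  then have Fint: "F integrable_on chart_vec ` ?S" and FG: "integral (chart_vec ` ?S) F = integral ?S G"
    using set_lebesgue_integral_eq_integral(1) by blast+
  have "integral (chart_vec ` ?S) (\<lambda>v. area_density (pair_of_vec v)) = integral (chart_vec ` ?S) F $ 1"
    using integral_component_eq_cart[OF Fint] by (simp add: F_def)
  also have "\<dots> = integral ?S (\<lambda>v. \<phi> (pair_of_vec v))"
    unfolding FG using integral_component_eq_cart[OF set_lebesgue_integral_eq_integral(1)[OF Gint]]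
    by (simp add: G_def)
  also have "\<dots> = integral (cbox 0 1) (\<lambda>v. \<phi> (pair_of_vec v))"
  proof (rule integral_subset_negligible)
    show "negligible (cbox 0 1 - ?S)"
      by (rule negligible_subset[OF negligible_standard_hyperplane_cart[where k = 2]])
         (auto simp: mem_box_cart not_less intro: antisym)
  qed auto
  also have "\<dots> = integral {0..1} (\<lambda>u. integral {0..1} (\<lambda>r. \<phi> (u, r)))"
    by (rule integral_unit_square[OF c\<phi>])
  also have "integral (chart_vec ` ?S) (\<lambda>v. area_density (pair_of_vec v)) =
      integral (chart_vec ` cbox 0 1) (\<lambda>v. area_density (pair_of_vec v))"
  proof (rule integral_subset_negligible)
    have "chart_vec v = vec_of_pair (snd A)" if "v \<in> cbox 0 1 - ?S" for v
    proof -
      have "v $ 2 = 0" using that by (auto simp: mem_box_cart not_less intro: antisym)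
      then have "cone_pt (pair_of_vec v) = A" by (simp add: cone_pt_def pair_of_vec_def)
      then show ?thesis
        using hyp_space_lorentz_self[OF hyp(1)] by (simp add: chart_vec_def chart_def Q_def)
    qed
    then have "chart_vec ` cbox 0 1 - chart_vec ` ?S \<subseteq> {vec_of_pair (snd A)}" by blast
    then show "negligible (chart_vec ` cbox 0 1 - chart_vec ` ?S)"
      using negligible_finite negligible_subset by blast
  qed auto
  finally show ?thesis by (simp add: hyp_area_eq_integral \<phi>_def)
qed

text \<open>
  Integration over \<open>r\<close> and then over \<open>u\<close>. The condition \<open>q < \<beta>\<^sup>2\<close> of the first integral holds because \<open>A\<close> is
  not in the plane of \<open>B\<close> and \<open>C\<close>.
\<close>

theorem hyp_area_eq_arctan:
  "hyp_area (hhull {A, B, C}) =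
    2 * arctan (\<bar>triple A B C\<bar> / (1 - lorentz B C - lorentz A C - lorentz A B))"
proof (cases "triple A B C = 0")
  case True
  then show ?thesis by (simp add: hyp_area_degenerate)
next
  case False
  define D where "D = \<bar>triple A B C\<bar>"
  define x y z where "x = - lorentz B C" and "y = - lorentz A C" and "z = - lorentz A B"
  define q where "q u = 1 + 2 * u * (1 - u) * (x - 1)" for u
  define \<beta> where "\<beta> u = (1 - u) * z + u * y" for u
  have g1: "1 < x" "1 < y" "1 < z"
    using lorentz_less_minus_one[OF hyp(2,3)] lorentz_less_minus_one[OF hyp(1,3)]
      lorentz_less_minus_one[OF hyp(1,2)] distinct by (auto simp: x_def y_def z_def)
  have D: "0 < D" "D\<^sup>2 = gram x y z"
    using False triple_sq_gram[OF hyp] by (auto simp: D_def x_def y_def z_def)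
  have inner: "integral {0..1} (\<lambda>r. D * (r / sqrt (Q (u, r)) ^ 3)) = D / (sqrt (q u) * (\<beta> u + sqrt (q u)))"
    if u: "u \<in> {0..1}" for u
  proof -
    have "Q (u, r) = (1 - r)\<^sup>2 + 2 * r * (1 - r) * \<beta> u + r\<^sup>2 * q u" for r
      using hyp[THEN hyp_space_lorentz_self]
      by (simp add: Q_def cone_pt_def lorentz_bilinear lorentz_commute[of B A] lorentz_commute[of C A]
          lorentz_commute[of C B] q_def \<beta>_def x_def y_def z_def power2_eq_square algebra_simps)
    moreover have "0 < q u" using u g1 by (simp add: q_def add_pos_nonneg)
    moreover have "0 < \<beta> u"
    proof (cases "u = 0")
      case False
      then have "0 < u * y" "0 \<le> (1 - u) * z" using u g1 by auto
      then show ?thesis unfolding \<beta>_def by linarith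
    qed (use g1 in \<open>simp add: \<beta>_def\<close>)
    moreover have "q u < (\<beta> u)\<^sup>2"
    proof -
      \<comment> \<open>Completing the square; the remainder is \<open>u\<^sup>2\<close> times the Gram determinant \<open>D\<^sup>2\<close>.\<close>
      have "(z\<^sup>2 - 1) * ((\<beta> u)\<^sup>2 - q u) = ((1 - u) * (z\<^sup>2 - 1) + u * (y * z - x))\<^sup>2 + u\<^sup>2 * D\<^sup>2"
        unfolding D(2) gram_def \<beta>_def q_def by (simp add: power2_eq_square algebra_simps)
      moreover have "0 < ((1 - u) * (z\<^sup>2 - 1) + u * (y * z - x))\<^sup>2 + u\<^sup>2 * D\<^sup>2"
      proof (cases "u = 0")
        case True
        have "1 < z\<^sup>2" using g1 by simp
        then have "0 < (z\<^sup>2 - 1)\<^sup>2" by (intro zero_less_power) linarith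
        then show ?thesis using True by simp
      next
        case False
        then show ?thesis using D(1) by (auto intro: add_nonneg_pos)
      qed
      moreover have "0 < z\<^sup>2 - 1" using g1 by simp
      ultimately show ?thesis by (metis diff_gt_0_iff_gt zero_less_mult_pos)
    qed
    ultimately have "integral {0..1} (\<lambda>r. r / sqrt (Q (u, r)) ^ 3) = 1 / (sqrt (q u) * (\<beta> u + sqrt (q u)))"
      using ray_integral[of "q u" "\<beta> u"] by simp
    then show ?thesis by (simp only: integral_mult_right) simp
  qed
  have "hyp_area (hhull {A, B, C}) = integral {0..1} (\<lambda>u. D / (sqrt (q u) * (\<beta> u + sqrt (q u))))"
    unfolding hyp_area_eq_square_integral[OF False] D_def[symmetric]
    by (rule Henstock_Kurzweil_Integration.integral_cong) (rule inner)
  also have "\<dots> = 2 * arctan (D / (1 + x + y + z))"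
    unfolding q_def \<beta>_def by (rule integral_over_rays[OF g1 D])
  finally show ?thesis by (simp add: D_def x_def y_def z_def)
qed

corollary hyp_area_eq_angle_defect:
  "hyp_area (hhull {A, B, C}) = pi - (hangle A B C + hangle B A C + hangle C A B)"
  using hyp_area_eq_arctan hangle_sum_eq[OF hyp distinct] by simp

end

section \<open>Upper angles in metric spaces\<close>

text \<open>
  The curves \<open>g\<close> and \<open>h\<close> make an angle of at most \<open>\<beta>\<close> at time 0: near time 0 their distances are at most
  those of two Euclidean rays with any larger angle below \<open>\<pi>\<close>. For \<open>\<beta> \<ge> \<pi>\<close> this is vacuous, so bounds can be
  added without distinguishing cases. The parameters replace the distances from the common
  starting point, which is justified for unit-speed geodesics.
\<close>

definition angle_bound :: "(real \<Rightarrow> 'm::metric_space) \<Rightarrow> (real \<Rightarrow> 'm) \<Rightarrow> real \<Rightarrow> bool" where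
  "angle_bound g h \<beta> \<longleftrightarrow> (\<forall>\<beta>'. \<beta> < \<beta>' \<and> \<beta>' < pi \<longrightarrow>
     (\<exists>e>0. \<forall>s t. 0 < s \<longrightarrow> s < e \<longrightarrow> 0 < t \<longrightarrow> t < e \<longrightarrow>
        (dist (g s) (h t))\<^sup>2 \<le> s\<^sup>2 + t\<^sup>2 - 2 * s * t * cos \<beta>'))"

lemma angle_bound_sym:
  assumes "angle_bound g h \<beta>"
  shows "angle_bound h g \<beta>"
  unfolding angle_bound_def
proof (intro allI impI)
  fix \<beta>' assume "\<beta> < \<beta>' \<and> \<beta>' < pi"
  then obtain e where e: "e > 0" "\<And>s t. 0 < s \<Longrightarrow> s < e \<Longrightarrow> 0 < t \<Longrightarrow> t < e \<Longrightarrow>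
      (dist (g s) (h t))\<^sup>2 \<le> s\<^sup>2 + t\<^sup>2 - 2 * s * t * cos \<beta>'"
    using assms unfolding angle_bound_def by blast
  have "(dist (h s) (g t))\<^sup>2 \<le> s\<^sup>2 + t\<^sup>2 - 2 * s * t * cos \<beta>'" if "0 < s" "s < e" "0 < t" "t < e" for s t
    using e(2)[of t s] that by (simp add: dist_commute algebra_simps)
  then show "\<exists>e>0. \<forall>s t. 0 < s \<longrightarrow> s < e \<longrightarrow> 0 < t \<longrightarrow> t < e \<longrightarrow>
      (dist (h s) (g t))\<^sup>2 \<le> s\<^sup>2 + t\<^sup>2 - 2 * s * t * cos \<beta>'"
    using e(1) by blast
qed

lemma angle_bound_cong:
  assumes b: "angle_bound g h \<beta>" and d: "0 < d" "\<And>s. 0 < s \<Longrightarrow> s < d \<Longrightarrow> h' s = h s"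
  shows "angle_bound g h' \<beta>"
  unfolding angle_bound_def
proof (intro allI impI)
  fix \<beta>' assume "\<beta> < \<beta>' \<and> \<beta>' < pi"
  then obtain e where "e > 0" "\<And>s t. 0 < s \<Longrightarrow> s < e \<Longrightarrow> 0 < t \<Longrightarrow> t < e \<Longrightarrow>
      (dist (g s) (h t))\<^sup>2 \<le> s\<^sup>2 + t\<^sup>2 - 2 * s * t * cos \<beta>'"
    using b unfolding angle_bound_def by blast
  then show "\<exists>e>0. \<forall>s t. 0 < s \<longrightarrow> s < e \<longrightarrow> 0 < t \<longrightarrow> t < e \<longrightarrow>
      (dist (g s) (h' t))\<^sup>2 \<le> s\<^sup>2 + t\<^sup>2 - 2 * s * t * cos \<beta>'"
    using d by (intro exI[of _ "min e d"]) simp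
qed

lemma cmod_cis_diff: "(cmod (of_real s * cis a - of_real t * cis b))\<^sup>2 = s\<^sup>2 + t\<^sup>2 - 2 * s * t * cos (a - b)"
proof -
  have expand: "(s * p - t * q)\<^sup>2 + (s * u - t * v)\<^sup>2 =
      s\<^sup>2 * (p\<^sup>2 + u\<^sup>2) + t\<^sup>2 * (q\<^sup>2 + v\<^sup>2) - 2 * s * t * (p * q + u * v)" for p q u v
    by (simp add: power2_eq_square algebra_simps)
  have "(cmod (of_real s * cis a - of_real t * cis b))\<^sup>2 =
      (s * cos a - t * cos b)\<^sup>2 + (s * sin a - t * sin b)\<^sup>2"
    by (simp add: cmod_power2)
  also note expand
  finally show ?thesis by (simp add: cos_diff)
qed

text \<open>
  In a Euclidean triangle with an apex angle \<open>a + b\<close> between sides \<open>s\<close> and \<open>t\<close>, the segment of length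
  \<open>r\<close> that splits the apex angle into \<open>a\<close> and \<open>b\<close> cuts the opposite side into two pieces. They bound
  \<open>d1\<close> and \<open>d2\<close>, and their lengths add up to that of the side.
\<close>

lemma euclidean_cevian:
  fixes s t a b :: real
  assumes "0 < s" "0 < t" "0 < a" "0 < b" "a + b < pi"
  obtains r where "0 < r" "r \<le> max s t"
    "\<And>d1 d2. d1\<^sup>2 \<le> s\<^sup>2 + r\<^sup>2 - 2 * s * r * cos a \<Longrightarrow> d2\<^sup>2 \<le> r\<^sup>2 + t\<^sup>2 - 2 * r * t * cos b \<Longrightarrow>
       0 \<le> d1 + d2 \<Longrightarrow> (d1 + d2)\<^sup>2 \<le> s\<^sup>2 + t\<^sup>2 - 2 * s * t * cos (a + b)"
proof -
  define x where "x = of_real s * cis a"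
  define z where "z = of_real t * cis (- b)"
  have sn: "0 < sin a" "0 < sin b" "0 < sin (a + b)" using assms by (auto intro: sin_gt_zero)
  \<comment> \<open>The sides lie along \<open>x\<close> and \<open>z\<close>, and the cevian along the positive real axis.\<close>
  define w where "w = s * sin a + t * sin b"
  have w: "0 < w" unfolding w_def using assms sn by (intro add_pos_pos mult_pos_pos)
  define l where "l = s * sin a / w"
  have l: "0 < l" "1 - l = t * sin b / w"
    using w assms sn by (auto simp: l_def w_def field_simps)
  have l1: "0 < 1 - l" unfolding l(2) using w assms sn by simp
  define r where "r = s * t * sin (a + b) / w"
  have r: "0 < r" unfolding r_def using w assms sn by simp
  have rp: "of_real r = of_real (1 - l) * x + of_real l * z"
  proof -
    have "Re (of_real (1 - l) * x + of_real l * z) = (t * sin b) / w * (s * cos a) + (s * sin a) / w * (t * cos b)"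
      by (simp add: x_def z_def l(2)) (simp add: l_def)
    also have "\<dots> = r" using w by (simp add: r_def sin_add field_simps)
    finally have "Re (of_real (1 - l) * x + of_real l * z) = r" .
    moreover have "Im (of_real (1 - l) * x + of_real l * z) = (t * sin b) / w * (s * sin a) - (s * sin a) / w * (t * sin b)"
      by (simp add: x_def z_def l(2)) (simp add: l_def)
    then have "Im (of_real (1 - l) * x + of_real l * z) = 0" by simp
    ultimately show ?thesis by (simp add: complex_eq_iff)
  qed
  show thesis
  proof (rule that[OF r])
    have "cmod (of_real r) \<le> cmod (of_real (1 - l) * x) + cmod (of_real l * z)"
      unfolding rp by (rule norm_triangle_ineq)
    also have "\<dots> = (1 - l) * s + l * t"
    proof -
      have "cmod (of_real (1 - l) * x) = (1 - l) * s"
        using assms(1) l1 by (metis abs_of_pos mult.right_neutral norm_cis norm_mult norm_of_real x_def)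
      moreover have "cmod (of_real l * z) = l * t"
        using assms(2) l(1) by (metis abs_of_pos mult.right_neutral norm_cis norm_mult norm_of_real z_def)
      ultimately show ?thesis by (simp only:)
    qed
    also have "\<dots> \<le> (1 - l) * max s t + l * max s t"
      using l(1) l1 by (intro add_mono mult_left_mono) auto
    finally show "r \<le> max s t" using r by (simp add: algebra_simps)
    fix d1 d2 :: real
    assume d1: "d1\<^sup>2 \<le> s\<^sup>2 + r\<^sup>2 - 2 * s * r * cos a" and d2: "d2\<^sup>2 \<le> r\<^sup>2 + t\<^sup>2 - 2 * r * t * cos b"
      and d0: "0 \<le> d1 + d2"
    have "x - of_real r = of_real l * (x - z)" unfolding rp by (simp add: algebra_simps)
    then have n1: "cmod (x - of_real r) = l * cmod (x - z)"
      by (simp only: norm_mult norm_of_real abs_of_pos[OF l(1)])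
    have "of_real r - z = of_real (1 - l) * (x - z)" unfolding rp by (simp add: algebra_simps)
    then have n2: "cmod (of_real r - z) = (1 - l) * cmod (x - z)"
      by (simp only: norm_mult norm_of_real abs_of_pos[OF l1])
    have "s\<^sup>2 + r\<^sup>2 - 2 * s * r * cos a = (cmod (x - of_real r))\<^sup>2"
      using cmod_cis_diff[of s a r 0] by (simp add: x_def)
    with d1 have 1: "d1 \<le> l * cmod (x - z)"
      unfolding n1[symmetric] by (metis norm_ge_zero power2_le_imp_le)
    have "r\<^sup>2 + t\<^sup>2 - 2 * r * t * cos b = (cmod (of_real r - z))\<^sup>2"
      using cmod_cis_diff[of r 0 t "- b"] by (simp add: z_def)
    with d2 have 2: "d2 \<le> (1 - l) * cmod (x - z)"
      unfolding n2[symmetric] by (metis norm_ge_zero power2_le_imp_le)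
    have "d1 + d2 \<le> cmod (x - z)" using 1 2 by (simp add: algebra_simps)
    then have "(d1 + d2)\<^sup>2 \<le> (cmod (x - z))\<^sup>2" using d0 by (intro power_mono)
    also have "\<dots> = s\<^sup>2 + t\<^sup>2 - 2 * s * t * cos (a + b)"
      using cmod_cis_diff[of s a t "- b"] by (simp add: x_def z_def)
    finally show "(d1 + d2)\<^sup>2 \<le> s\<^sup>2 + t\<^sup>2 - 2 * s * t * cos (a + b)" .
  qed
qed

text \<open>
  The triangle inequality for angles. Points \<open>g s\<close> and \<open>k t\<close> are compared with the sides of a Euclidean
  triangle of angle \<open>\<beta>'\<close>; the length of the cevian tells at which time \<open>r\<close> the middle curve has
  to be used.
\<close>

lemma angle_bound_trans:
  fixes g h k :: "real \<Rightarrow> 'm::metric_space"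
  assumes gh: "angle_bound g h \<beta>1" and hk: "angle_bound h k \<beta>2" and pos: "0 \<le> \<beta>1" "0 \<le> \<beta>2"
  shows "angle_bound g k (\<beta>1 + \<beta>2)"
  unfolding angle_bound_def
proof (intro allI impI)
  fix \<beta>' assume \<beta>': "\<beta>1 + \<beta>2 < \<beta>' \<and> \<beta>' < pi"
  \<comment> \<open>The excess of \<open>\<beta>'\<close> is divided evenly between the two angles.\<close>
  define a b where "a = \<beta>1 + (\<beta>' - \<beta>1 - \<beta>2) / 2" and "b = \<beta>2 + (\<beta>' - \<beta>1 - \<beta>2) / 2"
  have ab: "a + b = \<beta>'" by (simp add: a_def b_def field_simps)
  have a: "\<beta>1 < a" "\<beta>2 < b" using \<beta>' by (auto simp: a_def b_def)
  then have apos: "0 < a" "0 < b" "a < pi" "b < pi" using pos ab \<beta>' by linarith+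
  obtain e1 where e1: "0 < e1" "\<And>s t. 0 < s \<Longrightarrow> s < e1 \<Longrightarrow> 0 < t \<Longrightarrow> t < e1 \<Longrightarrow>
      (dist (g s) (h t))\<^sup>2 \<le> s\<^sup>2 + t\<^sup>2 - 2 * s * t * cos a"
    using gh a apos unfolding angle_bound_def by blast
  obtain e2 where e2: "0 < e2" "\<And>s t. 0 < s \<Longrightarrow> s < e2 \<Longrightarrow> 0 < t \<Longrightarrow> t < e2 \<Longrightarrow>
      (dist (h s) (k t))\<^sup>2 \<le> s\<^sup>2 + t\<^sup>2 - 2 * s * t * cos b"
    using hk a apos unfolding angle_bound_def by blast
  have "(dist (g s) (k t))\<^sup>2 \<le> s\<^sup>2 + t\<^sup>2 - 2 * s * t * cos \<beta>'"
    if st: "0 < s" "s < min e1 e2" "0 < t" "t < min e1 e2" for s t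
  proof -
    have "a + b < pi" using ab \<beta>' by simp
    then obtain r where r: "0 < r" "r \<le> max s t"
      "\<And>d1 d2. d1\<^sup>2 \<le> s\<^sup>2 + r\<^sup>2 - 2 * s * r * cos a \<Longrightarrow> d2\<^sup>2 \<le> r\<^sup>2 + t\<^sup>2 - 2 * r * t * cos b \<Longrightarrow>
         0 \<le> d1 + d2 \<Longrightarrow> (d1 + d2)\<^sup>2 \<le> s\<^sup>2 + t\<^sup>2 - 2 * s * t * cos (a + b)"
      using euclidean_cevian[OF st(1,3) apos(1,2)] by blast
    have "r < min e1 e2" using r(2) st by linarith
    have "(dist (g s) (k t))\<^sup>2 \<le> (dist (g s) (h r) + dist (h r) (k t))\<^sup>2"
      by (intro power_mono dist_triangle) auto
    also have "\<dots> \<le> s\<^sup>2 + t\<^sup>2 - 2 * s * t * cos (a + b)"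
      using st r(1) \<open>r < min e1 e2\<close> by (intro r(3) e1(2) e2(2)) auto
    finally show ?thesis by (simp add: ab)
  qed
  then show "\<exists>e>0. \<forall>s t. 0 < s \<longrightarrow> s < e \<longrightarrow> 0 < t \<longrightarrow> t < e \<longrightarrow>
      (dist (g s) (k t))\<^sup>2 \<le> s\<^sup>2 + t\<^sup>2 - 2 * s * t * cos \<beta>'"
    using e1(1) e2(1) by (intro exI[of _ "min e1 e2"]) auto
qed

text \<open>
  Near the starting point the comparison angles are at most any \<open>c > \<beta>\<close>: for \<open>c < \<pi>\<close> by the bound on the
  angle, and otherwise because comparison angles never exceed \<open>\<pi>\<close>.
\<close>

lemma upper_angle_le:
  fixes g h :: "real \<Rightarrow> 'm::metric_space"
  assumes b: "angle_bound g h \<beta>" "0 \<le> \<beta>" and gh: "g 0 = h 0"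
    and d: "0 < d" "\<And>s. 0 < s \<Longrightarrow> s < d \<Longrightarrow> dist (g 0) (g s) = s"
    "\<And>s. 0 < s \<Longrightarrow> s < d \<Longrightarrow> dist (h 0) (h s) = s"
  shows "upper_angle g h \<le> \<beta>"
proof (rule dense_ge)
  fix c assume c: "\<beta> < c"
  let ?p = "g 0"
  have ev: "\<exists>e>0. \<forall>s t. 0 < s \<longrightarrow> s < e \<longrightarrow> 0 < t \<longrightarrow> t < e \<longrightarrow> comparison_angle ?p (g s) (h t) \<le> c"
  proof -
    have cmp: "comparison_angle ?p (g s) (h t) = arccos ((s\<^sup>2 + t\<^sup>2 - (dist (g s) (h t))\<^sup>2) / (2 * s * t))"
      and bd: "-1 \<le> (s\<^sup>2 + t\<^sup>2 - (dist (g s) (h t))\<^sup>2) / (2 * s * t)"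
        "(s\<^sup>2 + t\<^sup>2 - (dist (g s) (h t))\<^sup>2) / (2 * s * t) \<le> 1"
      if st: "0 < s" "s < d" "0 < t" "t < d" for s t
    proof -
      let ?d = "dist (g s) (h t)"
      have ds: "dist ?p (g s) = s" "dist ?p (h t) = t" using d st gh by auto
      show "comparison_angle ?p (g s) (h t) = arccos ((s\<^sup>2 + t\<^sup>2 - ?d\<^sup>2) / (2 * s * t))"
        unfolding comparison_angle_def ds ..
      have "?d \<le> s + t" "s \<le> t + ?d" "t \<le> s + ?d"
        using dist_triangle3[of "g s" "h t" ?p] dist_triangle[of ?p "g s" "h t"] dist_triangle[of ?p "h t" "g s"] ds
        by (auto simp: dist_commute)
      then have "?d\<^sup>2 \<le> (s + t)\<^sup>2" "(s - t)\<^sup>2 \<le> ?d\<^sup>2"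
        using st by (auto intro: power_mono simp: abs_le_square_iff[symmetric])
      then show "-1 \<le> (s\<^sup>2 + t\<^sup>2 - ?d\<^sup>2) / (2 * s * t)" "(s\<^sup>2 + t\<^sup>2 - ?d\<^sup>2) / (2 * s * t) \<le> 1"
        using st by (auto simp: field_simps power2_eq_square)
    qed
    show ?thesis
    proof (cases "c < pi")
      case True
      then obtain e where e: "0 < e" "\<And>s t. 0 < s \<Longrightarrow> s < e \<Longrightarrow> 0 < t \<Longrightarrow> t < e \<Longrightarrow>
         (dist (g s) (h t))\<^sup>2 \<le> s\<^sup>2 + t\<^sup>2 - 2 * s * t * cos c"
        using b(1) c unfolding angle_bound_def by blast
      have "comparison_angle ?p (g s) (h t) \<le> c" if st: "0 < s" "s < min e d" "0 < t" "t < min e d" for s t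
      proof -
        have "cos c \<le> (s\<^sup>2 + t\<^sup>2 - (dist (g s) (h t))\<^sup>2) / (2 * s * t)"
          using e(2)[of s t] st by (simp add: field_simps)
        then have "arccos ((s\<^sup>2 + t\<^sup>2 - (dist (g s) (h t))\<^sup>2) / (2 * s * t)) \<le> arccos (cos c)"
          using bd[of s t] st by (intro arccos_le_arccos) auto
        also have "\<dots> = c" using b(2) c True by (intro arccos_cos) auto
        finally show ?thesis using st by (simp add: cmp)
      qed
      then show ?thesis using e(1) d(1) by (intro exI[of _ "min e d"]) auto
    next
      case False
      have "comparison_angle ?p (g s) (h t) \<le> c" if "0 < s" "s < d" "0 < t" "t < d" for s t
        using arccos_ubound[of "(s\<^sup>2 + t\<^sup>2 - (dist (g s) (h t))\<^sup>2) / (2 * s * t)"] bd[OF that] False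
        by (simp add: cmp[OF that])
      then show ?thesis using d(1) by blast
    qed
  qed
  then obtain e where e: "0 < e" "\<And>s t. 0 < s \<Longrightarrow> s < e \<Longrightarrow> 0 < t \<Longrightarrow> t < e \<Longrightarrow>
      comparison_angle ?p (g s) (h t) \<le> c" by blast
  have "\<forall>\<^sub>F x in at_right 0 \<times>\<^sub>F at_right 0.
      (case x of (s, t) \<Rightarrow> ereal (comparison_angle ?p (g s) (h t))) \<le> ereal c"
    unfolding eventually_prod_filter
  proof (intro exI conjI allI impI)
    show "\<forall>\<^sub>F s in at_right 0. 0 < s \<and> s < e" "\<forall>\<^sub>F s in at_right 0. 0 < s \<and> s < e"
      using e(1) by (auto simp: eventually_at_right)
  qed (use e in auto)
  then have "Limsup (at_right 0 \<times>\<^sub>F at_right 0) (\<lambda>(s, t). ereal (comparison_angle ?p (g s) (h t))) \<le> ereal c"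
    by (rule Limsup_bounded)
  moreover have "real_of_ereal L \<le> c" if "L \<le> ereal c" for L
    using that b(2) c by (cases L) auto
  ultimately show "upper_angle g h \<le> c" unfolding upper_angle_def by blast
qed

text \<open>
  The subdivision of a path that consists of its two end points.
\<close>

lemma dist_le_path_length:
  assumes "pathstart g = x" "pathfinish g = y"
  shows "ennreal (dist x y) \<le> path_length g"
proof -
  have "(\<Sum>i<length [0, 1::real] - 1. ennreal (dist (g ([0, 1] ! i)) (g ([0, 1] ! Suc i)))) \<le> path_length g"
    unfolding path_length_def by (rule SUP_upper) auto
  then show ?thesis using assms by (simp add: pathstart_def pathfinish_def)
qed

text \<open>
  The intrinsic distance is an infimum of lengths, each at least the distance. If no path in \<open>T\<close> is
  rectifiable, the intrinsic distance is 0 by convention; but then the model points coincide.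
\<close>

lemma dist_le_hdist:
  assumes iso: "hyp_isometric_via Q \<tau> T" and p: "p \<in> hhull Q" "q \<in> hhull Q"
  shows "dist (\<tau> p) (\<tau> q) \<le> hdist p q"
proof -
  define I where "I = (INF g \<in> {g. path g \<and> path_image g \<subseteq> T \<and> pathstart g = \<tau> p \<and> pathfinish g = \<tau> q}. path_length g)"
  have h: "enn2real I = hdist p q"
    using iso p by (auto simp: hyp_isometric_via_def intrinsic_dist_def I_def)
  have le: "ennreal (dist (\<tau> p) (\<tau> q)) \<le> I"
    unfolding I_def by (rule INF_greatest) (auto intro: dist_le_path_length)
  show ?thesis
  proof (cases "I = top")
    case True
    have hs: "p \<in> hyp_space" "q \<in> hyp_space" using p by (auto simp: hhull_def)
    have "hdist p q = 0" using h True by simp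
    then have "p = q" using hdist_pos[OF hs] by force
    then show ?thesis using hdist_nonneg[OF hs] by simp
  next
    case False
    then have "enn2real (ennreal (dist (\<tau> p) (\<tau> q))) \<le> enn2real I"
      using le by (intro enn2real_mono) (auto simp: top.not_eq_extremum)
    then show ?thesis by (simp add: h)
  qed
qed

lemma geodesic_on_continuous:
  assumes "geodesic_on dist I g"
  shows "continuous_on I g"
  unfolding continuous_on_iff
proof (intro ballI allI impI)
  fix t \<epsilon> :: real assume t: "t \<in> I" and \<epsilon>: "0 < \<epsilon>"
  then obtain e where e: "0 < e" "\<And>s s'. s \<in> I \<Longrightarrow> s' \<in> I \<Longrightarrow> \<bar>s - t\<bar> < e \<Longrightarrow> \<bar>s' - t\<bar> < e \<Longrightarrow> dist (g s) (g s') = \<bar>s - s'\<bar>"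
    using assms unfolding geodesic_on_def by blast
  then show "\<exists>d>0. \<forall>s\<in>I. dist s t < d \<longrightarrow> dist (g s) (g t) < \<epsilon>"
    using t \<epsilon> by (intro exI[of _ "min e \<epsilon>"]) (auto simp: dist_real_def)
qed

lemma geodesic_on_initial:
  assumes "geodesic_on dist {0..L} g" "0 < L"
  obtains e where "0 < e" "e \<le> L" "\<And>s. 0 \<le> s \<Longrightarrow> s < e \<Longrightarrow> dist (g 0) (g s) = s"
proof -
  have "0 \<in> {0..L}" using assms(2) by simp
  then obtain e where e: "0 < e" "\<And>s s'. s \<in> {0..L} \<Longrightarrow> s' \<in> {0..L} \<Longrightarrow> \<bar>s - 0\<bar> < e \<Longrightarrow> \<bar>s' - 0\<bar> < e \<Longrightarrow> dist (g s) (g s') = \<bar>s - s'\<bar>"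
    using assms unfolding geodesic_on_def by blast
  show thesis
    by (rule that[of "min e L"]) (use e assms(2) in auto)
qed

text \<open>
  Near the common starting point, the parameter on either curve is the distance from that point. A
  point \<open>g s\<close> with \<open>s\<close> small is some \<open>h s'\<close>, and \<open>s'\<close> must be small as well, because the rest of the
  curve \<open>h\<close> is compact and avoids the starting point.
\<close>

lemma geodesics_same_image:
  fixes g h :: "real \<Rightarrow> 'm::metric_space"
  assumes g: "geodesic_on dist {0..L} g" "0 < L" and h: "geodesic_on dist {0..L'} h" "0 < L'" "inj_on h {0..L'}"
    and im: "g ` {0..L} \<subseteq> h ` {0..L'}" and 0: "g 0 = h 0"
  obtains e where "0 < e" "\<And>s. 0 \<le> s \<Longrightarrow> s < e \<Longrightarrow> g s = h s"
proof -
  obtain e1 where e1: "0 < e1" "e1 \<le> L" "\<And>s. 0 \<le> s \<Longrightarrow> s < e1 \<Longrightarrow> dist (g 0) (g s) = s"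
    using geodesic_on_initial[OF g] by blast
  obtain e2 where e2: "0 < e2" "e2 \<le> L'" "\<And>s. 0 \<le> s \<Longrightarrow> s < e2 \<Longrightarrow> dist (h 0) (h s) = s"
    using geodesic_on_initial[OF h(1,2)] by blast
  let ?K = "h ` {e2/2..L'}"
  have "compact ?K"
    using e2 by (intro compact_continuous_image continuous_on_subset[OF geodesic_on_continuous[OF h(1)]]) auto
  moreover have "h 0 \<notin> ?K"
  proof
    assume "h 0 \<in> ?K"
    then obtain s where "h 0 = h s" "e2/2 \<le> s" "s \<le> L'" by auto
    then show False using inj_onD[OF h(3), of 0 s] e2(1) h(2) by auto
  qed
  ultimately have "open (- ?K)" "h 0 \<in> - ?K" using compact_imp_closed by auto
  then obtain \<delta> where "0 < \<delta>" "ball (h 0) \<delta> \<subseteq> - ?K"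
    unfolding open_contains_ball by blast
  then have \<delta>: "0 < \<delta>" "\<And>x. x \<in> ?K \<Longrightarrow> \<delta> \<le> dist (h 0) x"
    by (auto simp: subset_eq not_less[symmetric])
  have "g s = h s" if s: "0 \<le> s" "s < min e1 \<delta>" for s
  proof -
    have d: "dist (h 0) (g s) = s" using e1(3) s 0 by simp
    have "g s \<in> h ` {0..L'}" using im s e1 by auto
    then obtain s' where s': "0 \<le> s'" "s' \<le> L'" "g s = h s'" by auto
    have "h s' \<notin> ?K" using \<delta>(2)[of "h s'"] d s s' by auto
    then have "s' < e2 / 2" using s' by (meson atLeastAtMost_iff image_eqI not_less)
    then have "dist (h 0) (h s') = s'" using e2 s' by (intro e2(3)) auto
    then show ?thesis using d s' by simp
  qed
  then show thesis using that[of "min e1 \<delta>"] e1 \<delta> by auto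
qed

lemma cos_hangle:
  fixes p a b :: h2
  assumes "p \<in> hyp_space" "a \<in> hyp_space" "b \<in> hyp_space" "p \<noteq> a" "p \<noteq> b"
  shows "cos (hangle p a b) = lorentz (hdir p a) (hdir p b)"
    and "0 \<le> hangle p a b" and "hangle p a b \<le> pi"
proof -
  have "lorentz (hdir p a) (hdir p b) = cos_angle (- lorentz a b) (- lorentz p a) (- lorentz p b)"
    using assms by (simp add: lorentz_hdir_hdir cosh_hdist sinh_hdist cos_angle_def)
  moreover have "0 \<le> gram (- lorentz a b) (- lorentz p a) (- lorentz p b)"
  proof -
    have "gram (- lorentz a b) (- lorentz p a) (- lorentz p b) = gram (- lorentz a b) (- lorentz p b) (- lorentz p a)"
      by (simp add: gram_def algebra_simps)
    then show ?thesis using triple_sq_gram[OF assms(1-3)] by (metis zero_le_power2)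
  qed
  ultimately have "\<bar>lorentz (hdir p a) (hdir p b)\<bar> \<le> 1"
    using abs_cos_angle_le_1 lorentz_less_minus_one assms by (metis less_minus_iff)
  then show "cos (hangle p a b) = lorentz (hdir p a) (hdir p b)" "0 \<le> hangle p a b" "hangle p a b \<le> pi"
    by (auto simp: hangle_def abs_le_iff cos_arccos_abs intro: arccos_lbound arccos_ubound)
qed

text \<open>
  The derivative \<open>2 sinh x - 2 x\<close> of \<open>2 cosh x - x\<^sup>2\<close> is nonnegative for \<open>x \<ge> 0\<close>.
\<close>

lemma two_cosh_minus_square_mono:
  fixes c d :: real
  assumes "0 \<le> c" "c \<le> d"
  shows "d\<^sup>2 - c\<^sup>2 \<le> 2 * (cosh d - cosh c)"
proof -
  have "2 * cosh c - c\<^sup>2 \<le> 2 * cosh d - d\<^sup>2"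
  proof (rule DERIV_nonneg_imp_nondecreasing[OF assms(2)])
    fix x assume "c \<le> x" "x \<le> d"
    then have "x \<le> sinh x" 
      using assms(1) real_le_x_sinh[of x] by (simp add: sinh_field_def exp_minus)
    then show "\<exists>y. ((\<lambda>x. 2 * cosh x - x\<^sup>2) has_real_derivative y) (at x) \<and> 0 \<le> y"
      by (intro exI[of _ "2 * sinh x - 2 * x"]) (auto intro!: derivative_eq_intros)
  qed
  then show ?thesis by simp
qed

text \<open>
  The hyperbolic law of cosines expresses \<open>cosh d - cosh (s - t)\<close> for the distance \<open>d\<close>, and passing
  from \<open>2 cosh\<close> to the square decreases differences by \<open>two_cosh_minus_square_mono\<close>. A Taylor
  expansion would not be enough: the error has to be small relative to \<open>s t\<close>, even when \<open>s\<close> and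
  \<open>t\<close> are of different orders of magnitude.
\<close>

lemma hdist_sq_le:
  fixes p a b :: h2
  assumes hyp: "p \<in> hyp_space" "a \<in> hyp_space" "b \<in> hyp_space" "p \<noteq> a" "p \<noteq> b"
    and st: "0 \<le> s" "0 \<le> t"
  shows "(hdist (hgeod p a s) (hgeod p b t))\<^sup>2 \<le> (s - t)\<^sup>2 + 2 * (sinh s * sinh t * (1 - cos (hangle p a b)))"
proof -
  define d where "d = hdist (hgeod p a s) (hgeod p b t)"
  have in_h: "hgeod p a s \<in> hyp_space" "hgeod p b t \<in> hyp_space" using hyp by (auto intro: hgeod_in_hyp_space)
  have d0: "0 \<le> d" unfolding d_def by (rule hdist_nonneg[OF in_h])
  have cd: "cosh d - cosh (s - t) = sinh s * sinh t * (1 - cos (hangle p a b))"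
    using hyp by (simp add: d_def cosh_hdist[OF in_h] lorentz_hgeod_hgeod cos_hangle(1) cosh_diff algebra_simps)
  also have "0 \<le> \<dots>" using st by simp
  finally have "cosh \<bar>s - t\<bar> \<le> cosh d" by simp
  then have "\<bar>s - t\<bar> \<le> d" using d0 cosh_real_nonneg_le_iff by (metis abs_ge_zero)
  from two_cosh_minus_square_mono[OF _ this] cd show ?thesis by (simp add: d_def)
qed

text \<open>
  The bound of \<open>hdist_sq_le\<close> differs from the Euclidean one by the factor \<open>sinh s sinh t / (s t)\<close>, which
  tends to 1.
\<close>

lemma angle_bound_hangle:
  fixes p a b :: h2
  assumes hyp: "p \<in> hyp_space" "a \<in> hyp_space" "b \<in> hyp_space" "p \<noteq> a" "p \<noteq> b"
    and L: "0 < L" "\<And>s t. 0 < s \<Longrightarrow> s < L \<Longrightarrow> 0 < t \<Longrightarrow> t < L \<Longrightarrow>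
      dist (g s) (h t) \<le> hdist (hgeod p a s) (hgeod p b t)"
  shows "angle_bound g h (hangle p a b)"
  unfolding angle_bound_def
proof (intro allI impI)
  let ?\<alpha> = "hangle p a b"
  note ang = cos_hangle[OF hyp]
  fix \<beta>' assume \<beta>': "?\<alpha> < \<beta>' \<and> \<beta>' < pi"
  then have c: "cos \<beta>' < cos ?\<alpha>" using ang by (intro cos_monotone_0_pi) auto
  define u where "u = 1 - cos ?\<alpha>"
  define w where "w = 1 - cos \<beta>'"
  have uw: "0 \<le> u" "u < w" using c by (auto simp: u_def w_def)
  have "((\<lambda>s. (cosh s)\<^sup>2 * u) \<longlongrightarrow> (cosh 0)\<^sup>2 * u) (at (0::real))"
    by (intro tendsto_intros)
  then have "\<forall>\<^sub>F s in at (0::real). (cosh s)\<^sup>2 * u < w" using uw by (auto intro: order_tendstoD)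
  then obtain e where e: "0 < e" "\<And>s. s \<noteq> 0 \<Longrightarrow> \<bar>s\<bar> < e \<Longrightarrow> (cosh s)\<^sup>2 * u < w"
    unfolding eventually_at by (auto simp: dist_real_def)
  have sinh_le: "sinh s \<le> s * cosh s" if "0 \<le> s" for s :: real
  proof -
    have "0 * cosh 0 - sinh 0 \<le> s * cosh s - sinh s"
    proof (rule DERIV_nonneg_imp_nondecreasing[OF that])
      fix x :: real assume "0 \<le> x" "x \<le> s"
      then show "\<exists>y. ((\<lambda>x. x * cosh x - sinh x) has_real_derivative y) (at x) \<and> 0 \<le> y"
        by (intro exI[of _ "x * sinh x"]) (auto intro!: derivative_eq_intros)
    qed
    then show ?thesis by simp
  qed
  have "(dist (g s) (h t))\<^sup>2 \<le> s\<^sup>2 + t\<^sup>2 - 2 * s * t * cos \<beta>'"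
    if st: "0 < s" "s < min e L" "0 < t" "t < min e L" for s t
  proof -
    define m where "m = max s t"
    have m: "0 < m" "m < e" "s \<le> m" "t \<le> m" using st by (auto simp: m_def)
    have "cosh s \<le> cosh m" "cosh t \<le> cosh m" using st m by (auto simp: cosh_real_nonneg_le_iff)
    then have "sinh s \<le> s * cosh m" "sinh t \<le> t * cosh m"
      using sinh_le[of s] sinh_le[of t] st by (smt (verit) mult_left_mono)+
    then have "sinh s * sinh t \<le> (s * cosh m) * (t * cosh m)" using st by (intro mult_mono) auto
    then have "sinh s * sinh t * u \<le> (s * cosh m) * (t * cosh m) * u" using uw(1) by (rule mult_right_mono)
    also have "\<dots> = s * t * ((cosh m)\<^sup>2 * u)" by (simp add: power2_eq_square)
    also have "\<dots> \<le> s * t * w" using e(2)[of m] m st by (intro mult_left_mono) auto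
    finally have "sinh s * sinh t * u \<le> s * t * w" .
    moreover have "(dist (g s) (h t))\<^sup>2 \<le> (hdist (hgeod p a s) (hgeod p b t))\<^sup>2"
      using L(2)[of s t] st by (intro power_mono) auto
    moreover have "\<dots> \<le> (s - t)\<^sup>2 + 2 * (sinh s * sinh t * u)"
      unfolding u_def using hdist_sq_le[OF hyp] st by simp
    ultimately have "(dist (g s) (h t))\<^sup>2 \<le> (s - t)\<^sup>2 + 2 * (s * t * w)" by linarith
    then show ?thesis by (simp add: w_def power2_eq_square algebra_simps)
  qed
  then show "\<exists>e>0. \<forall>s t. 0 < s \<longrightarrow> s < e \<longrightarrow> 0 < t \<longrightarrow> t < e \<longrightarrow>
      (dist (g s) (h t))\<^sup>2 \<le> s\<^sup>2 + t\<^sup>2 - 2 * s * t * cos \<beta>'"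
    using e(1) L(1) by (intro exI[of _ "min e L"]) auto
qed

section \<open>Counting in triangulated surfaces\<close>

definition degree :: "'v set set \<Rightarrow> 'v \<Rightarrow> nat" where
  "degree E a = card {e \<in> E. a \<in> e}"

text \<open>
  The conditions of \<open>polygonal_arc\<close> for a fixed enumeration of the vertices of the arc.
\<close>

locale arc_list =
  fixes ws :: "'v list" and E :: "'v set set"
  assumes len: "2 \<le> length ws" and dist: "distinct ws"
    and E: "E = {{ws ! i, ws ! Suc i} | i. Suc i < length ws}"
begin

lemma incident_edges:
  assumes "j < length ws"
  shows "{e \<in> E. ws ! j \<in> e} =
    (if Suc j < length ws then {{ws ! j, ws ! Suc j}} else {}) \<union>
    (if 0 < j then {{ws ! (j - 1), ws ! j}} else {})"
proof -
  have "ws ! j \<in> {ws ! i, ws ! Suc i} \<longleftrightarrow> i = j \<or> Suc i = j" if "Suc i < length ws" for i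
    using that assms dist by (auto simp: nth_eq_iff_index_eq)
  then have "{e \<in> E. ws ! j \<in> e} = {{ws ! i, ws ! Suc i} | i. Suc i < length ws \<and> (i = j \<or> Suc i = j)}"
    unfolding E by blast
  also have "\<dots> = (if Suc j < length ws then {{ws ! j, ws ! Suc j}} else {}) \<union>
    (if 0 < j then {{ws ! (j - 1), ws ! j}} else {})"
    using assms by (cases j) (auto intro: exI[of _ j])
  finally show ?thesis .
qed

lemma degree_nth:
  assumes "j < length ws"
  shows "degree E (ws ! j) = (if j = 0 \<or> Suc j = length ws then 1 else 2)"
proof -
  have "ws ! (j - 1) \<noteq> ws ! j" "Suc j < length ws \<Longrightarrow> ws ! (j - 1) \<noteq> ws ! Suc j" if "0 < j"
    using that assms dist by (auto simp: nth_eq_iff_index_eq)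
  then show ?thesis
    unfolding degree_def incident_edges[OF assms] using assms len
    by (auto simp: doubleton_eq_iff)
qed

lemma Union_E: "\<Union>E = set ws"
proof (intro equalityI subsetI)
  fix x assume "x \<in> set ws"
  then obtain j where j: "j < length ws" "x = ws ! j" by (metis in_set_conv_nth)
  then have "{e \<in> E. ws ! j \<in> e} \<noteq> {}"
    unfolding incident_edges[OF j(1)] using len by (cases j) auto
  then show "x \<in> \<Union>E" using j by blast
qed (auto simp: E)

lemma degree_one_iff:
  "a \<in> \<Union>E \<Longrightarrow> degree E a = 1 \<longleftrightarrow> a = hd ws \<or> a = last ws"
proof -
  assume "a \<in> \<Union>E"
  then obtain j where j: "j < length ws" "a = ws ! j" unfolding Union_E by (metis in_set_conv_nth)
  have ne: "ws \<noteq> []" using len by auto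
  have "hd ws = ws ! 0" "last ws = ws ! (length ws - 1)"
    using ne by (simp_all add: hd_conv_nth last_conv_nth)
  then show ?thesis
    using j dist len ne degree_nth[OF j(1)] by (auto simp: nth_eq_iff_index_eq)
qed

lemma hd_last: "hd ws \<noteq> last ws" "hd ws \<in> \<Union>E" "last ws \<in> \<Union>E"
proof -
  have ne: "ws \<noteq> []" using len by auto
  then show "hd ws \<noteq> last ws" using dist len
    by (simp add: hd_conv_nth last_conv_nth nth_eq_iff_index_eq)
  show "hd ws \<in> \<Union>E" "last ws \<in> \<Union>E" using ne unfolding Union_E by auto
qed

lemma degree_cases: "a \<in> \<Union>E \<Longrightarrow> degree E a \<in> {1, 2}"
  using degree_nth unfolding Union_E by (metis in_set_conv_nth insertCI)

lemma inj_edges: "inj_on (\<lambda>i. {ws ! i, ws ! Suc i}) {..<length ws - 1}"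
  using dist by (auto simp: inj_on_def doubleton_eq_iff nth_eq_iff_index_eq)

end

lemma polygonal_circle_degree:
  assumes "polygonal_circle E" "a \<in> \<Union>E"
  shows "degree E a = 2"
proof -
  obtain ws where len: "3 \<le> length ws" and dist: "distinct ws"
    and E: "E = {{ws ! i, ws ! (Suc i mod length ws)} | i. i < length ws}"
    using assms(1) by (auto simp: polygonal_circle_def)
  define n where "n = length ws"
  have n: "3 \<le> n" using len by (simp add: n_def)
  obtain i where i: "i < n" "a = ws ! i \<or> a = ws ! (Suc i mod n)"
    using assms(2) unfolding E n_def by auto
  obtain j where j: "j < n" "a = ws ! j"
    using i n by (metis mod_less_divisor less_le_trans zero_less_numeral)
  \<comment> \<open>The predecessor of \<open>j\<close> on the circle.\<close>
  define k where "k = (if j = 0 then n - 1 else j - 1)"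
  have k: "k < n" "Suc k mod n = j" using j n by (auto simp: k_def)
  have uniq: "i = k" if "i < n" "Suc i mod n = j" for i
    using that j n by (cases "Suc i = n") (auto simp: k_def)
  have sj: "Suc j mod n < n" using n by simp
  have ne: "Suc j mod n \<noteq> j" "k \<noteq> j" "k \<noteq> Suc j mod n"
    using j n by (auto simp: k_def mod_Suc split: if_splits)
  have mem: "ws ! j \<in> {ws ! i, ws ! (Suc i mod n)} \<longleftrightarrow> i = j \<or> i = k" if "i < n" for i
  proof -
    have "Suc i mod n < n" using n by simp
    then have "ws ! j = ws ! (Suc i mod n) \<longleftrightarrow> j = Suc i mod n" "ws ! j = ws ! i \<longleftrightarrow> j = i"
      using dist j that by (simp_all add: nth_eq_iff_index_eq n_def)
    then show ?thesis using uniq that k(2) by auto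
  qed
  have "{e \<in> E. a \<in> e} = {{ws ! i, ws ! (Suc i mod n)} | i. i < n \<and> (i = j \<or> i = k)}"
    unfolding E j(2) n_def[symmetric] using mem by blast
  also have "\<dots> = {{ws ! j, ws ! (Suc j mod n)}, {ws ! k, ws ! j}}"
    using j k by auto
  finally have "{e \<in> E. a \<in> e} = {{ws ! j, ws ! (Suc j mod n)}, {ws ! k, ws ! j}}" .
  moreover have "{ws ! j, ws ! (Suc j mod n)} \<noteq> {ws ! k, ws ! j}"
    using ne dist j k sj by (auto simp: doubleton_eq_iff nth_eq_iff_index_eq n_def)
  ultimately show ?thesis by (simp add: degree_def)
qed

locale surface =
  fixes F :: "'v set set"
  assumes surface: "triangulated_surface F"
begin

lemma finite_F: "finite F" and card_triangle: "t \<in> F \<Longrightarrow> card t = 3"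
  using surface by (auto simp: triangulated_surface_def)

lemma finite_triangle: "t \<in> F \<Longrightarrow> finite t"
  using card_triangle[of t] by (intro card_ge_0_finite) simp

lemma finite_vertices: "finite (\<Union>F)"
  using finite_F finite_triangle by blast

lemma finite_edges: "finite (edges F)"
proof (rule finite_subset)
  show "edges F \<subseteq> Pow (\<Union>F)" by (auto simp: edges_def)
qed (simp add: finite_vertices)

text \<open>
  Through this, the shape of the links determines how many triangles contain an edge.
\<close>

lemma degree_link:
  assumes "a \<noteq> v"
  shows "degree (link F v) a = card {t \<in> F. {v, a} \<subseteq> t}"
proof -
  have "{e \<in> link F v. a \<in> e} = (\<lambda>t. t - {v}) ` {t \<in> F. {v, a} \<subseteq> t}"
    using assms by (auto simp: link_def)
  moreover have "inj_on (\<lambda>t. t - {v}) {t \<in> F. {v, a} \<subseteq> t}"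
    by (rule inj_onI) (auto 0 3)
  ultimately show ?thesis by (simp add: degree_def card_image)
qed

lemma link_cases:
  assumes "v \<in> \<Union>F"
  obtains "polygonal_circle (link F v)" | ws where "arc_list ws (link F v)"
  using surface assms unfolding triangulated_surface_def polygonal_arc_def arc_list_def by blast

lemma Union_link: "a \<in> \<Union>(link F v) \<longleftrightarrow> a \<noteq> v \<and> {v, a} \<in> edges F"
  by (auto simp: link_def edges_def)

lemma edge_doubleton:
  assumes "e \<in> edges F" "v \<in> e"
  obtains a where "a \<noteq> v" "e = {v, a}"
proof -
  have "card e = 2" using assms by (simp add: edges_def)
  then obtain x y where "e = {x, y}" "x \<noteq> y" by (metis card_2_iff)
  then show ?thesis using assms(2) that[of x] that[of y] by (cases "v = x") (auto simp: insert_commute)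
qed

lemma edge_degree:
  assumes "e \<in> edges F"
  shows "card {t \<in> F. e \<subseteq> t} \<in> {1, 2}"
proof -
  have "e \<noteq> {}" using assms by (auto simp: edges_def)
  then obtain v where v: "v \<in> e" by blast
  obtain a where a: "a \<noteq> v" "e = {v, a}" using edge_doubleton[OF assms v] .
  have aL: "a \<in> \<Union>(link F v)" unfolding Union_link using a assms by simp
  have "v \<in> \<Union>F" using assms v by (auto simp: edges_def)
  then show ?thesis
  proof (cases rule: link_cases)
    case 1
    then show ?thesis using polygonal_circle_degree[OF 1 aL] degree_link[OF a(1)] a(2) by simp
  next
    case (2 ws)
    interpret arc_list ws "link F v" by fact
    show ?thesis using degree_cases[OF aL] degree_link[OF a(1)] a(2) by simp
  qed
qed

lemma boundary_edge_iff_degree: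
  assumes "a \<noteq> v"
  shows "{v, a} \<in> boundary_edges F \<longleftrightarrow> a \<in> \<Union>(link F v) \<and> degree (link F v) a = 1"
  unfolding Union_link degree_link[OF assms] boundary_edges_def using assms by auto

text \<open>
  A boundary edge at \<open>v\<close> is a vertex of degree 1 in the link, which a circle does not have.
\<close>

lemma boundary_vertex_link:
  assumes "v \<in> boundary_vertices F"
  obtains ws where "arc_list ws (link F v)"
    "\<And>a. a \<noteq> v \<Longrightarrow> {v, a} \<in> boundary_edges F \<longleftrightarrow> a = hd ws \<or> a = last ws"
proof -
  obtain e where e: "e \<in> boundary_edges F" "v \<in> e" using assms by (auto simp: boundary_vertices_def)
  then obtain a where a: "a \<noteq> v" "e = {v, a}" using edge_doubleton by (auto simp: boundary_edges_def)
  have d: "a \<in> \<Union>(link F v)" "degree (link F v) a = 1"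
    using e a boundary_edge_iff_degree by auto
  have "v \<in> \<Union>F" using e by (auto simp: boundary_edges_def edges_def)
  then show thesis
  proof (cases rule: link_cases)
    case 1
    then show ?thesis using polygonal_circle_degree[OF 1 d(1)] d(2) by simp
  next
    case (2 ws)
    interpret arc_list ws "link F v" by fact
    have "{v, a} \<in> boundary_edges F \<longleftrightarrow> a = hd ws \<or> a = last ws" if "a \<noteq> v" for a
      using boundary_edge_iff_degree[OF that] degree_one_iff hd_last by blast
    then show ?thesis using that 2 by blast
  qed
qed

text \<open>
  Double counting: a boundary edge has two ends, and each boundary vertex lies on two boundary
  edges, which correspond to the two ends of its link.
\<close>

lemma card_boundary: "card (boundary_vertices F) = card (boundary_edges F)"
proof -
  have fE: "finite (boundary_edges F)" using finite_edges by (simp add: boundary_edges_def)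
  have fin_e: "finite e" "card e = 2" if "e \<in> boundary_edges F" for e
    using that by (auto simp: boundary_edges_def edges_def intro: card_ge_0_finite)
  have fV: "finite (boundary_vertices F)" unfolding boundary_vertices_def using fE fin_e by blast
  have two: "card {e \<in> boundary_edges F. v \<in> e} = 2" if v: "v \<in> boundary_vertices F" for v
  proof -
    obtain ws where ws: "arc_list ws (link F v)"
      and iff: "\<And>a. a \<noteq> v \<Longrightarrow> {v, a} \<in> boundary_edges F \<longleftrightarrow> a = hd ws \<or> a = last ws"
      using boundary_vertex_link[OF v] by blast
    interpret arc_list ws "link F v" by fact
    have ne: "hd ws \<noteq> v" "last ws \<noteq> v" using hd_last Union_link by auto
    have "{e \<in> boundary_edges F. v \<in> e} = {{v, hd ws}, {v, last ws}}"
    proof (intro equalityI subsetI)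
      fix e assume e: "e \<in> {e \<in> boundary_edges F. v \<in> e}"
      then obtain a where "a \<noteq> v" "e = {v, a}" using edge_doubleton by (auto simp: boundary_edges_def)
      then show "e \<in> {{v, hd ws}, {v, last ws}}" using iff e by auto
    qed (use iff ne in auto)
    then show ?thesis using hd_last(1) ne by (simp add: doubleton_eq_iff)
  qed
  have "2 * card (boundary_edges F) = (\<Sum>e\<in>boundary_edges F. card {v \<in> boundary_vertices F. v \<in> e})"
  proof -
    have "{v \<in> boundary_vertices F. v \<in> e} = e" if "e \<in> boundary_edges F" for e
      using that by (auto simp: boundary_vertices_def)
    then show ?thesis using fin_e by simp
  qed
  also have "\<dots> = 2 * card (boundary_vertices F)"
    by (rule sum_multicount[OF fE fV]) (use two in auto)
  finally show ?thesis by simp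
qed

text \<open>
  Double counting of the pairs of a triangle and one of its edges.
\<close>

lemma triangle_edge_count: "3 * card F + card (boundary_edges F) = 2 * card (edges F)"
proof -
  have three: "card {e \<in> edges F. e \<subseteq> t} = 3" if t: "t \<in> F" for t
  proof -
    have "{e \<in> edges F. e \<subseteq> t} = {e. e \<subseteq> t \<and> card e = 2}" using t by (auto simp: edges_def)
    then show ?thesis using n_subsets[OF finite_triangle[OF t], of 2] card_triangle[OF t]
      by (simp add: numeral_eq_Suc)
  qed
  have "(\<Sum>e\<in>edges F. card {t \<in> F. e \<subseteq> t}) = 3 * card F"
    by (rule sum_multicount[OF finite_edges finite_F]) (use three in auto)
  moreover have "(\<Sum>e\<in>edges F. card {t \<in> F. e \<subseteq> t} + (if e \<in> boundary_edges F then 1 else 0)) = 2 * card (edges F)"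
  proof -
    have "card {t \<in> F. e \<subseteq> t} + (if e \<in> boundary_edges F then 1 else 0) = 2" if "e \<in> edges F" for e
      using edge_degree[OF that] that by (auto simp: boundary_edges_def)
    then show ?thesis by simp
  qed
  moreover have "(\<Sum>e\<in>edges F. if e \<in> boundary_edges F then 1 else 0) = card (boundary_edges F)"
  proof -
    have "edges F \<inter> boundary_edges F = boundary_edges F" by (auto simp: boundary_edges_def)
    then show ?thesis using finite_edges by (simp add: sum.If_cases)
  qed
  ultimately show ?thesis by (simp add: sum.distrib)
qed

lemma boundary_subset: "boundary_vertices F \<subseteq> \<Union>F"
  by (auto simp: boundary_vertices_def boundary_edges_def edges_def)

lemma euler_char_eq:
  "2 * real_of_int (euler_char F) =
    2 * real (card (interior_vertices F)) + real (card (boundary_vertices F)) - real (card F)"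
proof -
  have "card (\<Union>F) = card (interior_vertices F) + card (boundary_vertices F)"
    unfolding interior_vertices_def
    using card_Diff_subset[OF finite_subset[OF boundary_subset finite_vertices] boundary_subset]
      card_mono[OF finite_vertices boundary_subset] by simp
  moreover have "3 * card F + card (boundary_vertices F) = 2 * card (edges F)"
    using triangle_edge_count card_boundary by simp
  then have "3 * real (card F) + card (boundary_vertices F) = 2 * real (card (edges F))"
    by (metis of_nat_add of_nat_mult of_nat_numeral)
  ultimately show ?thesis by (simp add: euler_char_def)
qed

lemma star_as_fan:
  assumes ws: "arc_list ws (link F v)"
  shows "bij_betw (\<lambda>i. {v, ws ! i, ws ! Suc i}) {..<length ws - 1} {t \<in> F. v \<in> t}"
proof -
  interpret arc_list ws "link F v" by fact
  have L: "link F v = (\<lambda>i. {ws ! i, ws ! Suc i}) ` {..<length ws - 1}" unfolding E by auto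
  have "bij_betw (\<lambda>i. {ws ! i, ws ! Suc i}) {..<length ws - 1} (link F v)"
    using inj_edges unfolding L by (rule inj_on_imp_bij_betw)
  moreover have "bij_betw (insert v) (link F v) {t \<in> F. v \<in> t}"
    by (rule bij_betw_byWitness[where f' = "\<lambda>t. t - {v}"]) (auto simp: link_def insert_absorb)
  ultimately show ?thesis by (auto dest: bij_betw_trans simp: comp_def)
qed

end

section \<open>The Gauss--Bonnet inequality\<close>

lemma triangle_angle_eq:
  assumes t: "t = {v, a, b}" "card t = 3"
  shows "triangle_angle P t v = hangle (P t v) (P t a) (P t b)"
  unfolding triangle_angle_def
proof (rule the_equality)
  show "\<exists>a' b'. t = {v, a', b'} \<and> card t = 3 \<and> hangle (P t v) (P t a) (P t b) = hangle (P t v) (P t a') (P t b')"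
    by (rule exI[of _ a], rule exI[of _ b], intro conjI, rule t(1), rule t(2), rule HOL.refl)
  fix \<alpha> assume "\<exists>a' b'. t = {v, a', b'} \<and> card t = 3 \<and> \<alpha> = hangle (P t v) (P t a') (P t b')"
  then obtain a' b' where t': "t = {v, a', b'}" and \<alpha>: "\<alpha> = hangle (P t v) (P t a') (P t b')"
    by (elim exE conjE) (rule that)
  have "card {v, a, b} = 3" "card {v, a', b'} = 3" using t t' by simp_all
  then have "v \<notin> {a, b}" "v \<notin> {a', b'}"
    by (auto simp: card_insert_if split: if_splits)
  moreover have "{v, a, b} = {v, a', b'}" using t(1) t' by simp
  ultimately have "{a, b} = {a', b'}" by (metis Diff_insert_absorb)
  then show "\<alpha> = hangle (P t v) (P t a) (P t b)"
    unfolding \<alpha> by (auto simp: doubleton_eq_iff hangle_commute)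
qed

lemma simplex_points_singleton: "simplex_points {v} = {vertex_point v}"
proof -
  have "x = vertex_point v" if "x \<in> simplex_points {v}" for x
    using that by (auto simp: simplex_points_def vertex_point_def fun_eq_iff)
  moreover have "vertex_point v \<in> simplex_points {v}"
    by (auto simp: simplex_points_def vertex_point_def)
  ultimately show ?thesis by blast
qed

text \<open>
  A triangulated surface whose triangles are mapped to hyperbolic triangles, without any condition
  on the angle sums.
\<close>

locale hyperbolic_triangles = surface F for F :: "'v set set" +
  fixes f :: "('v \<Rightarrow> real) \<Rightarrow> 'm::metric_space"
    and P :: "'v set \<Rightarrow> 'v \<Rightarrow> h2" and \<tau> :: "'v set \<Rightarrow> h2 \<Rightarrow> 'm"
  assumes maps: "maps_to_hyperbolic_triangles F f P \<tau>"
begin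

lemma model_vertex: "t \<in> F \<Longrightarrow> v \<in> t \<Longrightarrow> P t v \<in> hyp_space"
  and model_vertex_neq: "t \<in> F \<Longrightarrow> v \<in> t \<Longrightarrow> a \<in> t \<Longrightarrow> v \<noteq> a \<Longrightarrow> P t v \<noteq> P t a"
proof -
  have *: "P t ` t \<subseteq> hyp_space \<and> inj_on (P t) t" if "t \<in> F"
    using maps that unfolding maps_to_hyperbolic_triangles_def by blast
  show "t \<in> F \<Longrightarrow> v \<in> t \<Longrightarrow> P t v \<in> hyp_space"
    "t \<in> F \<Longrightarrow> v \<in> t \<Longrightarrow> a \<in> t \<Longrightarrow> v \<noteq> a \<Longrightarrow> P t v \<noteq> P t a"
    using * by (blast, metis inj_onD)
qed

lemma model_isometry: "t \<in> F \<Longrightarrow> hyp_isometric_via (P t ` t) (\<tau> t) (f ` simplex_points t)"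
  and model_totally_geodesic: "t \<in> F \<Longrightarrow> totally_geodesic (f ` simplex_points t)"
  and model_face: "t \<in> F \<Longrightarrow> s \<subseteq> t \<Longrightarrow> \<tau> t ` hhull (P t ` s) = f ` simplex_points s"
  using maps by (auto simp: maps_to_hyperbolic_triangles_def)

lemma triangle_vertices:
  assumes "t \<in> F"
  obtains a b c where "t = {a, b, c}" "a \<noteq> b" "a \<noteq> c" "b \<noteq> c"
  using card_triangle[OF assms] by (auto simp: card_3_iff)

lemma triangle_area_eq:
  assumes t: "t \<in> F"
  shows "hyp_area (hhull (P t ` t)) = pi - (\<Sum>v\<in>t. triangle_angle P t v)"
proof -
  obtain a b c where abc: "t = {a, b, c}" "a \<noteq> b" "a \<noteq> c" "b \<noteq> c" using triangle_vertices[OF t] .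
  have perm: "t = {b, a, c}" "t = {c, a, b}" using abc(1) by auto
  have 3: "card t = 3" by (rule card_triangle[OF t])
  interpret hyp_triangle "P t a" "P t b" "P t c"
    using abc t model_vertex model_vertex_neq by unfold_locales auto
  have "(\<Sum>v\<in>t. triangle_angle P t v) = triangle_angle P t a + (triangle_angle P t b + triangle_angle P t c)"
    using abc by (simp add: insert_commute)
  moreover have "P t ` t = {P t a, P t b, P t c}" using abc(1) by blast
  ultimately show ?thesis
    using hyp_area_eq_angle_defect triangle_angle_eq[OF abc(1) 3, of P]
      triangle_angle_eq[OF perm(1) 3, of P] triangle_angle_eq[OF perm(2) 3, of P] by simp
qed

lemma triangle_angle_nonneg:
  assumes t: "t \<in> F" and v: "v \<in> t"
  shows "0 \<le> triangle_angle P t v"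
proof -
  have 3: "card t = 3" by (rule card_triangle[OF t])
  then have "card (t - {v}) = 2" using v by simp
  then obtain a b where ab: "t - {v} = {a, b}" "a \<noteq> b" by (auto simp: card_2_iff)
  then have tv: "t = {v, a, b}" using v by blast
  have in_t: "a \<in> t" "b \<in> t" "v \<noteq> a" "v \<noteq> b" using ab by auto
  show ?thesis
    unfolding triangle_angle_eq[OF tv 3]
    by (rule cos_hangle(2)[OF model_vertex[OF t v] model_vertex[OF t in_t(1)] model_vertex[OF t in_t(2)]
          model_vertex_neq[OF t v in_t(1,3)] model_vertex_neq[OF t v in_t(2,4)]])
qed

context
  fixes t v a
  assumes t: "t \<in> F" and va: "v \<in> t" "a \<in> t" "v \<noteq> a"
begin

lemmas va_hyp = model_vertex[OF t va(1)] model_vertex[OF t va(2)] model_vertex_neq[OF t va]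

lemma hgeod_in_model:
  assumes "s \<in> {0..hdist (P t v) (P t a)}"
  shows "hgeod (P t v) (P t a) s \<in> hhull (P t ` t)"
proof -
  have "hgeod (P t v) (P t a) s \<in> hhull {P t v, P t a}"
    unfolding hhull_pair[OF va_hyp] using assms by blast
  moreover have "hhull {P t v, P t a} \<subseteq> hhull (P t ` t)"
    using va finite_triangle[OF t] by (intro hhull_mono) auto
  ultimately show ?thesis by blast
qed

lemma side_geodesic_image:
  "side_geodesic P \<tau> t v a ` {0..hdist (P t v) (P t a)} = f ` simplex_points {v, a}"
proof -
  have "side_geodesic P \<tau> t v a ` {0..hdist (P t v) (P t a)} = \<tau> t ` hhull {P t v, P t a}"
    unfolding hhull_pair[OF va_hyp] side_geodesic_def by (simp add: image_image)
  also have "\<dots> = f ` simplex_points {v, a}"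
    using model_face[OF t, of "{v, a}"] va by simp
  finally show ?thesis .
qed

lemma side_geodesic_0: "side_geodesic P \<tau> t v a 0 = f (vertex_point v)"
proof -
  have "\<tau> t ` hhull (P t ` {v}) = f ` simplex_points {v}"
    using va by (intro model_face[OF t]) auto
  then show ?thesis
    using hhull_singleton[OF va_hyp(1)]
    by (simp add: side_geodesic_def hgeod_0 simplex_points_singleton)
qed

lemma side_geodesic_inj: "inj_on (side_geodesic P \<tau> t v a) {0..hdist (P t v) (P t a)}"
proof (rule inj_onI)
  fix s s' assume s: "s \<in> {0..hdist (P t v) (P t a)}" "s' \<in> {0..hdist (P t v) (P t a)}"
    and e: "side_geodesic P \<tau> t v a s = side_geodesic P \<tau> t v a s'"
  have "inj_on (\<tau> t) (hhull (P t ` t))"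
    using model_isometry[OF t] by (simp add: hyp_isometric_via_def bij_betw_def)
  then have "hgeod (P t v) (P t a) s = hgeod (P t v) (P t a) s'"
    using e s hgeod_in_model unfolding side_geodesic_def by (meson inj_onD)
  then show "s = s'"
    using hdist_hgeod[OF va_hyp, of s s'] hdist_self[OF hgeod_in_hyp_space[OF va_hyp, of s']] by simp
qed

lemma side_geodesic_geodesic: "geodesic_on dist {0..hdist (P t v) (P t a)} (side_geodesic P \<tau> t v a)"
proof -
  let ?L = "hdist (P t v) (P t a)" and ?T = "f ` simplex_points t"
  have im: "side_geodesic P \<tau> t v a ` {0..?L} \<subseteq> ?T"
    using hgeod_in_model model_face[OF t, of t] by (auto simp: side_geodesic_def)
  have "intrinsic_dist ?T (side_geodesic P \<tau> t v a s) (side_geodesic P \<tau> t v a s') = \<bar>s - s'\<bar>"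
    if "s \<in> {0..?L}" "s' \<in> {0..?L}" for s s'
    using model_isometry[OF t] hgeod_in_model[OF that(1)] hgeod_in_model[OF that(2)] hdist_hgeod[OF va_hyp]
    by (simp add: hyp_isometric_via_def side_geodesic_def)
  then have "geodesic_on (intrinsic_dist ?T) {0..?L} (side_geodesic P \<tau> t v a)"
    unfolding geodesic_on_def by (meson zero_less_one)
  with im show ?thesis
    using model_totally_geodesic[OF t] unfolding totally_geodesic_def by blast
qed

end

lemma side_geodesic_shared:
  assumes "t \<in> F" "t' \<in> F" "v \<in> t" "a \<in> t" "v \<in> t'" "a \<in> t'" "v \<noteq> a"
  obtains e where "0 < e" "\<And>s. 0 \<le> s \<Longrightarrow> s < e \<Longrightarrow> side_geodesic P \<tau> t v a s = side_geodesic P \<tau> t' v a s"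
proof (rule geodesics_same_image)
  show "geodesic_on dist {0..hdist (P t v) (P t a)} (side_geodesic P \<tau> t v a)"
    "geodesic_on dist {0..hdist (P t' v) (P t' a)} (side_geodesic P \<tau> t' v a)"
    using assms by (auto intro: side_geodesic_geodesic)
  show "0 < hdist (P t v) (P t a)" "0 < hdist (P t' v) (P t' a)"
    using assms by (auto intro!: hdist_pos model_vertex dest: model_vertex_neq)
  show "inj_on (side_geodesic P \<tau> t' v a) {0..hdist (P t' v) (P t' a)}"
    using assms by (intro side_geodesic_inj)
qed (use assms that in \<open>simp_all add: side_geodesic_image side_geodesic_0\<close>)

lemma angle_bound_triangle:
  assumes t: "t \<in> F" "t = {v, a, b}"
  shows "angle_bound (side_geodesic P \<tau> t v a) (side_geodesic P \<tau> t v b) (triangle_angle P t v)"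
proof -
  have 3: "card t = 3" by (rule card_triangle[OF t(1)])
  have ne: "v \<noteq> a" "v \<noteq> b" using 3 t(2) by (auto simp: card_insert_if split: if_splits)
  have in_t: "v \<in> t" "a \<in> t" "b \<in> t" using t(2) by auto
  note hyp = model_vertex[OF t(1) in_t(1)] model_vertex[OF t(1) in_t(2)] model_vertex[OF t(1) in_t(3)]
    model_vertex_neq[OF t(1) in_t(1,2) ne(1)] model_vertex_neq[OF t(1) in_t(1,3) ne(2)]
  let ?L = "min (hdist (P t v) (P t a)) (hdist (P t v) (P t b))"
  show ?thesis
    unfolding triangle_angle_eq[OF t(2) 3]
  proof (rule angle_bound_hangle[OF hyp])
    show "0 < ?L" using hyp by (simp add: hdist_pos)
    fix s s' assume "0 < s" "s < ?L" "0 < s'" "s' < ?L"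
    then show "dist (side_geodesic P \<tau> t v a s) (side_geodesic P \<tau> t v b s')
        \<le> hdist (hgeod (P t v) (P t a) s) (hgeod (P t v) (P t b) s')"
      unfolding side_geodesic_def
      by (intro dist_le_hdist[OF model_isometry[OF t(1)]] hgeod_in_model t(1) in_t ne) auto
  qed
qed

text \<open>
  Induction along the fan of triangles at \<open>v\<close>: the new triangle is attached along the side from \<open>v\<close> to
  \<open>ws ! Suc j\<close>, which has to be reparametrized from one triangle to the other.
\<close>

lemma angle_bound_fan:
  assumes ws: "arc_list ws (link F v)" and j: "Suc j < length ws"
  defines "tri \<equiv> \<lambda>i. {v, ws ! i, ws ! Suc i}"
  shows "angle_bound (side_geodesic P \<tau> (tri 0) v (ws ! 0)) (side_geodesic P \<tau> (tri j) v (ws ! Suc j))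
    (\<Sum>i\<le>j. triangle_angle P (tri i) v)"
  using j
proof (induction j)
  have tri: "tri i \<in> F" if "Suc i < length ws" for i
    using bij_betwE[OF star_as_fan[OF ws]] that by (auto simp: tri_def)
  {
    case 0
    show ?case using angle_bound_triangle[OF tri[OF 0]] by (simp add: tri_def)
  next
    case (Suc j)
    have tj: "tri j \<in> F" "tri (Suc j) \<in> F" using tri Suc.prems by auto
    have ne: "v \<noteq> ws ! Suc j" using card_triangle[OF tj(1)] by (auto simp: tri_def card_insert_if split: if_splits)
    obtain e where e: "0 < e" "\<And>s. 0 \<le> s \<Longrightarrow> s < e \<Longrightarrow>
        side_geodesic P \<tau> (tri (Suc j)) v (ws ! Suc j) s = side_geodesic P \<tau> (tri j) v (ws ! Suc j) s"
      by (rule side_geodesic_shared[OF tj(2,1) _ _ _ _ ne]) (auto simp: tri_def)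
    have "angle_bound (side_geodesic P \<tau> (tri 0) v (ws ! 0)) (side_geodesic P \<tau> (tri (Suc j)) v (ws ! Suc j))
      (\<Sum>i\<le>j. triangle_angle P (tri i) v)"
      by (rule angle_bound_cong[OF Suc.IH e(1)]) (use Suc.prems e(2) in auto)
    moreover have "angle_bound (side_geodesic P \<tau> (tri (Suc j)) v (ws ! Suc j))
        (side_geodesic P \<tau> (tri (Suc j)) v (ws ! Suc (Suc j))) (triangle_angle P (tri (Suc j)) v)"
      using angle_bound_triangle[OF tj(2)] by (simp add: tri_def)
    moreover have "0 \<le> triangle_angle P (tri i) v" if "i \<le> Suc j" for i
      using that Suc.prems tri by (intro triangle_angle_nonneg) (auto simp: tri_def)
    ultimately show ?case
      unfolding sum.atMost_Suc by (intro angle_bound_trans sum_nonneg) auto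
  }
qed

text \<open>
  The two boundary edges at \<open>v\<close> are the ends of the fan, in one order or the other.
\<close>

lemma exterior_angle_ge:
  assumes v: "v \<in> boundary_vertices F" and ext: "is_exterior_angle F P \<tau> v \<theta>"
  shows "pi - angle_sum F P v \<le> \<theta>"
proof -
  obtain a b t u where ab: "a \<noteq> b" "{v, a} \<in> boundary_edges F" "t \<in> F" "{v, a} \<subseteq> t"
    "{v, b} \<in> boundary_edges F" "u \<in> F" "{v, b} \<subseteq> u"
    and \<theta>: "\<theta> = pi - upper_angle (side_geodesic P \<tau> t v a) (side_geodesic P \<tau> u v b)"
    using ext unfolding is_exterior_angle_def by (elim exE conjE) (rule that)
  have card2: "card {v, a} = 2" "card {v, b} = 2"
    using ab by (auto simp: boundary_edges_def edges_def)
  then have ne: "v \<noteq> a" "v \<noteq> b" by auto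
  obtain ws where ws: "arc_list ws (link F v)"
    and iff: "\<And>a. a \<noteq> v \<Longrightarrow> {v, a} \<in> boundary_edges F \<longleftrightarrow> a = hd ws \<or> a = last ws"
    using boundary_vertex_link[OF v] by blast
  interpret arc_list ws "link F v" by fact
  define tri where "tri i = {v, ws ! i, ws ! Suc i}" for i
  \<comment> \<open>The index of the last triangle of the fan.\<close>
  define k where "k = length ws - 2"
  have k: "Suc k < length ws" "Suc (Suc k) = length ws" using len by (auto simp: k_def)
  have wsne: "ws \<noteq> []" using len by auto
  have hl: "hd ws = ws ! 0" "last ws = ws ! Suc k"
  proof -
    have "length ws - 1 = Suc k" using k(2) by simp
    then show "hd ws = ws ! 0" "last ws = ws ! Suc k"
      using wsne by (simp_all add: hd_conv_nth last_conv_nth)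
  qed
  have tri: "tri i \<in> F" if "Suc i < length ws" for i
    using bij_betwE[OF star_as_fan[OF ws]] that by (auto simp: tri_def)
  define S where "S = angle_sum F P v"
  have S: "S = (\<Sum>i\<le>k. triangle_angle P (tri i) v)"
  proof -
    have "{..k} = {..<length ws - 1}" using k by auto
    then show ?thesis
      unfolding S_def angle_sum_def tri_def
      using sum.reindex_bij_betw[OF star_as_fan[OF ws], of "\<lambda>t. triangle_angle P t v"] by (simp only:)
  qed
  have S0: "0 \<le> S" unfolding S_def angle_sum_def by (intro sum_nonneg triangle_angle_nonneg) auto
  have fan: "angle_bound (side_geodesic P \<tau> (tri 0) v (ws ! 0)) (side_geodesic P \<tau> (tri k) v (ws ! Suc k)) S"
    unfolding S tri_def by (rule angle_bound_fan[OF ws k(1)])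
  have move: "angle_bound g (side_geodesic P \<tau> t' v x) S"
    if m: "angle_bound g (side_geodesic P \<tau> t0 v x) S" "t0 \<in> F" "t' \<in> F" "{v, x} \<subseteq> t0" "{v, x} \<subseteq> t'" "v \<noteq> x"
    for g t0 t' x
  proof -
    obtain e where "0 < e" "\<And>s. 0 \<le> s \<Longrightarrow> s < e \<Longrightarrow> side_geodesic P \<tau> t' v x s = side_geodesic P \<tau> t0 v x s"
      by (rule side_geodesic_shared[of t' t0 v x]) (use m in auto)
    then show ?thesis using angle_bound_cong[OF m(1)] by simp
  qed
  have t0k: "tri 0 \<in> F" "tri k \<in> F" "{v, ws ! 0} \<subseteq> tri 0" "{v, ws ! Suc k} \<subseteq> tri k"
    using tri k by (auto simp: tri_def)
  have ends: "a = ws ! 0 \<and> b = ws ! Suc k \<or> a = ws ! Suc k \<and> b = ws ! 0"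
    using iff[of a] iff[of b] ab ne hl by auto
  then have "angle_bound (side_geodesic P \<tau> t v a) (side_geodesic P \<tau> u v b) S"
  proof
    assume e: "a = ws ! 0 \<and> b = ws ! Suc k"
    have "angle_bound (side_geodesic P \<tau> (tri 0) v a) (side_geodesic P \<tau> u v b) S"
      by (rule move[of _ "tri k"]) (use fan e t0k ab ne in auto)
    from move[OF angle_bound_sym[OF this] t0k(1) ab(3) _ ab(4) ne(1)] t0k(3) e
    show ?thesis by (auto intro: angle_bound_sym)
  next
    assume e: "a = ws ! Suc k \<and> b = ws ! 0"
    have "angle_bound (side_geodesic P \<tau> (tri 0) v b) (side_geodesic P \<tau> t v a) S"
      by (rule move[of _ "tri k"]) (use fan e t0k ab ne in auto)
    from move[OF angle_bound_sym[OF this] t0k(1) ab(6) _ ab(7) ne(2)] t0k(3) e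
    show ?thesis by auto
  qed
  moreover have "\<exists>d>0. \<forall>s. 0 < s \<longrightarrow> s < d \<longrightarrow> dist (side_geodesic P \<tau> t v x 0) (side_geodesic P \<tau> t v x s) = s"
    if "t \<in> F" "{v, x} \<subseteq> t" "v \<noteq> x" for t x
  proof -
    have "0 < hdist (P t v) (P t x)"
      using that by (auto intro!: hdist_pos model_vertex dest: model_vertex_neq)
    from geodesic_on_initial[OF side_geodesic_geodesic this] that show ?thesis
      by (metis insert_subset less_imp_le)
  qed
  then obtain d1 d2 where
    "0 < d1" "\<forall>s. 0 < s \<longrightarrow> s < d1 \<longrightarrow> dist (side_geodesic P \<tau> t v a 0) (side_geodesic P \<tau> t v a s) = s"
    "0 < d2" "\<forall>s. 0 < s \<longrightarrow> s < d2 \<longrightarrow> dist (side_geodesic P \<tau> u v b 0) (side_geodesic P \<tau> u v b s) = s"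
    using ab ne by metis
  moreover have "side_geodesic P \<tau> t v a 0 = side_geodesic P \<tau> u v b 0"
    using ab ne by (simp add: side_geodesic_0)
  ultimately have "upper_angle (side_geodesic P \<tau> t v a) (side_geodesic P \<tau> u v b) \<le> S"
    using S0 by (intro upper_angle_le[where d = "min d1 d2"]) auto
  then show ?thesis by (simp add: \<theta> S_def)
qed

lemma surface_area_eq:
  "surface_area F P = pi * card F - (\<Sum>v\<in>\<Union>F. angle_sum F P v)"
proof -
  have "surface_area F P = (\<Sum>t\<in>F. pi - (\<Sum>v\<in>t. triangle_angle P t v))"
    unfolding surface_area_def by (simp add: triangle_area_eq)
  also have "\<dots> = pi * card F - (\<Sum>t\<in>F. \<Sum>v\<in>t. triangle_angle P t v)"
    by (simp add: sum_subtractf mult.commute)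
  also have "(\<Sum>t\<in>F. \<Sum>v\<in>t. triangle_angle P t v) = (\<Sum>t\<in>F. \<Sum>v | v \<in> \<Union>F \<and> v \<in> t. triangle_angle P t v)"
    by (intro sum.cong HOL.refl arg_cong2[of _ _ _ _ sum]) auto
  also have "\<dots> = (\<Sum>v\<in>\<Union>F. angle_sum F P v)"
    unfolding angle_sum_def by (rule sum.swap_restrict[OF finite_F finite_vertices])
  finally show ?thesis .
qed

end

theorem theorem5p2:
  fixes \<A> :: "('m::metric_space set \<times> ('m \<Rightarrow> h3)) set"
    and \<T> :: "(h3 set \<times> (h3 \<Rightarrow> 'm)) set"
    and F :: "'v set set" and V :: "'v set"
    and f :: "('v \<Rightarrow> real) \<Rightarrow> 'm"
    and P :: "'v set \<Rightarrow> 'v \<Rightarrow> h2" and \<tau> :: "'v set \<Rightarrow> h2 \<Rightarrow> 'm"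
    and \<theta> :: "'v \<Rightarrow> real"
  assumes "general_hyperbolic_manifold \<A> \<T>"
    and "triangulated_surface F"
    and "hyperbolic_map F V f P \<tau>"
    and "\<forall>c. arc c \<and> path_image c \<subseteq> boundary_points F - vertex_point ` V \<longrightarrow> geodesic_path (f \<circ> c)"
    and "\<forall>v\<in>V. is_exterior_angle F P \<tau> v (\<theta> v)"
  shows "surface_area F P \<le> (\<Sum>v\<in>V. \<theta> v) - 2 * pi * real_of_int (euler_char F)"
proof -
  interpret hyperbolic_triangles F f P \<tau>
    using assms(2,3) by unfold_locales (auto simp: hyperbolic_map_def)
  let ?B = "boundary_vertices F" and ?I = "interior_vertices F"
  have VB: "V \<subseteq> ?B" and int: "\<And>v. v \<in> ?I \<Longrightarrow> 2 * pi \<le> angle_sum F P v"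
    and bdry: "\<And>v. v \<in> ?B - V \<Longrightarrow> pi \<le> angle_sum F P v"
    using assms(3) by (auto simp: hyperbolic_map_def)
  have fin: "finite ?B" "finite ?I" "finite V"
    using finite_subset[OF boundary_subset finite_vertices] finite_vertices VB
    by (auto simp: interior_vertices_def intro: finite_subset)
  have "(\<Sum>v\<in>\<Union>F. angle_sum F P v) = (\<Sum>v\<in>?I. angle_sum F P v) + (\<Sum>v\<in>?B - V. angle_sum F P v) + (\<Sum>v\<in>V. angle_sum F P v)"
    using sum.subset_diff[OF boundary_subset finite_vertices, of "angle_sum F P"]
      sum.subset_diff[OF VB fin(1), of "angle_sum F P"]
    by (simp add: interior_vertices_def)
  also have "\<dots> \<ge> (\<Sum>v\<in>?I. 2 * pi) + (\<Sum>v\<in>?B - V. pi) + (\<Sum>v\<in>V. pi - \<theta> v)"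
    using int bdry exterior_angle_ge VB assms(5)
    by (intro add_mono sum_mono) (auto simp: algebra_simps)
  also have "(\<Sum>v\<in>?B - V. pi) = pi * card ?B - pi * card V"
    using fin VB by (simp add: card_Diff_subset card_mono algebra_simps)
  finally have "2 * pi * card ?I + pi * card ?B - (\<Sum>v\<in>V. \<theta> v) \<le> (\<Sum>v\<in>\<Union>F. angle_sum F P v)"
    by (simp add: sum_subtractf algebra_simps)
  moreover have "2 * pi * euler_char F = pi * (2 * real (card ?I) + real (card ?B) - real (card F))"
    unfolding euler_char_eq[symmetric] by simp
  ultimately show ?thesis
    unfolding surface_area_eq by (simp add: algebra_simps)
qed

end
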